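(* Let $\mathcal C$ be a constraint that is admissible for $[0,1]$, and for each (large enough) $n$ let $(m_1^{(n)},\dots,m_n^{(n)})$ be drawn from the uniform distribution on $\mathcal M_n^{\mathcal C}([0,1])$, all random variables being defined on a common probability space. Then there is a probability measure $\mu^{\mathcal C}$ on $[0,1]$ such that for every $l\in\mathbb N$, as $n\to\infty$, $$(m_1^{(n)},\dots,m_l^{(n)})\to\big(m_1(\mu^{\mathcal C}),\dots,m_l(\mu^{\mathcal C})\big)\quad\text{almost surely},$$ and $\mu^{\mathcal C}$ is of the form $$\mu^{\mathcal C}(dx)=\frac{1}{S_{i_k}(x)\sqrt{x(1-x)}}\,dx,$$ where $S_{i_k}$ is a polynomial of degree at most $i_k$ that is strictly positive on $[0,1]$. Furthermore, $\mu^{\mathcal C}$ is the unique probability measure that minimizes the Kullback--Leibler divergence $\mathcal K(\mu^0|\mu)$ among all $\mu\in\mathcal P^{\mathcal C}([0,1])$.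
   Context: For a Borel set $E\subset\mathbb R$, $\mathcal P(E)$ is the set of Borel probability measures on $E$ possessing moments of all orders, $m_j(\mu):=\int x^j\,d\mu(x)$, and $\mathcal M_n(E):=\{(m_1(\mu),\dots,m_n(\mu)):\mu\in\mathcal P(E)\}$. A constraint $\mathcal C=\{m_{i_1}=c_{i_1},\dots,m_{i_k}=c_{i_k}\}$ consists of finitely many integers $1\le i_1<\dots<i_k$ and real values $c_{i_1},\dots,c_{i_k}$; $k=0$ (no constraint) is allowed, with $i_k:=0$. Put $\mathcal P^{\mathcal C}(E):=\{\mu\in\mathcal P(E): m_{i_j}(\mu)=c_{i_j},\ 1\le j\le k\}$ and $\mathcal M^{\mathcal C}_n(E):=\{(m_1(\mu),\dots,m_n(\mu)):\mu\in\mathcal P^{\mathcal C}(E)\}$. $\mathcal C$ is admissible for $E$ if $\mathcal M^{\mathcal C}_{i_k}(E)\cap\operatorname{Int}\mathcal M_{i_k}(E)\neq\emptyset$ (automatic if $k=0$). Uniform distribution: for $n\ge i_k$, $\mathcal M_n^{\mathcal C}([0,1])$ is identified with its projection to the $n-k$ unconstrained coordinates $(m_j,\ 1\le j\le n,\ j\ne i_1,\dots,i_k)$, a compact convex subset of $[0,1]^{n-k}$ of positive Lebesgue measure; the uniform distribution on $\mathcal M_n^{\mathcal C}([0,1])$ is the push-forward, under this identification, of normalized $(n-k)$-dimensional Lebesgue measure on the projection. $\mu^0(dx):=\frac{1}{\pi\sqrt{x(1-x)}}dx$ on $[0,1]$ is the arcsine distribution, and $\mathcal K(\mu^0|\mu):=\int\log\frac{d\mu^0}{d\mu}\,d\mu^0$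 if $\mu^0\ll\mu$, and $\mathcal K(\mu^0|\mu):=\infty$ otherwise. *)

theory Defs
  imports "HOL-Probability.Probability"
begin

section \<open>Moment spaces\<close>

text \<open>
  A Borel probability measure on a Borel set \<open>E\<close> of reals is represented as a
  probability measure on the Borel sets of the real line that gives mass 1 to \<open>E\<close>.
  A vector in \<open>n\<close>-dimensional Euclidean space is an extensional function on \<open>{1..n}\<close>.
\<close>

definition moment_measures :: "real set \<Rightarrow> real measure set" where
  "moment_measures E =
     {\<mu>. prob_space \<mu> \<and> sets \<mu> = sets borel \<and> emeasure \<mu> E = 1 \<and>
         (\<forall>j::nat. integrable \<mu> (\<lambda>x. x ^ j))}"

definition moment :: "nat \<Rightarrow> real measure \<Rightarrow> real" where
  "moment j \<mu> = (\<integral>x. x ^ j \<partial>\<mu>)"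

definition moment_vector :: "nat \<Rightarrow> real measure \<Rightarrow> (nat \<Rightarrow> real)" where
  "moment_vector n \<mu> = (\<lambda>j\<in>{1..n}. moment j \<mu>)"

definition moment_space :: "nat \<Rightarrow> real set \<Rightarrow> (nat \<Rightarrow> real) set" where
  "moment_space n E = moment_vector n ` moment_measures E"

section \<open>Constraints\<close>

text \<open>
  The constraint \<open>m\<^sub>i = c\<^sub>i\<close> for \<open>i\<close> in a finite set of positive indices is the finite
  partial map \<open>C\<close> with \<open>C i = Some c\<^sub>i\<close> on that set; \<open>last_index\<close> is the largest
  constrained index, and 0 for the empty constraint.
\<close>

definition is_constraint :: "(nat \<rightharpoonup> real) \<Rightarrow> bool" where
  "is_constraint C \<longleftrightarrow> finite (dom C) \<and> 0 \<notin> dom C"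

definition last_index :: "(nat \<rightharpoonup> real) \<Rightarrow> nat" where
  "last_index C = (if dom C = {} then 0 else Max (dom C))"

definition constrained_measures :: "(nat \<rightharpoonup> real) \<Rightarrow> real set \<Rightarrow> real measure set" where
  "constrained_measures C E =
     {\<mu> \<in> moment_measures E. \<forall>i c. C i = Some c \<longrightarrow> moment i \<mu> = c}"

definition constrained_moment_space :: "(nat \<rightharpoonup> real) \<Rightarrow> nat \<Rightarrow> real set \<Rightarrow> (nat \<Rightarrow> real) set" where
  "constrained_moment_space C n E = moment_vector n ` constrained_measures C E"

definition admissible :: "(nat \<rightharpoonup> real) \<Rightarrow> real set \<Rightarrow> bool" where
  "admissible C E \<longleftrightarrow>
     constrained_moment_space C (last_index C) E \<inter>
       (product_topology (\<lambda>_. euclideanreal) {1..last_index C} interior_of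
          moment_space (last_index C) E) \<noteq> {}"

section \<open>The uniform distribution\<close>

definition free_indices :: "(nat \<rightharpoonup> real) \<Rightarrow> nat \<Rightarrow> nat set" where
  "free_indices C n = {1..n} - dom C"

definition free_moment_space :: "(nat \<rightharpoonup> real) \<Rightarrow> nat \<Rightarrow> (nat \<Rightarrow> real) set" where
  "free_moment_space C n =
     (\<lambda>m. restrict m (free_indices C n)) ` constrained_moment_space C n {0..1}"

definition insert_constraint :: "(nat \<rightharpoonup> real) \<Rightarrow> nat \<Rightarrow> (nat \<Rightarrow> real) \<Rightarrow> (nat \<Rightarrow> real)" where
  "insert_constraint C n m = (\<lambda>i\<in>{1..n}. case C i of Some c \<Rightarrow> c | None \<Rightarrow> m i)"

text \<open>
  Meaningful for \<open>n \<ge> last_index C\<close>.  \<open>insert_constraint C n\<close> is the inverse of the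
  projection of the constrained moment space to its free coordinates, and the product of
  the \<open>lborel\<close> is Lebesgue measure on these coordinates.
\<close>

definition uniform_moments :: "(nat \<rightharpoonup> real) \<Rightarrow> nat \<Rightarrow> (nat \<Rightarrow> real) measure" where
  "uniform_moments C n =
     distr (uniform_measure (\<Pi>\<^sub>M i\<in>free_indices C n. lborel) (free_moment_space C n))
       (\<Pi>\<^sub>M i\<in>{1..n}. borel) (insert_constraint C n)"

section \<open>Arcsine distribution and Kullback--Leibler divergence\<close>

text \<open>
  Here and in similar densities, the value at the endpoints 0 and 1 is \<open>_ / 0 = 0\<close>,
  which affects only a Lebesgue null set.
\<close>

definition arcsine :: "real measure" where
  "arcsine = density lborel (\<lambda>x. ennreal (indicat_real {0..1} x / (pi * sqrt (x * (1 - x)))))"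

text \<open>
  The library's \<open>entropy_density (exp 1) \<mu> \<nu>\<close> is the natural logarithm of the derivative of
  \<open>\<nu>\<close> with respect to \<open>\<mu>\<close>, and \<open>absolutely_continuous \<mu> \<nu>\<close> says that \<open>\<nu>\<close> is absolutely
  continuous with respect to \<open>\<mu>\<close>.  The library's real-valued \<open>KL_divergence\<close> is 0 when the
  logarithm is not integrable, whereas the integral is then infinite; so the
  integral is formed here as positive minus negative part in the extended reals.  For
  probability measures the negative part is always finite.
\<close>

definition kullback_leibler :: "'a measure \<Rightarrow> 'a measure \<Rightarrow> ereal" where
  "kullback_leibler \<nu> \<mu> =
     (if absolutely_continuous \<mu> \<nu> then
        enn2ereal (\<integral>\<^sup>+ x. ennreal (entropy_density (exp 1) \<mu> \<nu> x) \<partial>\<nu>) -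
        enn2ereal (\<integral>\<^sup>+ x. ennreal (- entropy_density (exp 1) \<mu> \<nu> x) \<partial>\<nu>)
      else \<infinity>)"

lemma kullback_leibler_eq_KL_divergence:
  assumes "absolutely_continuous \<mu> \<nu>" and "integrable \<nu> (entropy_density (exp 1) \<mu> \<nu>)"
  shows "kullback_leibler \<nu> \<mu> = ereal (KL_divergence (exp 1) \<mu> \<nu>)"
proof -
  let ?h = "entropy_density (exp 1) \<mu> \<nu>"
  obtain r q where "0 \<le> r" "0 \<le> q"
    "(\<integral>\<^sup>+ x. ennreal (?h x) \<partial>\<nu>) = ennreal r"
    "(\<integral>\<^sup>+ x. ennreal (- ?h x) \<partial>\<nu>) = ennreal q"
    "integral\<^sup>L \<nu> ?h = r - q"
    using assms(2) by (rule integrableE)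
  then show ?thesis
    using assms(1) by (simp add: kullback_leibler_def KL_divergence_def enn2ereal_ennreal)
qed

end

theory Submission
  imports Defs
begin

text \<open>
  The fibre of the moment space over fixed moments of order at most \<open>l\<close> has volume at most
  \<open>c * L (A + B) ^ (n - l)\<close> for every pair \<open>A\<close>, \<open>B\<close> of nonnegative polynomials of degree \<open>l + 1\<close>
  of the form \<open>p\<^sup>2\<close>, \<open>x * (1 - x) * r\<^sup>2\<close> (or \<open>x * p\<^sup>2\<close>, \<open>(1 - x) * r\<^sup>2\<close>) with leading coefficients
  \<open>1\<close> and \<open>-1\<close>, where \<open>L\<close> is the moment functional: with \<open>a = L A\<close> and \<open>b = L B\<close>, the next moment
  has \<open>a, b \<ge> 0\<close>, and the combinations \<open>x * p - s * (1 - x) * r\<close>, \<open>p + s * r\<close> (suitably normalized)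
  form a pair for the next order with sum \<open>(A + s\<^sup>2 * B) / (1 + s)\<^sup>2\<close>, whose value is \<open>a * b / (a + b)\<close> for
  \<open>s = a / b\<close>. Equality holds for the orthogonal pair of \<open>L\<close>.

  If \<open>q\<close> maximizes \<open>\<integral> ln q \<partial>arcsine - L q\<close> among the polynomials that only involve constrained
  powers, then \<open>\<mu> = arcsine / q\<close> satisfies the constraint, and \<open>ln y \<le> y - 1\<close> shows that \<open>\<mu>\<close>
  minimizes the divergence. The orthogonal pair of \<open>\<mu>\<close> has a sum proportional to \<open>q\<close>, and \<open>L q\<close> is constant
  on the slice cut out by the constraint; so no slice point has a larger fibre than \<open>\<mu>\<close>, and any
  other one has an exponentially smaller fibre. Almost sure convergence follows by Borel--Cantelli.
\<close>

section \<open>Moment functionals and nonnegative polynomials\<close>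

text \<open>For the orthogonal pair of strictly positive moments, \<open>a\<close> and
  \<open>b\<close> are the distances of the next moment from the two ends of its range, so
  \<open>L (A + B)\<close> is the width of that range; any other pair gives an upper bound for it.
  Integrating \<open>(a * b / \<rho>) ^ k\<close> over a range of width
  \<open>\<rho> = a + b\<close> returns \<open>\<rho> ^ (k + 1)\<close> times a Beta integral free
  of the moments. One recursion thus serves both volume bounds, and the constants cancel in
  quotients of volumes. That the pair of \<open>\<mu>\<close> adds up to a multiple of
  \<open>q\<close> rests on a continuation of the moments with \<open>a = b\<close>: two such steps
  rotate the pair by an angle with cosine \<open>2 * x - 1\<close>. A single point of the slice has
  volume zero. The lower bound is carried to a neighbourhood by mixing with weight
  \<open>\<epsilon>\<close>, at the price of a factor \<open>(1 - \<epsilon>) ^ k\<close>; this is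
  affordable because compactness makes the loss far from \<open>\<mu>\<close> uniform.\<close>

definition moment_functional :: "(nat \<Rightarrow> real) \<Rightarrow> real poly \<Rightarrow> real" where
  "moment_functional m P = (\<Sum>i\<le>degree P. coeff P i * m i)"

lemma moment_functional_eq_sum:
  assumes "degree P \<le> n"
  shows "moment_functional m P = (\<Sum>i\<le>n. coeff P i * m i)"
  unfolding moment_functional_def using assms
  by (intro sum.mono_neutral_left) (auto simp: coeff_eq_0)

lemma moment_functional_add:
  "moment_functional m (P + Q) = moment_functional m P + moment_functional m Q"
proof -
  let ?n = "max (degree P) (degree Q)"
  have "degree (P + Q) \<le> ?n" by (rule degree_add_le_max)
  then show ?thesis
    by (simp add: moment_functional_eq_sum[of _ ?n] sum.distrib distrib_right)
qed

lemma moment_functional_smult: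
  "moment_functional m (smult c P) = c * moment_functional m P"
  by (simp add: moment_functional_eq_sum[of _ "degree P"] degree_smult_le sum_distrib_left mult.assoc)

lemma moment_functional_0 [simp]: "moment_functional m 0 = 0"
  by (simp add: moment_functional_def)

lemma moment_functional_const [simp]: "moment_functional m [:c:] = c * m 0"
  by (simp add: moment_functional_def)

lemma moment_functional_1 [simp]: "moment_functional m 1 = m 0"
  by (simp add: moment_functional_def)

lemma moment_functional_diff:
  "moment_functional m (P - Q) = moment_functional m P - moment_functional m Q"
  using moment_functional_add[of m "P - Q" Q] by simp

lemma moment_functional_monom: "moment_functional m (monom c n) = c * m n"
  by (simp add: moment_functional_eq_sum[of _ n] degree_monom_le if_distrib[of "\<lambda>x. x * _"] cong: if_cong)

lemma moment_functional_cong: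
  assumes "\<And>i. i \<le> n \<Longrightarrow> m i = m' i" and "degree P \<le> n"
  shows "moment_functional m P = moment_functional m' P"
  using assms by (simp add: moment_functional_def)

lemma moment_functional_upd:
  assumes "degree P \<le> n"
  shows "moment_functional (m(n := t)) P = moment_functional m P + coeff P n * (t - m n)"
proof -
  have "moment_functional (m(n := t)) P =
      (\<Sum>i<n. coeff P i * m i) + coeff P n * t"
    unfolding moment_functional_eq_sum[OF assms] lessThan_Suc_atMost[symmetric] by simp
  moreover have "moment_functional m P = (\<Sum>i<n. coeff P i * m i) + coeff P n * m n"
    unfolding moment_functional_eq_sum[OF assms] lessThan_Suc_atMost[symmetric] by simp
  ultimately show ?thesis by (simp add: algebra_simps)
qed

lemma moment_functional_affine:
  "moment_functional (\<lambda>i. a * m i + b * m' i) P = a * moment_functional m P + b * moment_functional m' P"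
  by (simp add: moment_functional_def sum.distrib sum_distrib_left algebra_simps)

lemma moment_functional_integral:
  assumes "\<And>i. i \<le> n \<Longrightarrow> integrable M (\<lambda>x. x ^ i * w x :: real)"
    and "\<And>i. i \<le> n \<Longrightarrow> m i = (\<integral>x. x ^ i * w x \<partial>M)" and "degree P \<le> n"
  shows "moment_functional m P = (\<integral>x. poly P x * w x \<partial>M)"
proof -
  have "(\<integral>x. poly P x * w x \<partial>M) = (\<integral>x. (\<Sum>i\<le>n. coeff P i * (x ^ i * w x)) \<partial>M)"
  proof (rule Bochner_Integration.integral_cong)
    fix x
    have "poly P x = (\<Sum>i\<le>n. coeff P i * x ^ i)"
      unfolding poly_altdef using assms(3)
      by (intro sum.mono_neutral_left) (auto simp: coeff_eq_0)
    then show "poly P x * w x = (\<Sum>i\<le>n. coeff P i * (x ^ i * w x))"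
      by (simp add: sum_distrib_right mult.assoc)
  qed simp
  also have "\<dots> = (\<Sum>i\<le>n. coeff P i * (\<integral>x. x ^ i * w x \<partial>M))"
    using assms(1) by (subst Bochner_Integration.integral_sum) auto
  also have "\<dots> = moment_functional m P"
    using assms(2) by (simp add: moment_functional_eq_sum[OF assms(3)])
  finally show ?thesis by simp
qed

text \<open>Dividing by a linear factor reveals the sign of the quotient only away from the zero
  \<open>z\<close>; continuity supplies it at \<open>z\<close>.\<close>

lemma poly_nonneg_extend:
  fixes P :: "real poly"
  assumes "\<And>x. x \<in> {a..b} \<Longrightarrow> x \<noteq> z \<Longrightarrow> 0 \<le> poly P x" and "a < b" and "x \<in> {a..b}"
  shows "0 \<le> poly P x"
proof (rule ccontr)
  assume neg: "\<not> 0 \<le> poly P x"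
  have "isCont (poly P) x" by simp
  then obtain d where d: "d > 0" "\<And>y. \<bar>y - x\<bar> < d \<Longrightarrow> poly P y < 0"
  proof -
    have "\<forall>\<^sub>F y in nhds x. poly P y < 0"
      using neg \<open>isCont (poly P) x\<close> by (intro order_tendstoD(2)[of _ "poly P x"]) (auto simp: isCont_def tendsto_nhds_iff)
    then show ?thesis
      using that unfolding eventually_nhds_metric dist_real_def by blast
  qed
  have "\<exists>y\<in>{a..b}. y \<noteq> z \<and> \<bar>y - x\<bar> < d"
  proof (cases "x = z")
    case False then show ?thesis using assms(3) d(1) by (intro bexI[of _ x]) auto
  next
    case True
    show ?thesis
    proof (cases "x < b")
      case True
      then show ?thesis using \<open>x = z\<close> assms(3) d(1)
        by (intro bexI[of _ "x + min (d/2) ((b - x)/2)"]) (auto simp: min_def field_simps)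
    next
      case False
      then show ?thesis using \<open>x = z\<close> assms(2,3) d(1)
        by (intro bexI[of _ "x - min (d/2) ((x - a)/2)"]) (auto simp: min_def field_simps)
    qed
  qed
  then show False using assms(1) d(2) by force
qed

text \<open>
  A polynomial version of the theorem of Markov and Lukacs: subtracting its minimum, a polynomial
  that is nonnegative on \<open>[0,1]\<close> acquires a zero there, and one of the factors \<open>x\<close>, \<open>1 - x\<close>,
  \<open>(x - z)\<^sup>2\<close> splits off.
\<close>

lemma positive_on_nonneg_polys:
  fixes F :: "real poly \<Rightarrow> real"
  assumes add: "\<And>P Q. F (P + Q) = F P + F Q" and smult: "\<And>c P. F (smult c P) = c * F P"
    and base: "\<And>i j s. s \<noteq> 0 \<Longrightarrow> i + j + 2 * degree s \<le> n \<Longrightarrow>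
       0 < F ([:0, 1:] ^ i * [:1, -1:] ^ j * s\<^sup>2)"
    and "P \<noteq> 0" "\<And>x. x \<in> {0..1} \<Longrightarrow> 0 \<le> poly P x" "degree P \<le> n"
  shows "0 < F P"
proof -
  \<comment> \<open>The factors that split off are collected in a prefix, and the induction on the
    degree of \<open>P\<close> runs over all prefixes: positivity of \<open>F\<close> at a quotient
    would say nothing about its multiples by \<open>x\<close>, \<open>1 - x\<close> or a
    square.\<close>
  have "0 < F ([:0, 1:] ^ i * [:1, -1:] ^ j * s\<^sup>2 * P)"
    if "s \<noteq> 0" "P \<noteq> 0" "\<forall>x\<in>{0..1}. 0 \<le> poly P x" "i + j + 2 * degree s + degree P \<le> n" for i j s P
    using that
  proof (induction "degree P" arbitrary: i j s P rule: less_induct)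
    case less
    let ?B = "\<lambda>i j (s::real poly). [:0, 1:] ^ i * [:1, -1:] ^ j * s\<^sup>2"
    show ?case
    proof (cases "degree P = 0")
      case True
      then obtain c where P: "P = [:c:]" by (rule degree_eq_zeroE)
      with less.prems have "c > 0" by (auto simp: less_le)
      moreover have "F (?B i j s * P) = c * F (?B i j s)"
        by (simp add: P smult)
      ultimately show ?thesis using base[of s i j] less.prems True by simp
    next
      case False
      have "continuous_on {0..1} (poly P)" by (intro continuous_intros)
      then obtain z where z: "z \<in> {0..1}" and min: "\<And>x. x \<in> {0..1} \<Longrightarrow> poly P z \<le> poly P x"
        using continuous_attains_inf[of "{0..1::real}" "poly P"] by auto
      define c where "c = poly P z"
      define Q where "Q = P - [:c:]"
      have c: "c \<ge> 0" using less.prems z by (simp add: c_def)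
      have degQ: "degree Q = degree P"
        unfolding Q_def using False by (subst diff_conv_add_uminus, subst degree_add_eq_left) auto
      have Q0: "Q \<noteq> 0" using degQ False by auto
      have Qnn: "0 \<le> poly Q x" if "x \<in> {0..1}" for x
        using min[OF that] by (simp add: Q_def c_def)
      have Qz: "poly Q z = 0" by (simp add: Q_def c_def)
      have pos: "0 < F (?B i j s * Q)"
      proof -
        obtain R where R: "Q = [:-z, 1:] * R" using Qz by (auto simp: poly_eq_0_iff_dvd elim: dvdE)
        have R0: "R \<noteq> 0" using Q0 R by auto
        have degR: "degree Q = Suc (degree R)"
          using R0 unfolding R by (subst degree_mult_eq) auto
        consider "z = 0" | "z = 1" | "0 < z" "z < 1" using z by force
        then show ?thesis
        proof cases
          case 1
          have "0 \<le> poly R x" if "x \<in> {0..1}" for x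
          proof (rule poly_nonneg_extend[of 0 1 0 R x])
            fix x :: real assume "x \<in> {0..1}" "x \<noteq> 0"
            then show "0 \<le> poly R x" using Qnn[of x] unfolding R 1 by (simp add: zero_le_mult_iff)
          qed (use that in auto)
          then have "0 < F (?B (Suc i) j s * R)"
            using less.prems R0 degR degQ by (intro less.hyps) auto
          moreover have "?B (Suc i) j s * R = ?B i j s * Q"
            unfolding R 1 by (simp only: power_Suc mult_ac minus_zero)
          ultimately show ?thesis by (simp only:)
        next
          case 2
          have Q: "Q = [:1, -1:] * (- R)"
            unfolding R 2 by (simp add: minus_mult_left[symmetric] algebra_simps)
          have "0 \<le> poly (- R) x" if "x \<in> {0..1}" for x
          proof (rule poly_nonneg_extend[of 0 1 1 "- R" x])
            fix x :: real assume "x \<in> {0..1}" "x \<noteq> 1"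
            moreover have "poly Q x = (x - 1) * poly R x" by (simp add: R 2 algebra_simps)
            ultimately show "0 \<le> poly (- R) x" using Qnn[of x] by (simp add: zero_le_mult_iff)
          qed (use that in auto)
          then have "0 < F (?B i (Suc j) s * (- R))"
            using less.prems R0 degR degQ by (intro less.hyps) auto
          moreover have "?B i (Suc j) s * (- R) = ?B i j s * Q"
            by (subst Q) (simp only: power_Suc mult_ac)
          ultimately show ?thesis by (simp only:)
        next
          case 3
          have QR: "poly Q x = (x - z) * poly R x" for x by (simp add: R algebra_simps)
          have *: "0 \<le> poly R x" if "x \<in> {z..1}" for x
          proof (rule poly_nonneg_extend[of z 1 z R x])
            fix x :: real assume "x \<in> {z..1}" "x \<noteq> z"
            then show "0 \<le> poly R x" using Qnn[of x] 3 QR[of x]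
              by (auto simp: zero_le_mult_iff)
          qed (use that 3 in auto)
          have **: "0 \<le> poly (- R) x" if "x \<in> {0..z}" for x
          proof (rule poly_nonneg_extend[of 0 z z "- R" x])
            fix x :: real assume "x \<in> {0..z}" "x \<noteq> z"
            then show "0 \<le> poly (- R) x" using Qnn[of x] 3 QR[of x]
              by (auto simp: zero_le_mult_iff)
          qed (use that 3 in auto)
          \<comment> \<open>An interior zero is double: \<open>Q\<close> keeps its sign at
            \<open>z\<close> while \<open>x - z\<close> changes it, so \<open>R\<close> has opposite
            signs on the two sides.\<close>
          have "poly R z = 0" using *[of z] **[of z] 3 by simp
          then obtain T where T: "R = [:-z, 1:] * T" by (auto simp: poly_eq_0_iff_dvd elim: dvdE)
          have T0: "T \<noteq> 0" using R0 T by auto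
          have degT: "degree R = Suc (degree T)"
            using T0 unfolding T by (subst degree_mult_eq) auto
          have "0 \<le> poly T x" if "x \<in> {0..1}" for x
          proof (rule poly_nonneg_extend[of 0 1 z T x])
            fix x :: real assume "x \<in> {0..1}" "x \<noteq> z"
            moreover have "poly R x = (x - z) * poly T x" by (simp add: T algebra_simps)
            ultimately show "0 \<le> poly T x"
              using *[of x] **[of x]
              by (cases "x < z") (auto simp: zero_le_mult_iff mult_le_0_iff)
          qed (use that in auto)
          moreover have "degree (s * [:-z, 1:]) = degree s + 1"
            using less.prems by (subst degree_mult_eq) auto
          ultimately have "0 < F (?B i j (s * [:-z, 1:]) * T)"
            using less.prems T0 degR degQ degT by (intro less.hyps) auto
          moreover have "?B i j (s * [:-z, 1:]) * T = ?B i j s * Q"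
            by (simp only: R T power2_eq_square mult_ac)
          ultimately show ?thesis by (simp only:)
        qed
      qed
      have "?B i j s * P = smult c (?B i j s) + ?B i j s * Q"
        by (simp add: Q_def algebra_simps)
      then have "F (?B i j s * P) = c * F (?B i j s) + F (?B i j s * Q)"
        by (simp add: add smult)
      moreover have "0 < F (?B i j s)" using less.prems by (intro base) auto
      ultimately show ?thesis using pos c by (simp add: add_nonneg_pos)
    qed
  qed
  from this[of 1 P 0 0] show ?thesis using assms(4-6) by simp
qed

section \<open>The arcsine distribution\<close>

abbreviation arcsine_density :: "real \<Rightarrow> real" where
  "arcsine_density x \<equiv> indicat_real {0..1} x / (pi * sqrt (x * (1 - x)))"

lemma sets_arcsine [simp, measurable_cong]: "sets arcsine = sets borel"
  by (simp add: arcsine_def)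

lemma space_arcsine [simp]: "space arcsine = UNIV"
  by (simp add: arcsine_def)

text \<open>Under \<open>x = (1 - cos t) / 2\<close> the Jacobian \<open>sin t / 2\<close> equals
  \<open>sqrt (x * (1 - x))\<close>, so the arcsine distribution becomes the uniform distribution on
  \<open>{0..pi}\<close>.\<close>

lemma nn_integral_arcsine:
  assumes [measurable]: "f \<in> borel_measurable borel"
  shows "(\<integral>\<^sup>+x. f x \<partial>arcsine) =
    (\<integral>\<^sup>+t. f ((1 - cos t) / 2) * ennreal (1 / pi) * indicator {0..pi} t \<partial>lborel)"
proof -
  let ?g = "\<lambda>t::real. (1 - cos t) / 2" and ?F = "\<lambda>x. f x * ennreal (arcsine_density x)"
  have [measurable]: "?F \<in> borel_measurable borel" by measurable
  have "(\<integral>\<^sup>+x. f x \<partial>arcsine) = (\<integral>\<^sup>+x. ?F x \<partial>lborel)"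
    by (simp add: arcsine_def nn_integral_density mult.commute)
  also have "\<dots> = (\<integral>\<^sup>+x. ?F x * indicator {?g 0..?g pi} x \<partial>lborel)"
    by (intro nn_integral_cong) (auto simp: indicator_def)
  also have "\<dots> = (\<integral>\<^sup>+t. ?F (?g t) * ennreal (sin t / 2) * indicator {0..pi} t \<partial>lborel)"
    by (rule nn_integral_substitution_aux)
      (auto intro!: derivative_eq_intros continuous_intros simp: sin_ge_zero)
  also have "\<dots> = (\<integral>\<^sup>+t. f (?g t) * ennreal (1 / pi) * indicator {0..pi} t \<partial>lborel)"
  proof (rule nn_integral_cong_AE)
    have "AE t in lborel. t \<noteq> 0 \<and> t \<noteq> pi"
      using AE_lborel_singleton[of 0] AE_lborel_singleton[of pi] by eventually_elim simp
    then show "AE t in lborel. ?F (?g t) * ennreal (sin t / 2) * indicator {0..pi} t =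
        f (?g t) * ennreal (1 / pi) * indicator {0..pi} t"
    proof eventually_elim
      case (elim t)
      show ?case
      proof (cases "t \<in> {0..pi}")
        case True
        then have s: "sin t > 0" using elim by (intro sin_gt_zero) auto
        have "?g t * (1 - ?g t) = (1 - (cos t)\<^sup>2) / 4" by (simp add: power2_eq_square field_simps)
        also have "\<dots> = (sin t / 2)\<^sup>2" by (simp add: sin_squared_eq power_divide)
        finally have "?g t * (1 - ?g t) = (sin t / 2)\<^sup>2" .
        then have "sqrt (?g t * (1 - ?g t)) = sin t / 2"
          using s by simp
        moreover have "?g t \<in> {0..1}" using cos_ge_minus_one[of t] cos_le_one[of t]
          by (simp add: field_simps del: cos_ge_minus_one cos_le_one; linarith)
        ultimately have D: "arcsine_density (?g t) = 1 / (pi * (sin t / 2))"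
          by (simp only: indicator_simps)
        have "ennreal (arcsine_density (?g t)) * ennreal (sin t / 2) = ennreal (1 / pi)"
          unfolding D using s by (subst ennreal_mult[symmetric]) (auto simp: field_simps)
        then show ?thesis by (simp only: mult.assoc)
      qed simp
    qed
  qed
  finally show ?thesis .
qed

lemma prob_space_arcsine: "prob_space arcsine"
proof
  have "emeasure arcsine (space arcsine) = (\<integral>\<^sup>+x. 1 \<partial>arcsine)" by simp
  also have "\<dots> = (\<integral>\<^sup>+t. ennreal (1 / pi) * indicator {0..pi} t \<partial>lborel)"
    by (subst nn_integral_arcsine) auto
  also have "\<dots> = ennreal (1 / pi) * ennreal pi"
    by (simp add: nn_integral_cmult)
  also have "\<dots> = 1" by (subst ennreal_mult[symmetric]) auto
  finally show "emeasure arcsine (space arcsine) = 1" .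
qed

interpretation arcsine: prob_space arcsine by (rule prob_space_arcsine)

lemma AE_arcsine: "AE x in arcsine. x \<in> {0..1}"
  unfolding arcsine_def by (subst AE_density) (auto simp: indicator_def)

lemma AE_arcsine_iff:
  assumes "{x. P x} \<in> sets borel"
  shows "(AE x in arcsine. P x) \<longleftrightarrow> (AE x in lborel. x \<in> {0..1} \<longrightarrow> P x)"
proof -
  \<comment> \<open>At 0 and 1 the density evaluates to \<open>_ / 0 = 0\<close>; these points are
    removed before its positivity is identified with membership in \<open>{0..1}\<close>.\<close>
  have "AE x in lborel. x \<noteq> 0 \<and> x \<noteq> (1::real)"
    using AE_lborel_singleton[of 0] AE_lborel_singleton[of 1] by eventually_elim simp
  then have "AE x in lborel. (0 < arcsine_density x) = (x \<in> {0..1})"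
    by eventually_elim (auto simp: indicator_def)
  then have "(AE x in lborel. 0 < arcsine_density x \<longrightarrow> P x) \<longleftrightarrow> (AE x in lborel. x \<in> {0..1} \<longrightarrow> P x)"
    by (intro eventually_subst) (auto elim!: eventually_mono)
  then show ?thesis
    unfolding arcsine_def by (subst AE_density) (auto simp: ennreal_less_zero_iff)
qed

lemma integrable_arcsine:
  assumes "f \<in> borel_measurable borel" and "\<And>x. x \<in> {0..1} \<Longrightarrow> \<bar>f x\<bar> \<le> (B::real)"
  shows "integrable arcsine f"
proof (rule arcsine.integrable_const_bound[where B = B])
  show "AE x in arcsine. norm (f x) \<le> B"
    using AE_arcsine by eventually_elim (use assms(2) in auto)
qed (use assms(1) in \<open>simp add: measurable_cong_sets[OF sets_arcsine refl]\<close>)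

lemma integrable_arcsine_continuous:
  assumes "f \<in> borel_measurable borel" and "continuous_on {0..1} (f :: real \<Rightarrow> real)"
  shows "integrable arcsine f"
proof -
  have "bounded (f ` {0..1})"
    using assms(2) by (intro compact_imp_bounded compact_continuous_image) auto
  then obtain B where "\<forall>x\<in>{0..1}. \<bar>f x\<bar> \<le> B"
    unfolding bounded_iff by auto
  then show ?thesis using assms(1) by (intro integrable_arcsine[of f B]) auto
qed

text \<open>The arcsine distribution charges every nondegenerate subinterval of
  \<open>{0..1}\<close>, so a continuous function that is nonzero at one point is nonzero on a set
  of positive mass.\<close>

lemma arcsine_continuous_eq_0:
  assumes "f \<in> borel_measurable borel" "continuous_on {0..1} (f :: real \<Rightarrow> real)"
    and "AE x in arcsine. f x = 0" and "x \<in> {0..1}"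
  shows "f x = 0"
proof -
  have ae: "AE x\<in>{0..1} in lborel. f x = 0"
    using assms(1,3) by (subst (asm) AE_arcsine_iff) auto
  show ?thesis
  proof (rule ccontr)
    assume ne: "f x \<noteq> 0"
    have "\<forall>\<^sub>F y in at x within {0..1}. f y \<noteq> 0"
      using assms(2,4) ne unfolding continuous_on_def by (intro tendsto_imp_eventually_ne) auto
    then obtain d where d: "d > 0" "\<And>y. y \<in> {0..1} \<Longrightarrow> y \<noteq> x \<Longrightarrow> dist y x < d \<Longrightarrow> f y \<noteq> 0"
      unfolding eventually_at by auto
    define a where "a = max 0 (x - d/2)"
    define b where "b = min 1 (x + d/2)"
    have ab: "a < b" using assms(4) d(1) by (auto simp: a_def b_def max_def min_def)
    have ne': "f y \<noteq> 0" if "y \<in> {a..b}" for y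
      using that d ne by (cases "y = x") (auto simp: a_def b_def dist_real_def)
    have "AE y in lborel. y \<notin> {a..b}"
      using ae
    proof eventually_elim
      case (elim y)
      then show ?case using ne'[of y] by (auto simp: a_def b_def)
    qed
    then have "emeasure lborel {a..b} = 0"
      by (subst (asm) AE_iff_measurable[of "{a..b}"]) auto
    then show False using ab by simp
  qed
qed

text \<open>Serves to exclude zeros of a limiting denominator: a polynomial vanishing at
  \<open>z\<close> is at most a multiple of \<open>\<bar>x - z\<bar>\<close> in absolute value
  there. The arcsine density is at least \<open>1 / pi\<close>, which leaves a logarithmic
  divergence.\<close>

lemma nn_integral_arcsine_inverse_dist:
  assumes "z \<in> {0..1}"
  shows "(\<integral>\<^sup>+x. inverse (ennreal \<bar>x - z\<bar>) \<partial>arcsine) = \<infinity>"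
proof (rule ccontr)
  let ?h = "\<lambda>x. inverse (ennreal \<bar>x - z\<bar>)"
  assume fin: "(\<integral>\<^sup>+x. ?h x \<partial>arcsine) \<noteq> \<infinity>"
  obtain C where C: "(\<integral>\<^sup>+x. ?h x \<partial>arcsine) = ennreal C" "C \<ge> 0"
    using fin by (cases "\<integral>\<^sup>+x. ?h x \<partial>arcsine") auto
  \<comment> \<open>One side of \<open>z\<close> with a piece of length \<open>e\<close> cut off;
    the side is chosen so that length 1/2 fits into \<open>{0..1}\<close>.\<close>
  define J :: "real \<Rightarrow> real set" where "J e = (if z \<le> 1/2 then {z + e..z + 1/2} else {z - 1/2..z - e})" for e
  have bound: "- ln (2 * e) \<le> C * pi" if e: "0 < e" "e < 1/2" for e :: real
  proof -
    have arc: "ennreal (1 / pi) \<le> ennreal (arcsine_density x)" if "x \<in> {0<..<1}" for x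
    proof -
      have "x * (1 - x) > 0" "x * (1 - x) \<le> 1"
        using that mult_le_one[of x "1 - x"] by auto
      then have "pi * sqrt (x * (1 - x)) \<le> pi" "pi * sqrt (x * (1 - x)) > 0" by auto
      then have "1 / pi \<le> 1 / (pi * sqrt (x * (1 - x)))"
        by (intro divide_left_mono) auto
      then show ?thesis using that by (auto simp: indicator_def intro!: ennreal_leI)
    qed
    have "(\<integral>\<^sup>+x. ennreal (1 / pi) * (ennreal (1 / \<bar>x - z\<bar>) * indicator (J e) x) \<partial>lborel) \<le>
       (\<integral>\<^sup>+x. ennreal (arcsine_density x) * ?h x \<partial>lborel)"
    proof (rule nn_integral_mono_AE)
      have "AE x in lborel. x \<noteq> 0 \<and> x \<noteq> (1::real)"
        using AE_lborel_singleton[of 0] AE_lborel_singleton[of 1] by eventually_elim simp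
      then show "AE x in lborel. ennreal (1 / pi) * (ennreal (1 / \<bar>x - z\<bar>) * indicator (J e) x) \<le>
          ennreal (arcsine_density x) * ?h x"
      proof eventually_elim
        case (elim x)
        show ?case
        proof (cases "x \<in> J e")
          case True
          then have "x \<in> {0<..<1}" "x \<noteq> z" using elim e assms by (auto simp: J_def split: if_splits)
          then show ?thesis
            using arc[of x] True by (auto simp: inverse_ennreal inverse_eq_divide intro!: mult_right_mono)
        qed simp
      qed
    qed
    also have "\<dots> = ennreal C"
      unfolding C(1)[symmetric] arcsine_def by (subst nn_integral_density) auto
    finally have le: "ennreal (1 / pi) * (\<integral>\<^sup>+x. ennreal (1 / \<bar>x - z\<bar>) * indicator (J e) x \<partial>lborel) \<le> ennreal C"
      by (subst (asm) nn_integral_cmult) (auto simp: J_def)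
    have "(\<integral>\<^sup>+x. ennreal (1 / \<bar>x - z\<bar>) * indicator (J e) x \<partial>lborel) = ennreal (- ln (2 * e))"
    proof (cases "z \<le> 1/2")
      case True
      have "(\<integral>\<^sup>+x. ennreal (1 / \<bar>x - z\<bar>) * indicator {z + e..z + 1/2} x \<partial>lborel) =
          ennreal (ln (z + 1/2 - z) - ln (z + e - z))"
        using e by (intro nn_integral_FTC_Icc) (auto intro!: derivative_eq_intros)
      then show ?thesis using True e by (simp add: J_def ln_mult ln_div)
    next
      case False
      have "(\<integral>\<^sup>+x. ennreal (1 / \<bar>x - z\<bar>) * indicator {z - 1/2..z - e} x \<partial>lborel) =
          ennreal (- ln (z - (z - e)) - - ln (z - (z - 1/2)))"
        using e by (intro nn_integral_FTC_Icc) (auto intro!: derivative_eq_intros simp: field_simps)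
      then show ?thesis using False e by (simp add: J_def ln_mult ln_div algebra_simps)
    qed
    then have "ennreal (1 / pi * - ln (2 * e)) \<le> ennreal C"
      using le e by (subst ennreal_mult) auto
    then have "1 / pi * - ln (2 * e) \<le> C" using C(2) by (auto simp: ennreal_le_iff2 intro: order_trans)
    then show ?thesis by (simp add: field_simps)
  qed
  have "- (C * pi) - 1 < 0" using mult_nonneg_nonneg[OF C(2) pi_ge_zero] by linarith
  \<comment> \<open>For this \<open>e\<close>, the quantity \<open>- ln (2 * e)\<close> equals
    \<open>C * pi + 1\<close>.\<close>
  then show False
    using bound[of "exp (- (C * pi) - 1) / 2"] by simp
qed

section \<open>Extremal pairs of polynomials\<close>

text \<open>Only degree bounds are assumed, so test polynomials whose leading coefficient may vanish
  are covered without a case distinction.\<close>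

lemma coeff_mult_top:
  fixes p q :: "'a::comm_semiring_0 poly"
  assumes "degree p \<le> a" "degree q \<le> b"
  shows "coeff (p * q) (a + b) = coeff p a * coeff q b"
proof -
  have "coeff p i * coeff q (a + b - i) = 0" if "i \<le> a + b" "i \<noteq> a" for i
    using assms that by (cases "i < a") (simp_all add: coeff_eq_0)
  then have "coeff (p * q) (a + b) = (\<Sum>i\<in>{a}. coeff p i * coeff q (a + b - i))"
    unfolding coeff_mult by (intro sum.mono_neutral_right) auto
  then show ?thesis by simp
qed

lemma degree_mult_le_add: "degree p \<le> a \<Longrightarrow> degree q \<le> b \<Longrightarrow> degree (p * q) \<le> a + b"
  for p q :: "'a::comm_semiring_0 poly"
  using degree_mult_le[of p q] by linarith

lemma degree_le_if_coeff_0: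
  fixes p :: "'a::zero poly"
  assumes "degree p \<le> Suc n" "coeff p (Suc n) = 0"
  shows "degree p \<le> n"
  using assms by (metis degree_le coeff_eq_0 le_antisym not_less_eq_eq not_less)

text \<open>Merges the two shapes of the extremal polynomials: for odd \<open>l\<close> they are
  \<open>p\<^sup>2\<close> and \<open>x * (1 - x) * r\<^sup>2\<close>, for even \<open>l\<close>
  they are \<open>x * p\<^sup>2\<close> and \<open>(1 - x) * r\<^sup>2\<close>.\<close>

definition odd_factor :: "nat \<Rightarrow> real poly" where
  "odd_factor n = (if even n then 1 else [:0, 1:])"

lemma odd_factor_Suc_Suc [simp]: "odd_factor (Suc (Suc n)) = odd_factor n"
  by (simp add: odd_factor_def)

lemma odd_factor_add_even [simp]: "odd_factor (n + 2 * j) = odd_factor n"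
  by (simp add: odd_factor_def)

lemma poly_odd_factor_nonneg: "0 \<le> x \<Longrightarrow> 0 \<le> poly (odd_factor n) x"
  by (simp add: odd_factor_def)

lemma odd_factor_neq_0 [simp]: "odd_factor n \<noteq> 0"
  by (simp add: odd_factor_def)

lemma odd_factor_eq_power: "odd_factor n = [:0, 1:] ^ (n mod 2)"
  by (auto simp: odd_factor_def odd_iff_mod_2_eq_one)

lemma degree_odd_factor: "degree (odd_factor n) = n mod 2"
  by (simp add: odd_factor_def odd_iff_mod_2_eq_one)

lemma coeff_odd_factor: "coeff (odd_factor n) (n mod 2) = 1"
  by (auto simp: odd_factor_def odd_iff_mod_2_eq_one even_iff_mod_2_eq_zero)

text \<open>
  The polynomials of degree \<open>l + 1\<close> with leading coefficient \<open>1\<close> (and \<open>-1\<close>, respectively)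
  among which the extremal nonnegative polynomials on \<open>[0,1]\<close> are found.
\<close>

definition lower_poly :: "nat \<Rightarrow> real poly \<Rightarrow> real poly" where
  "lower_poly l p = odd_factor (Suc l) * p\<^sup>2"

definition upper_poly :: "nat \<Rightarrow> real poly \<Rightarrow> real poly" where
  "upper_poly l r = odd_factor l * [:1, -1:] * r\<^sup>2"

text \<open>The two degrees are those that give \<open>lower_poly\<close> and
  \<open>upper_poly\<close> the degree \<open>Suc l\<close>; the factor \<open>1 - x\<close> makes
  the leading coefficient of the latter \<open>-1\<close>.\<close>

definition monic_pair :: "nat \<Rightarrow> real poly \<Rightarrow> real poly \<Rightarrow> bool" where
  "monic_pair l p r \<longleftrightarrow> degree p \<le> Suc l div 2 \<and> coeff p (Suc l div 2) = 1 \<and>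
     degree r \<le> l div 2 \<and> coeff r (l div 2) = 1"

text \<open>Orthogonal polynomials for the functional weighted by \<open>odd_factor (Suc l)\<close>
  and by \<open>odd_factor l * (1 - x)\<close>. Lower degree is expressed by a bound together with a
  vanishing top coefficient, a linear condition that leaves only \<open>u = 0\<close> when the bound
  is 0.\<close>

definition orthogonal_pair :: "nat \<Rightarrow> (nat \<Rightarrow> real) \<Rightarrow> real poly \<Rightarrow> real poly \<Rightarrow> bool" where
  "orthogonal_pair l m p r \<longleftrightarrow>
     (\<forall>u. degree u \<le> Suc l div 2 \<longrightarrow> coeff u (Suc l div 2) = 0 \<longrightarrow>
        moment_functional m (odd_factor (Suc l) * p * u) = 0) \<and>
     (\<forall>u. degree u \<le> l div 2 \<longrightarrow> coeff u (l div 2) = 0 \<longrightarrow>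
        moment_functional m (odd_factor l * [:1, -1:] * r * u) = 0)"

text \<open>Here \<open>c\<close> is the ratio of the distances of the next moment from the ends of
  its range, and \<open>c / (1 + c)\<close> is then its relative position, the canonical moment. The
  division by \<open>1 + c\<close> restores leading coefficient 1.\<close>

definition next_lower :: "real \<Rightarrow> nat \<Rightarrow> real poly \<Rightarrow> real poly \<Rightarrow> real poly" where
  "next_lower c l p r = smult (1 / (1 + c)) (odd_factor (Suc l) * p - smult c ([:1, -1:] * r))"

definition next_upper :: "real \<Rightarrow> nat \<Rightarrow> real poly \<Rightarrow> real poly \<Rightarrow> real poly" where
  "next_upper c l p r = smult (1 / (1 + c)) (p + smult c (odd_factor l * r))"

text \<open>The leading terms of the summands cancel, so the value depends on the first
  \<open>l\<close> moments only.\<close>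

definition gap_poly :: "nat \<Rightarrow> real poly \<Rightarrow> real poly \<Rightarrow> real poly" where
  "gap_poly l p r = lower_poly l p + upper_poly l r"

lemma lower_poly_nonneg: "0 \<le> x \<Longrightarrow> 0 \<le> poly (lower_poly l p) x"
  by (simp add: lower_poly_def poly_odd_factor_nonneg)

lemma poly_upper_poly: "poly (upper_poly l r) x = poly (odd_factor l) x * ((1 - x) * (poly r x)\<^sup>2)"
  by (simp add: upper_poly_def algebra_simps)

lemma upper_poly_nonneg: "0 \<le> x \<Longrightarrow> x \<le> 1 \<Longrightarrow> 0 \<le> poly (upper_poly l r) x"
  by (simp add: poly_upper_poly poly_odd_factor_nonneg)

text \<open>The two parity factors multiply to \<open>x\<close>, so the cross terms
  \<open>2 * c * x * (1 - x) * p * r\<close> cancel, and the remaining squares recombine through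
  \<open>x + (1 - x) = 1\<close>.\<close>

lemma gap_poly_next:
  assumes "c \<noteq> -1"
  shows "gap_poly (Suc l) (next_lower c l p r) (next_upper c l p r) =
    smult (1 / (1 + c)\<^sup>2) (lower_poly l p + smult (c\<^sup>2) (upper_poly l r))"
proof -
  define x :: "real poly" where "x = [:0, 1:]"
  have [simp]: "[:1, -1:] = 1 - x" by (simp add: x_def one_pCons)
  have s: "next_lower c l p r = [:1 / (1 + c):] * (odd_factor (Suc l) * p - [:c:] * ((1 - x) * r))"
    and t: "next_upper c l p r = [:1 / (1 + c):] * (p + [:c:] * (odd_factor l * r))"
    by (simp_all add: next_lower_def next_upper_def)
  have k: "smult (1 / (1 + c)\<^sup>2) Q = [:1 / (1 + c):]\<^sup>2 * Q" and k2: "smult (c\<^sup>2) Q = [:c:]\<^sup>2 * Q" for Q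
    by (simp_all add: power2_eq_square)
  have id: "X * (C * (X' * p - D * ((1 - x) * r)))\<^sup>2 + X' * (1 - x) * (C * (p + D * (X * r)))\<^sup>2 =
      C\<^sup>2 * (X' * p\<^sup>2 + D\<^sup>2 * (X * (1 - x) * r\<^sup>2))" if "X * X' = x" "X = 1 \<or> X' = 1" for X X' C D
    using that by (auto simp: power2_eq_square algebra_simps)
  have "odd_factor l * odd_factor (Suc l) = x" "odd_factor l = 1 \<or> odd_factor (Suc l) = 1"
    by (auto simp: odd_factor_def x_def)
  from id[OF this, of "[:1 / (1 + c):]" "[:c:]"] show ?thesis
    unfolding gap_poly_def lower_poly_def upper_poly_def s t k k2 by simp
qed

lemma monic_pair_0 [simp]: "monic_pair 0 1 1"
  by (simp add: monic_pair_def)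

lemma
  assumes "monic_pair l p r"
  shows degree_lower_poly: "degree (lower_poly l p) \<le> Suc l"
    and coeff_lower_poly: "coeff (lower_poly l p) (Suc l) = 1"
    and degree_upper_poly: "degree (upper_poly l r) \<le> Suc l"
    and coeff_upper_poly: "coeff (upper_poly l r) (Suc l) = -1"
    and degree_gap_poly: "degree (gap_poly l p r) \<le> l"
proof -
  have a: "Suc l mod 2 + (Suc l div 2 + Suc l div 2) = Suc l" by presburger
  have b: "(l mod 2 + 1) + (l div 2 + l div 2) = Suc l" by presburger
  show 1: "degree (lower_poly l p) \<le> Suc l"
    unfolding lower_poly_def power2_eq_square using assms
    by (subst a[symmetric], intro degree_mult_le_add) (auto simp: degree_odd_factor monic_pair_def)
  have "degree (p * p) \<le> Suc l div 2 + Suc l div 2" "coeff (p * p) (Suc l div 2 + Suc l div 2) = 1"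
    using assms by (auto simp: monic_pair_def coeff_mult_top intro: degree_mult_le_add)
  from coeff_mult_top[OF eq_refl[OF degree_odd_factor[of "Suc l"]] this(1)] this(2)
  show 2: "coeff (lower_poly l p) (Suc l) = 1"
    unfolding lower_poly_def power2_eq_square a by (simp only: coeff_odd_factor mult_1_right)
  have 3: "degree (odd_factor l * [:1, -1:]) \<le> l mod 2 + 1"
    by (intro degree_mult_le_add) (auto simp: degree_odd_factor)
  have 4: "coeff (odd_factor l * [:1, -1:]) (l mod 2 + 1) = -1"
    by (subst coeff_mult_top) (auto simp: degree_odd_factor coeff_odd_factor)
  then have 4: "coeff (odd_factor l * [:1, -1:]) (Suc (l mod 2)) = -1" by (simp only: Suc_eq_plus1)
  show 5: "degree (upper_poly l r) \<le> Suc l"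
    unfolding upper_poly_def power2_eq_square using assms
    by (subst b[symmetric], intro degree_mult_le_add 3) (auto simp: monic_pair_def)
  have "degree (r * r) \<le> l div 2 + l div 2" "coeff (r * r) (l div 2 + l div 2) = 1"
    using assms by (auto simp: monic_pair_def coeff_mult_top intro: degree_mult_le_add)
  from coeff_mult_top[OF 3 this(1)] this(2) show 6: "coeff (upper_poly l r) (Suc l) = -1"
    unfolding upper_poly_def power2_eq_square b by (simp only: 4 Suc_eq_plus1[symmetric] mult_1_right)
  show "degree (gap_poly l p r) \<le> l"
    unfolding gap_poly_def by (rule degree_le_if_coeff_0) (simp_all add: 1 2 5 6 degree_add_le)
qed

lemma monic_pair_next:
  assumes "monic_pair l p r" "c \<noteq> -1"
  shows "monic_pair (Suc l) (next_lower c l p r) (next_upper c l p r)"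
proof -
  have a: "Suc (Suc l) div 2 = Suc l mod 2 + Suc l div 2" by presburger
  have b: "Suc (Suc l) div 2 = 1 + l div 2" by presburger
  have d: "Suc l div 2 = l mod 2 + l div 2" by presburger
  have "degree (odd_factor (Suc l) * p) \<le> Suc (Suc l) div 2"
    unfolding a using assms(1)
    by (intro degree_mult_le_add) (auto simp: degree_odd_factor monic_pair_def)
  moreover have "degree ([:1, -1:] * r) \<le> Suc (Suc l) div 2"
    unfolding b using assms(1) by (intro degree_mult_le_add) (auto simp: monic_pair_def)
  moreover have "coeff (odd_factor (Suc l) * p) (Suc (Suc l) div 2) = 1"
    unfolding a using assms(1)
    by (subst coeff_mult_top) (auto simp: degree_odd_factor coeff_odd_factor monic_pair_def)
  moreover have "coeff ([:1, -1:] * r) (Suc (Suc l) div 2) = -1"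
    unfolding b using assms(1) by (subst coeff_mult_top) (auto simp: monic_pair_def)
  moreover have "degree (odd_factor l * r) \<le> Suc l div 2"
    unfolding d using assms(1)
    by (intro degree_mult_le_add) (auto simp: degree_odd_factor monic_pair_def)
  moreover have "coeff (odd_factor l * r) (Suc l div 2) = 1"
    unfolding d using assms(1)
    by (subst coeff_mult_top) (auto simp: degree_odd_factor coeff_odd_factor monic_pair_def)
  ultimately show ?thesis
    using assms unfolding monic_pair_def next_lower_def next_upper_def
    by (auto intro!: degree_diff_le degree_add_le order_trans[OF degree_smult_le]
        simp: divide_simps add.commute simp del: mult_pCons_left)
qed

text \<open>Subtracting the multiple of \<open>p\<close> with the same top coefficient leaves a
  polynomial to which \<open>p\<close> is orthogonal.\<close>

lemma orthogonal_pair_lower_top: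
  assumes "orthogonal_pair l m p r" "monic_pair l p r" "degree w \<le> Suc l div 2"
  shows "moment_functional m (odd_factor (Suc l) * p * w) =
    coeff w (Suc l div 2) * moment_functional m (lower_poly l p)"
proof -
  let ?k = "Suc l div 2" and ?c = "coeff w (Suc l div 2)"
  define u where "u = w - smult ?c p"
  have "degree u \<le> ?k" "coeff u ?k = 0"
    using assms(2,3) unfolding u_def monic_pair_def
    by (auto intro!: degree_diff_le order_trans[OF degree_smult_le])
  then have "moment_functional m (odd_factor (Suc l) * p * u) = 0"
    using assms(1) by (auto simp: orthogonal_pair_def)
  moreover have "odd_factor (Suc l) * p * w = smult ?c (lower_poly l p) + odd_factor (Suc l) * p * u"
    by (simp add: u_def lower_poly_def power2_eq_square algebra_simps)
  ultimately show ?thesis by (simp add: moment_functional_add moment_functional_smult)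
qed

lemma orthogonal_pair_upper_top:
  assumes "orthogonal_pair l m p r" "monic_pair l p r" "degree w \<le> l div 2"
  shows "moment_functional m (odd_factor l * [:1, -1:] * r * w) =
    coeff w (l div 2) * moment_functional m (upper_poly l r)"
proof -
  let ?k = "l div 2" and ?c = "coeff w (l div 2)"
  define u where "u = w - smult ?c r"
  have "degree u \<le> ?k" "coeff u ?k = 0"
    using assms(2,3) unfolding u_def monic_pair_def
    by (auto intro!: degree_diff_le order_trans[OF degree_smult_le])
  then have "moment_functional m (odd_factor l * [:1, -1:] * r * u) = 0"
    using assms(1) by (auto simp: orthogonal_pair_def)
  moreover have "odd_factor l * [:1, -1:] * r * w =
      smult ?c (upper_poly l r) + odd_factor l * [:1, -1:] * r * u"
    unfolding u_def upper_poly_def power2_eq_square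
    by (simp only: right_diff_distrib mult_smult_right mult.assoc smult_diff_right)
  ultimately show ?thesis by (simp add: moment_functional_add moment_functional_smult)
qed

text \<open>Tested against \<open>u\<close>, the two summands of each new polynomial give the same
  coefficient of \<open>u\<close> times the lower value and times \<open>c\<close> times the upper
  value, with opposite signs. The condition on \<open>c\<close> is exactly their
  cancellation.\<close>

lemma orthogonal_pair_next:
  assumes o: "orthogonal_pair l m p r" and mp: "monic_pair l p r"
    and c: "moment_functional m (lower_poly l p) = c * moment_functional m (upper_poly l r)"
  shows "orthogonal_pair (Suc l) m (next_lower c l p r) (next_upper c l p r)"
  unfolding orthogonal_pair_def
proof (intro conjI allI impI)
  have d: "Suc l div 2 = l mod 2 + l div 2" by presburger
  fix u :: "real poly"
  assume "degree u \<le> Suc (Suc l) div 2" "coeff u (Suc (Suc l) div 2) = 0"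
  then have u: "degree u \<le> l div 2" by (intro degree_le_if_coeff_0[of u "l div 2"]) auto
  have *: "degree (odd_factor l * u) \<le> Suc l div 2"
    unfolding d using u by (intro degree_mult_le_add) (auto simp: degree_odd_factor)
  have **: "coeff (odd_factor l * u) (Suc l div 2) = coeff u (l div 2)"
    unfolding d using u by (subst coeff_mult_top) (auto simp: degree_odd_factor coeff_odd_factor)
  have "odd_factor (Suc (Suc l)) * next_lower c l p r * u =
      smult (1 / (1 + c)) (odd_factor (Suc l) * p * (odd_factor l * u)
        - smult c (odd_factor l * [:1, -1:] * r * u))"
    unfolding next_lower_def odd_factor_Suc_Suc
    by (simp only: mult_smult_left mult_smult_right left_diff_distrib right_diff_distrib mult_ac)
  then show "moment_functional m (odd_factor (Suc (Suc l)) * next_lower c l p r * u) = 0"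
    using c orthogonal_pair_lower_top[OF o mp *] orthogonal_pair_upper_top[OF o mp u]
    by (simp only: moment_functional_smult moment_functional_diff **) simp
next
  fix u :: "real poly"
  assume u: "degree u \<le> Suc l div 2" "coeff u (Suc l div 2) = 0"
  show "moment_functional m (odd_factor (Suc l) * [:1, -1:] * next_upper c l p r * u) = 0"
  proof (cases "u = 0")
    case False
    have "Suc l div 2 \<noteq> 0"
    proof
      assume "Suc l div 2 = 0"
      then show False using u False by (metis leading_coeff_0_iff le_0_eq)
    qed
    then obtain k where k: "Suc l div 2 = Suc k" by (cases "Suc l div 2") auto
    have u': "degree u \<le> k"
      by (rule degree_le_if_coeff_0) (use u k in \<open>simp_all only:\<close>)
    have d: "l div 2 = Suc l mod 2 + k" using k by (cases "even l") (auto elim!: evenE oddE)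
    have 1: "degree ([:1, -1:] * u) \<le> Suc l div 2"
      unfolding k using u' degree_mult_le_add[of "[:1, -1:]" 1 u k] by simp
    have 2: "coeff ([:1, -1:] * u) (Suc l div 2) = - coeff u k"
      unfolding k using u' coeff_mult_top[of "[:1, -1:]" 1 u k] by simp
    have 3: "degree (odd_factor (Suc l) * u) \<le> l div 2"
      unfolding d using u' by (intro degree_mult_le_add) (auto simp: degree_odd_factor)
    have 4: "coeff (odd_factor (Suc l) * u) (l div 2) = coeff u k"
      unfolding d using u' by (subst coeff_mult_top) (auto simp: degree_odd_factor coeff_odd_factor)
    have "odd_factor (Suc l) * [:1, -1:] * next_upper c l p r * u =
        smult (1 / (1 + c)) (odd_factor (Suc l) * p * ([:1, -1:] * u)
          + smult c (odd_factor l * [:1, -1:] * r * (odd_factor (Suc l) * u)))"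
      unfolding next_upper_def
      by (simp only: mult_smult_left mult_smult_right distrib_left distrib_right mult_ac)
    then show ?thesis
      using c orthogonal_pair_lower_top[OF o mp 1] orthogonal_pair_upper_top[OF o mp 3]
      by (simp only: moment_functional_smult moment_functional_add 2 4) simp
  qed simp
qed

text \<open>A test polynomial stays below the top degree, so all products in the orthogonality
  conditions have degree at most \<open>l\<close>.\<close>

lemma orthogonal_pair_cong:
  assumes "orthogonal_pair l m p r" "monic_pair l p r" "\<And>i. i \<le> l \<Longrightarrow> m i = m' i"
  shows "orthogonal_pair l m' p r"
  unfolding orthogonal_pair_def
proof (intro conjI allI impI)
  fix u :: "real poly"
  assume u: "degree u \<le> Suc l div 2" "coeff u (Suc l div 2) = 0"
  show "moment_functional m' (odd_factor (Suc l) * p * u) = 0"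
  proof (cases "u = 0")
    case False
    then have "degree u \<noteq> Suc l div 2" using u(2) by (metis leading_coeff_0_iff)
    then have "Suc (degree u) \<le> Suc l div 2" using u(1) by simp
    moreover have "Suc l mod 2 + 2 * (Suc l div 2) = Suc l" by presburger
    moreover have "degree (odd_factor (Suc l) * p * u) \<le> Suc l mod 2 + Suc l div 2 + degree u"
      using assms(2) by (intro degree_mult_le_add) (auto simp: degree_odd_factor monic_pair_def)
    ultimately have "degree (odd_factor (Suc l) * p * u) \<le> l" by linarith
    then show ?thesis
      using assms(1,3) u moment_functional_cong[of l m m'] unfolding orthogonal_pair_def by metis
  qed simp
next
  fix u :: "real poly"
  assume u: "degree u \<le> l div 2" "coeff u (l div 2) = 0"
  show "moment_functional m' (odd_factor l * [:1, -1:] * r * u) = 0"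
  proof (cases "u = 0")
    case False
    then have "degree u \<noteq> l div 2" using u(2) by (metis leading_coeff_0_iff)
    then have "Suc (degree u) \<le> l div 2" using u(1) by simp
    moreover have "l mod 2 + 2 * (l div 2) = l" by presburger
    moreover have "degree (odd_factor l * [:1, -1:] * r * u) \<le> l mod 2 + 1 + l div 2 + degree u"
      using assms(2)
      by (intro degree_mult_le_add order.refl) (auto simp: degree_odd_factor monic_pair_def)
    ultimately have "degree (odd_factor l * [:1, -1:] * r * u) \<le> l" by linarith
    then show ?thesis
      using assms(1,3) u moment_functional_cong[of l m m'] unfolding orthogonal_pair_def by metis
  qed simp
qed

section \<open>Strict positivity, the algebraic form of interiority, and its passage to the next
  order\<close>

definition strictly_positive :: "nat \<Rightarrow> (nat \<Rightarrow> real) \<Rightarrow> bool" where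
  "strictly_positive n m \<longleftrightarrow>
     (\<forall>P. P \<noteq> 0 \<longrightarrow> degree P \<le> n \<longrightarrow> (\<forall>x\<in>{0..1}. 0 \<le> poly P x) \<longrightarrow> 0 < moment_functional m P)"

lemma strictly_positiveD:
  "strictly_positive n m \<Longrightarrow> P \<noteq> 0 \<Longrightarrow> degree P \<le> n \<Longrightarrow>
    (\<And>x. 0 \<le> x \<Longrightarrow> x \<le> 1 \<Longrightarrow> 0 \<le> poly P x) \<Longrightarrow> 0 < moment_functional m P"
  by (simp add: strictly_positive_def)

lemma strictly_positive_cong:
  "strictly_positive n m \<Longrightarrow> (\<And>i. i \<le> n \<Longrightarrow> m i = m' i) \<Longrightarrow> strictly_positive n m'"
  unfolding strictly_positive_def by (metis moment_functional_cong)

lemma gap_poly_neq_0: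
  assumes "monic_pair l p r"
  shows "gap_poly l p r \<noteq> 0"
proof
  assume eq: "gap_poly l p r = 0"
  have "poly (lower_poly l p) x = 0" if "x \<in> {0..1}" for x
  proof -
    have "poly (lower_poly l p) x + poly (upper_poly l r) x = 0"
      using arg_cong[OF eq, of "\<lambda>P. poly P x"] by (simp add: gap_poly_def)
    then show ?thesis
      using that lower_poly_nonneg[of x l p] upper_poly_nonneg[of x l r] by simp
  qed
  then have "{0..1} \<subseteq> {x. poly (lower_poly l p) x = 0}" by blast
  moreover have "lower_poly l p \<noteq> 0" using coeff_lower_poly[OF assms] by auto
  ultimately have "finite {0..1::real}" by (metis finite_subset poly_roots_finite)
  then show False by (simp add: infinite_Icc_iff[THEN iffD2])
qed

lemma moment_functional_gap_pos:
  assumes "strictly_positive l m" "monic_pair l p r"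
  shows "0 < moment_functional m (gap_poly l p r)"
  using assms gap_poly_neq_0[OF assms(2)] degree_gap_poly[OF assms(2)]
  by (intro strictly_positiveD) (auto simp: gap_poly_def lower_poly_nonneg upper_poly_nonneg)

text \<open>Pythagoras: with \<open>s = c * p + u\<close> the mixed term vanishes, and what remains
  is a positive multiple of the value at \<open>W * p\<^sup>2\<close> plus a nonnegative
  term.\<close>

lemma orthogonal_square_pos:
  assumes p: "degree p \<le> k" "coeff p k = 1"
    and orth: "\<And>u. degree u \<le> k \<Longrightarrow> coeff u k = 0 \<Longrightarrow> moment_functional m (W * p * u) = 0"
    and nonneg: "\<And>u. u \<noteq> 0 \<Longrightarrow> degree u < k \<Longrightarrow> 0 \<le> moment_functional m (W * u\<^sup>2)"
    and pos: "0 < moment_functional m (W * p\<^sup>2)" and s: "degree s = k" "s \<noteq> 0"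
  shows "0 < moment_functional m (W * s\<^sup>2)"
proof -
  define c where "c = lead_coeff s"
  define u where "u = s - smult c p"
  have u: "degree u \<le> k" "coeff u k = 0"
    using s p by (auto simp: u_def c_def intro!: degree_diff_le order_trans[OF degree_smult_le])
  have "moment_functional m (W * u\<^sup>2) \<ge> 0"
  proof (cases "u = 0")
    case False
    then have "degree u < k" using u by (metis leading_coeff_0_iff le_neq_implies_less)
    then show ?thesis using False by (rule nonneg[rotated])
  qed simp
  moreover have "moment_functional m (W * p * u) = 0" by (rule orth[OF u])
  moreover have "W * s\<^sup>2 = smult (c\<^sup>2) (W * p\<^sup>2) + smult (2 * c) (W * p * u) + W * u\<^sup>2"
  proof -
    have "s = [:c:] * p + u" by (simp add: u_def)
    moreover have "smult (c\<^sup>2) Q = [:c:]\<^sup>2 * Q" "smult (2 * c) Q = [:c:] * Q + [:c:] * Q" for Q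
      by (simp_all add: power2_eq_square flip: smult_add_left)
    moreover have "W * (D * v + u)\<^sup>2 = D\<^sup>2 * (W * v\<^sup>2) + (D * (W * v * u) + D * (W * v * u)) + W * u\<^sup>2" for D v
      by (simp add: power2_eq_square algebra_simps)
    ultimately show ?thesis by (simp only:)
  qed
  moreover have "c\<^sup>2 > 0" using s(2) by (simp add: c_def)
  ultimately show ?thesis using pos
    by (simp only: moment_functional_add moment_functional_smult) (simp add: add_pos_nonneg)
qed

text \<open>It suffices to treat products \<open>x ^ i * (1 - x) ^ j * s\<^sup>2\<close>. Up to
  degree \<open>l\<close> they are covered by the hypothesis. In degree \<open>Suc l\<close> even
  powers are absorbed into the square, and the parity of \<open>j\<close> decides whether a
  \<open>lower_poly\<close> or an \<open>upper_poly\<close> is left.\<close>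

lemma strictly_positive_Suc:
  assumes sp: "strictly_positive l m" and o: "orthogonal_pair l m p r" and mp: "monic_pair l p r"
    and a: "0 < moment_functional m (lower_poly l p)" and b: "0 < moment_functional m (upper_poly l r)"
  shows "strictly_positive (Suc l) m"
  unfolding strictly_positive_def
proof (intro allI impI)
  fix P :: "real poly"
  assume P: "P \<noteq> 0" "degree P \<le> Suc l" "\<forall>x\<in>{0..1}. 0 \<le> poly P x"
  have lower: "0 < moment_functional m (lower_poly l s)" if s: "degree s = Suc l div 2" "s \<noteq> 0" for s
    unfolding lower_poly_def
  proof (rule orthogonal_square_pos[where p = p, OF _ _ _ _ _ s])
    fix u :: "real poly" assume u: "u \<noteq> 0" "degree u < Suc l div 2"
    moreover have "Suc l mod 2 + 2 * (Suc l div 2) = Suc l" by presburger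
    moreover have "degree (lower_poly l u) \<le> Suc l mod 2 + (degree u + degree u)"
      unfolding lower_poly_def power2_eq_square
      by (intro degree_mult_le_add) (auto simp: degree_odd_factor)
    ultimately have "degree (lower_poly l u) \<le> l" by linarith
    moreover have "lower_poly l u \<noteq> 0" using u by (simp add: lower_poly_def)
    ultimately have "0 \<le> moment_functional m (lower_poly l u)"
      using strictly_positiveD[OF sp, of "lower_poly l u"] lower_poly_nonneg by fastforce
    then show "0 \<le> moment_functional m (odd_factor (Suc l) * u\<^sup>2)"
      unfolding lower_poly_def .
  qed (use o mp a in \<open>auto simp: orthogonal_pair_def monic_pair_def lower_poly_def\<close>)
  have upper: "0 < moment_functional m (upper_poly l s)" if s: "degree s = l div 2" "s \<noteq> 0" for s
    unfolding upper_poly_def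
  proof (rule orthogonal_square_pos[where p = r, OF _ _ _ _ _ s])
    fix u :: "real poly" assume u: "u \<noteq> 0" "degree u < l div 2"
    moreover have "l mod 2 + 2 * (l div 2) = l" by presburger
    moreover have "degree (upper_poly l u) \<le> l mod 2 + 1 + (degree u + degree u)"
      unfolding upper_poly_def power2_eq_square
      by (intro degree_mult_le_add) (auto simp: degree_odd_factor)
    ultimately have "degree (upper_poly l u) \<le> l" by linarith
    moreover have "upper_poly l u \<noteq> 0"
      using u by (simp add: upper_poly_def del: mult_pCons_right mult_pCons_left)
    ultimately have "0 \<le> moment_functional m (upper_poly l u)"
      using strictly_positiveD[OF sp, of "upper_poly l u"] upper_poly_nonneg by fastforce
    then show "0 \<le> moment_functional m (odd_factor l * [:1, -1:] * u\<^sup>2)"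
      unfolding upper_poly_def .
  qed (use o mp b in \<open>auto simp: orthogonal_pair_def monic_pair_def upper_poly_def simp del: mult_pCons_right mult_pCons_left\<close>)
  show "0 < moment_functional m P"
  proof (rule positive_on_nonneg_polys[where F = "moment_functional m" and n = "Suc l"])
    fix i j :: nat and s :: "real poly"
    assume s: "s \<noteq> 0" and deg: "i + j + 2 * degree s \<le> Suc l"
    let ?Q = "[:0, 1:] ^ i * [:1, -1:] ^ j * s\<^sup>2"
    have degQ: "degree ?Q = i + j + 2 * degree s"
      using s by (simp add: degree_mult_eq degree_power_eq del: mult_pCons_left mult_pCons_right)
    have nn: "0 \<le> poly ?Q x" if "x \<in> {0..1}" for x
      using that by (auto simp: poly_power intro!: mult_nonneg_nonneg)
    show "0 < moment_functional m ?Q"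
    proof (cases "i + j + 2 * degree s \<le> l")
      case True
      have "?Q \<noteq> 0" using s by simp
      then show ?thesis
        using True degQ nn by (intro strictly_positiveD[OF sp]) auto
    next
      case False
      then have eq: "i + j + 2 * degree s = Suc l" using deg by simp
      define t where "t = [:0, 1:] ^ (i div 2) * [:1, -1:] ^ (j div 2) * s"
      have t0: "t \<noteq> 0" using s by (simp add: t_def)
      have degt: "degree t = i div 2 + j div 2 + degree s"
        using s by (simp add: t_def degree_mult_eq degree_power_eq del: mult_pCons_left mult_pCons_right)
      have Q: "?Q = [:0, 1:] ^ (i mod 2) * [:1, -1:] ^ (j mod 2) * t\<^sup>2"
      proof -
        have "[:0, 1::real:] ^ i = [:0, 1:] ^ (i mod 2) * ([:0, 1:] ^ (i div 2))\<^sup>2"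
          "[:1, -1::real:] ^ j = [:1, -1:] ^ (j mod 2) * ([:1, -1:] ^ (j div 2))\<^sup>2"
          by (simp_all only: power_mult[symmetric] power_add[symmetric] mult.commute[of _ 2] mod_mult_div_eq)
        then show ?thesis unfolding t_def by (simp only: power_mult_distrib mult_ac)
      qed
      show ?thesis
      proof (cases "even j")
        case True
        have par: "j mod 2 = 0" "i mod 2 = Suc l mod 2" using eq True by presburger+
        then have "?Q = lower_poly l t"
          unfolding Q lower_poly_def odd_factor_eq_power by (simp only: power_0 mult_1_right)
        moreover have "degree t = Suc l div 2" unfolding degt
          using eq par mult_div_mod_eq[of 2 i] mult_div_mod_eq[of 2 j] mult_div_mod_eq[of 2 "Suc l"] by linarith
        ultimately show ?thesis using lower[OF _ t0] by (simp only:)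
      next
        case False
        have par: "j mod 2 = 1" "i mod 2 = l mod 2" using eq False by presburger+
        then have "?Q = upper_poly l t"
          unfolding Q upper_poly_def odd_factor_eq_power by (simp only: power_one_right)
        moreover have "degree t = l div 2" unfolding degt
          using eq par mult_div_mod_eq[of 2 i] mult_div_mod_eq[of 2 j] mult_div_mod_eq[of 2 l] by linarith
        ultimately show ?thesis using upper[OF _ t0] by (simp only:)
      qed
    qed
  qed (use P in \<open>auto simp: moment_functional_add moment_functional_smult\<close>)
qed

section \<open>Chebyshev polynomials and balanced continuations\<close>

lemma borel_measurable_poly [measurable]: "poly (P :: real poly) \<in> borel_measurable borel"
  by (intro borel_measurable_continuous_onI continuous_intros)

lemma integrable_arcsine_poly [simp]: "integrable arcsine (poly P)"
  by (intro integrable_arcsine_continuous continuous_intros borel_measurable_poly)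

lemma integral_arcsine:
  fixes f :: "real \<Rightarrow> real"
  assumes [measurable]: "f \<in> borel_measurable borel"
  shows "(\<integral>x. f x \<partial>arcsine) =
    (\<integral>t. indicat_real {0..pi} t * (f ((1 - cos t) / 2) / pi) \<partial>lborel)"
proof -
  let ?g = "\<lambda>t::real. (1 - cos t) / 2"
  let ?w = "\<lambda>t. ennreal (indicat_real {0..pi} t / pi)"
  have eq: "arcsine = distr (density lborel ?w) borel ?g"
  proof (rule measure_eqI)
    fix A assume "A \<in> sets arcsine"
    then have [measurable]: "A \<in> sets borel" by simp
    have [measurable]: "?g -` A \<in> sets borel"
      by (rule measurable_sets_borel[of ?g borel]) auto
    have "emeasure arcsine A = (\<integral>\<^sup>+x. indicator A x \<partial>arcsine)" by simp
    also have "\<dots> = (\<integral>\<^sup>+t. indicator A (?g t) * ennreal (1 / pi) * indicator {0..pi} t \<partial>lborel)"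
      by (rule nn_integral_arcsine) measurable
    also have "\<dots> = (\<integral>\<^sup>+t. ?w t * indicator (?g -` A) t \<partial>lborel)"
      by (intro nn_integral_cong) (auto simp: indicator_def)
    also have "\<dots> = emeasure (density lborel ?w) (?g -` A)"
      by (rule emeasure_density[symmetric]) measurable
    also have "\<dots> = emeasure (distr (density lborel ?w) borel ?g) A"
      by (subst emeasure_distr) auto
    finally show "emeasure arcsine A = emeasure (distr (density lborel ?w) borel ?g) A" .
  qed simp
  have "(\<integral>x. f x \<partial>arcsine) = (\<integral>t. f (?g t) \<partial>density lborel ?w)"
    by (subst eq, subst integral_distr) simp_all
  also have "\<dots> = (\<integral>t. indicat_real {0..pi} t / pi * f (?g t) \<partial>lborel)"
    by (subst integral_density) auto
  finally show ?thesis by (simp add: field_simps)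
qed

text \<open>
  The Chebyshev polynomials of both kinds, transplanted to \<open>[0,1]\<close>: with \<open>2 * x - 1 = cos s\<close>,
  the pair consists of \<open>cos (j * s)\<close> and \<open>sin (j * s) / sin s\<close>.
\<close>

primrec chebyshev :: "nat \<Rightarrow> real poly \<times> real poly" where
  "chebyshev 0 = (1, 0)"
| "chebyshev (Suc j) =
     ([:-1, 2:] * fst (chebyshev j) - [:0, 4, -4:] * snd (chebyshev j),
      [:-1, 2:] * snd (chebyshev j) + fst (chebyshev j))"

text \<open>The shift by \<open>pi\<close> comes from
  \<open>2 * x - 1 = - cos t = cos (t + pi)\<close>; the recursion is the pair of addition
  theorems.\<close>

lemma poly_chebyshev:
  "poly (fst (chebyshev j)) ((1 - cos t) / 2) = cos (real j * (t + pi)) \<and>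
   poly (snd (chebyshev j)) ((1 - cos t) / 2) * sin (t + pi) = sin (real j * (t + pi))"
proof (induction j)
  case (Suc j)
  let ?s = "t + pi" and ?x = "(1 - cos t) / 2"
  let ?T = "poly (fst (chebyshev j)) ?x" and ?U = "poly (snd (chebyshev j)) ?x"
  have T: "?T = cos (real j * ?s)" and U: "?U * sin ?s = sin (real j * ?s)" using Suc by auto
  have y: "poly [:-1, 2:] ?x = cos ?s" by (simp add: cos_add field_simps)
  have "poly [:0, 4, -4:] ?x = 1 - cos t * cos t" by (simp add: field_simps)
  also have "\<dots> = sin ?s * sin ?s"
    using sin_cos_squared_add[of t] by (simp add: sin_add power2_eq_square algebra_simps)
  finally have z: "poly [:0, 4, -4:] ?x = sin ?s * sin ?s" .
  have J: "real (Suc j) * ?s = real j * ?s + ?s" by (simp add: algebra_simps)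
  have "poly (fst (chebyshev (Suc j))) ?x = cos ?s * ?T - sin ?s * (?U * sin ?s)"
    using y z by (simp only: chebyshev.simps fst_conv poly_diff poly_mult mult_ac)
  also have "\<dots> = cos (real (Suc j) * ?s)" unfolding T U J cos_add[of "real j * ?s" ?s] by (simp only: mult_ac)
  finally have 1: "poly (fst (chebyshev (Suc j))) ?x = cos (real (Suc j) * ?s)" .
  have "poly (snd (chebyshev (Suc j))) ?x * sin ?s = cos ?s * (?U * sin ?s) + ?T * sin ?s"
    using y by (simp only: chebyshev.simps snd_conv poly_add poly_mult distrib_left distrib_right mult_ac)
  also have "\<dots> = sin (real (Suc j) * ?s)" unfolding T U J sin_add[of "real j * ?s" ?s] by (simp only: mult_ac add_ac)
  finally show ?case using 1 by blast
qed simp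

lemma integral_chebyshev:
  assumes "j > 0"
  shows "(\<integral>x. poly (fst (chebyshev j)) x \<partial>arcsine) = 0"
proof -
  have "(\<integral>x. poly (fst (chebyshev j)) x \<partial>arcsine) =
      (\<integral>t. (cos (real j * (t + pi)) / pi) * indicat_real {0..pi} t \<partial>lborel)"
    by (subst integral_arcsine) (simp_all add: poly_chebyshev mult.commute)
  also have "\<dots> = sin (real j * (pi + pi)) / (j * pi) - sin (real j * (0 + pi)) / (j * pi)"
  proof (rule integral_FTC_Icc_real)
    fix t :: real
    show "((\<lambda>t. sin (real j * (t + pi)) / (j * pi)) has_real_derivative cos (real j * (t + pi)) / pi) (at t)"
      using assms by (auto intro!: derivative_eq_intros simp: field_simps)
    show "isCont (\<lambda>t. cos (real j * (t + pi)) / pi) t" by (intro continuous_intros) auto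
  qed simp
  also have "\<dots> = 0"
    using sin_int_2pin[of "int j"] sin_npi2[of j] by (simp add: algebra_simps)
  finally show ?thesis .
qed

text \<open>Multiplied by \<open>x\<close>, the second component obeys the same degree bound as the
  first, also for \<open>j = 0\<close>, where it vanishes. In this form the recursion has only
  positive top coefficients, so nothing cancels at the top.\<close>

lemma chebyshev_degree:
  "degree (fst (chebyshev j)) \<le> j \<and> 0 < coeff (fst (chebyshev j)) j \<and>
   degree ([:0, 1:] * snd (chebyshev j)) \<le> j \<and> 0 \<le> coeff ([:0, 1:] * snd (chebyshev j)) j"
proof (induction j)
  case (Suc j)
  let ?T = "fst (chebyshev j)" and ?V = "[:0, 1:] * snd (chebyshev j)"
  have T: "fst (chebyshev (Suc j)) = [:-1, 2:] * ?T + [:-4, 4:] * ?V"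
  proof -
    have "[:0, 4, -4:] = - ([:-4, 4:] * [:0, 1::real:])" by simp
    then show ?thesis by (simp only: chebyshev.simps fst_conv minus_mult_left[symmetric] diff_minus_eq_add mult.assoc)
  qed
  have V: "[:0, 1:] * snd (chebyshev (Suc j)) = [:-1, 2:] * ?V + [:0, 1:] * ?T"
    by (simp only: chebyshev.simps snd_conv distrib_left mult_ac)
  have d: "degree (A * ?T) \<le> Suc j" "degree (A * ?V) \<le> Suc j"
    "coeff (A * ?T) (Suc j) = coeff A 1 * coeff ?T j" "coeff (A * ?V) (Suc j) = coeff A 1 * coeff ?V j"
    if "degree A \<le> 1" for A :: "real poly"
    using degree_mult_le_add[OF that, of ?T j] degree_mult_le_add[OF that, of ?V j]
      coeff_mult_top[OF that, of ?T j] coeff_mult_top[OF that, of ?V j] Suc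
    by (simp_all del: mult_pCons_left mult_pCons_right)
  have deg: "degree [:a, b:] \<le> 1" for a b :: real by simp
  show ?case
    unfolding T V coeff_add d(3,4)[OF deg]
    using Suc by (intro conjI degree_add_le d deg) (auto simp del: mult_pCons_left mult_pCons_right)
qed simp

lemma eq_on_chebyshev:
  fixes F G :: "real poly \<Rightarrow> real"
  assumes F: "\<And>P Q. F (P + Q) = F P + F Q" "\<And>c P. F (smult c P) = c * F P"
    and G: "\<And>P Q. G (P + Q) = G P + G Q" "\<And>c P. G (smult c P) = c * G P"
    and eq: "\<And>j. j \<le> n \<Longrightarrow> F (fst (chebyshev j)) = G (fst (chebyshev j))"
    and "degree f \<le> n"
  shows "F f = G f"
  using eq \<open>degree f \<le> n\<close>
proof (induction n arbitrary: f)
  case 0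
  then obtain a where "f = [:a:]" by (auto elim: degree_eq_zeroE)
  then have "f = smult a (fst (chebyshev 0))" by simp
  then show ?case using 0(1)[of 0] by (simp only: F G)
next
  case (Suc n)
  let ?T = "fst (chebyshev (Suc n))"
  define c where "c = coeff f (Suc n) / coeff ?T (Suc n)"
  have T: "degree ?T \<le> Suc n" "0 < coeff ?T (Suc n)" using chebyshev_degree[of "Suc n"] by auto
  define g where "g = f - smult c ?T"
  have "degree g \<le> Suc n" unfolding g_def
    using T(1) Suc.prems(2) by (intro degree_diff_le order_trans[OF degree_smult_le])
  moreover have "coeff g (Suc n) = 0" using T(2) by (simp add: g_def c_def del: chebyshev.simps)
  ultimately have "degree g \<le> n" by (rule degree_le_if_coeff_0)
  have "F g = G g"
  proof (rule Suc.IH)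
    show "F (fst (chebyshev j)) = G (fst (chebyshev j))" if "j \<le> n" for j
      using that by (intro Suc.prems(1)) simp
  qed fact
  moreover have "f = g + smult c ?T" by (simp add: g_def)
  ultimately show ?case using Suc.prems(1)[of "Suc n"] by (simp only: F G)
qed

text \<open>Put \<open>X = odd_factor l\<close>, \<open>X' = odd_factor (Suc l)\<close> and
  \<open>cos s = 2 * x - 1\<close>. On the vector of \<open>sqrt X' * p\<close> and
  \<open>sqrt (X * (1 - x)) * r\<close>, two balanced steps act as the rotation by \<open>s\<close>
  divided by 4. One step swaps the parity factors, so steps are iterated in pairs.\<close>

lemma next_next:
  defines "y \<equiv> [:-1, 2::real:]"
  shows "next_lower 1 (Suc l) (next_lower 1 l p r) (next_upper 1 l p r) =
      smult (1/4) (y * p - 2 * (odd_factor l * [:1, -1:] * r))"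
    and "next_upper 1 (Suc l) (next_lower 1 l p r) (next_upper 1 l p r) =
      smult (1/4) (y * r + 2 * (odd_factor (Suc l) * p))"
proof -
  define x :: "real poly" where "x = [:0, 1:]"
  have one: "[:1, -1:] = 1 - x" by (simp add: x_def one_pCons numeral_poly)
  have y: "y = 2 * x - 1" by (simp add: x_def y_def one_pCons numeral_poly)
  have X: "odd_factor l * odd_factor (Suc l) = x"
    by (auto simp: odd_factor_def x_def)
  have half: "smult (1 / (1 + 1)) (smult (1 / (1 + 1)) A - smult (1 / (1 + 1)) B) = smult (1/4) (A - B)"
    "smult (1 / (1 + 1)) (smult (1 / (1 + 1)) A + smult (1 / (1 + 1)) B) = smult (1/4) (A + B)"
    for A B :: "real poly"
    by (simp_all add: smult_diff_right smult_add_right)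
  have 1: "X * (X' * p - (1 - x) * r) - (1 - x) * (p + X * r) = y * p - 2 * (X * (1 - x) * r)"
    if "X * X' = x" for X X' unfolding y that[symmetric] by (simp add: algebra_simps)
  have 2: "(X' * p - (1 - x) * r) + X' * (p + X * r) = y * r + 2 * (X' * p)"
    if "X * X' = x" for X X' unfolding y that[symmetric] by (simp add: algebra_simps)
  show "next_lower 1 (Suc l) (next_lower 1 l p r) (next_upper 1 l p r) =
      smult (1/4) (y * p - 2 * (odd_factor l * [:1, -1:] * r))"
    unfolding next_lower_def next_upper_def one 1[OF X, symmetric]
    by (simp only: mult_smult_right odd_factor_Suc_Suc smult_1_left half)
  show "next_upper 1 (Suc l) (next_lower 1 l p r) (next_upper 1 l p r) =
      smult (1/4) (y * r + 2 * (odd_factor (Suc l) * p))"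
    unfolding next_lower_def next_upper_def one 2[OF X, symmetric]
    by (simp only: mult_smult_right odd_factor_Suc_Suc smult_1_left half)
qed

text \<open>After \<open>j\<close> double steps the rotation is by \<open>j * s\<close>; the
  Chebyshev pair supplies \<open>cos (j * s)\<close> and \<open>sin (j * s) / sin s\<close>, and the
  factor 2 stems from \<open>sin s = 2 * sqrt (x * (1 - x))\<close>.\<close>

lemma even_iterate_chebyshev:
  fixes p r :: "nat \<Rightarrow> real poly"
  assumes p: "\<And>j. p (Suc j) = next_lower 1 (l + j) (p j) (r j)"
    and r: "\<And>j. r (Suc j) = next_upper 1 (l + j) (p j) (r j)"
  shows "p (2 * j) = smult (1 / 4 ^ j)
      (fst (chebyshev j) * p 0 - 2 * (odd_factor l * [:1, -1:] * snd (chebyshev j) * r 0)) \<and>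
    r (2 * j) = smult (1 / 4 ^ j)
      (fst (chebyshev j) * r 0 + 2 * (odd_factor (Suc l) * snd (chebyshev j) * p 0))"
proof (induction j)
  case (Suc j)
  define x :: "real poly" where "x = [:0, 1:]"
  have one: "[:1, -1:] = 1 - x" by (simp add: x_def one_pCons numeral_poly)
  have y: "[:-1, 2:] = 2 * x - 1" by (simp add: x_def one_pCons numeral_poly)
  have z: "[:0, 4, -4:] = 4 * (x * (1 - x))" by (simp add: x_def one_pCons numeral_poly)
  have X: "odd_factor l * odd_factor (Suc l) = x"
    by (auto simp: odd_factor_def x_def)
  let ?T = "fst (chebyshev j)" and ?U = "snd (chebyshev j)"
  let ?X = "odd_factor l" and ?X' = "odd_factor (Suc l)"
  have of: "odd_factor (l + 2 * j) = ?X" "odd_factor (Suc (l + 2 * j)) = ?X'"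
    by (simp_all flip: add_Suc)
  have p2: "p (2 * Suc j) = smult (1/4) ((2 * x - 1) * p (2 * j) - 2 * (?X * (1 - x) * r (2 * j)))"
    using next_next(1)[of "l + 2 * j" "p (2 * j)" "r (2 * j)"]
    by (simp only: mult_Suc_right add_2_eq_Suc p[of "Suc (2 * j)"] p[of "2 * j"] r[of "2 * j"] add_Suc_right of one y)
  have r2: "r (2 * Suc j) = smult (1/4) ((2 * x - 1) * r (2 * j) + 2 * (?X' * p (2 * j)))"
    using next_next(2)[of "l + 2 * j" "p (2 * j)" "r (2 * j)"]
    by (simp only: mult_Suc_right add_2_eq_Suc r[of "Suc (2 * j)"] p[of "2 * j"] r[of "2 * j"] add_Suc_right of one y)
  have 1: "(2 * x - 1) * (?T * P - 2 * (X * (1 - x) * ?U * R)) - 2 * (X * (1 - x) * (?T * R + 2 * (X' * ?U * P)))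
     = ((2 * x - 1) * ?T - 4 * (x * (1 - x)) * ?U) * P - 2 * (X * (1 - x) * ((2 * x - 1) * ?U + ?T) * R)"
    if "X * X' = x" for X X' P R
    unfolding that[symmetric] by (simp add: algebra_simps)
  have 2: "(2 * x - 1) * (?T * R + 2 * (X' * ?U * P)) + 2 * (X' * (?T * P - 2 * (X * (1 - x) * ?U * R)))
     = ((2 * x - 1) * ?T - 4 * (x * (1 - x)) * ?U) * R + 2 * (X' * ((2 * x - 1) * ?U + ?T) * P)"
    if "X * X' = x" for X X' P R
    unfolding that[symmetric] by (simp add: algebra_simps)
  have c: "1/4 * (1 / 4 ^ j) = (1 / 4 ^ Suc j :: real)" by simp
  show ?case
    unfolding p2 r2 conjunct1[OF Suc] conjunct2[OF Suc] chebyshev.simps fst_conv snd_conv one y z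
      1[OF X, symmetric] 2[OF X, symmetric] c[symmetric]
    by (simp only: mult_smult_right smult_diff_right[symmetric] smult_add_right[symmetric] smult_smult)
qed simp

text \<open>The inner product of a plane vector with its image under the rotation by
  \<open>j * s\<close> is \<open>cos (j * s)\<close> times its squared norm, which here is the gap
  polynomial; \<open>4 ^ j\<close> undoes the scaling.\<close>

lemma gap_poly_times_chebyshev:
  fixes p r :: "nat \<Rightarrow> real poly"
  assumes "\<And>j. p (Suc j) = next_lower 1 (l + j) (p j) (r j)"
    and "\<And>j. r (Suc j) = next_upper 1 (l + j) (p j) (r j)"
  shows "gap_poly l (p 0) (r 0) * fst (chebyshev j) = smult (4 ^ j)
    (odd_factor (Suc l) * p (2 * j) * p 0 + odd_factor l * [:1, -1:] * r (2 * j) * r 0)"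
proof -
  let ?T = "fst (chebyshev j)" and ?U = "snd (chebyshev j)"
  have "X' * (?T * P - 2 * (X * D * ?U * R)) * P + X * D * (?T * R + 2 * (X' * ?U * P)) * R =
    (X' * P\<^sup>2 + X * D * R\<^sup>2) * ?T" for X X' D P R
    by (simp add: algebra_simps power2_eq_square)
  then show ?thesis
    unfolding gap_poly_def lower_poly_def upper_poly_def
    unfolding even_iterate_chebyshev[OF assms, THEN conjunct1] even_iterate_chebyshev[OF assms, THEN conjunct2]
    by (simp only: mult_smult_right mult_smult_left smult_add_right[symmetric] smult_smult) simp
qed

text \<open>
  Moments can be continued so that the two gaps agree in every further step; on such a
  continuation, multiplication by the gap polynomial turns the functional into the arcsine
  distribution.
\<close>

lemma exists_balanced_extension:
  fixes p r :: "nat \<Rightarrow> real poly"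
  assumes p: "\<And>j. p (Suc j) = next_lower 1 (l + j) (p j) (r j)"
    and r: "\<And>j. r (Suc j) = next_upper 1 (l + j) (p j) (r j)"
    and sp: "strictly_positive l m" and o: "orthogonal_pair l m (p 0) (r 0)"
    and mp: "monic_pair l (p 0) (r 0)"
  shows "\<exists>m'. (\<forall>i\<le>l. m' i = m i) \<and> strictly_positive (l + j) m' \<and>
    (\<forall>i\<le>j. orthogonal_pair (l + i) m' (p i) (r i))"
proof (induction j)
  case 0
  show ?case using sp o by (intro exI[of _ m]) auto
next
  case (Suc j)
  have mpj: "monic_pair (l + i) (p i) (r i)" for i
    by (induction i) (use mp in \<open>auto simp: p r intro: monic_pair_next\<close>)
  from Suc obtain m' where m': "\<forall>i\<le>l. m' i = m i" "strictly_positive (l + j) m'"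
    "\<forall>i\<le>j. orthogonal_pair (l + i) m' (p i) (r i)" by blast
  let ?n = "Suc (l + j)"
  let ?A = "lower_poly (l + j) (p j)" and ?B = "upper_poly (l + j) (r j)"
  \<comment> \<open>Raising the new moment raises the value at \<open>?A\<close> and lowers the
    value at \<open>?B\<close> by the same amount; moving it by half of the difference makes them
    equal.\<close>
  define d where "d = moment_functional m' ?A - moment_functional m' ?B"
  define m'' where "m'' = m'(?n := m' ?n - d / 2)"
  have agree: "m'' i = m' i" if "i \<le> l + j" for i using that by (simp add: m''_def)
  have A: "moment_functional m'' ?A = moment_functional m' ?A - d / 2"
    unfolding m''_def using degree_lower_poly[OF mpj] coeff_lower_poly[OF mpj]
    by (subst moment_functional_upd) auto
  have B: "moment_functional m'' ?B = moment_functional m' ?B + d / 2"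
    unfolding m''_def using degree_upper_poly[OF mpj] coeff_upper_poly[OF mpj]
    by (subst moment_functional_upd) auto
  have AB: "moment_functional m'' ?A = moment_functional m'' ?B"
    unfolding A B d_def by (simp add: field_simps)
  have sp'': "strictly_positive (l + j) m''"
    by (rule strictly_positive_cong[OF m'(2)]) (simp add: agree)
  have o'': "orthogonal_pair (l + i) m'' (p i) (r i)" if "i \<le> j" for i
    by (rule orthogonal_pair_cong[OF _ mpj]) (use m'(3) that agree in auto)
  have "0 < moment_functional m'' ?A + moment_functional m'' ?B"
    using moment_functional_gap_pos[OF sp'' mpj] by (simp add: gap_poly_def moment_functional_add)
  then have "strictly_positive ?n m''"
    using AB by (intro strictly_positive_Suc[OF sp'' o'' mpj]) auto
  moreover have "orthogonal_pair ?n m'' (p (Suc j)) (r (Suc j))"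
    unfolding p r using AB by (intro orthogonal_pair_next[OF o'' mpj]) auto
  ultimately show ?case
    using m'(1) agree o'' by (intro exI[of _ m'']) (auto simp: le_Suc_eq)
qed

text \<open>Two linear functionals of \<open>f\<close> are compared on Chebyshev polynomials. For
  \<open>j > 0\<close> the arcsine side is 0; on the other side the product with the gap polynomial
  is a sum of products of the original pair with the pair \<open>2 * j\<close> steps later, and both
  vanish by orthogonality since the original degrees are smaller.\<close>

lemma exists_arcsine_extension:
  assumes sp: "strictly_positive l m" and o: "orthogonal_pair l m p r" and mp: "monic_pair l p r"
  shows "\<exists>m'. (\<forall>i\<le>l. m' i = m i) \<and> strictly_positive (l + 2 * n) m' \<and>
    (\<forall>f. degree f \<le> n \<longrightarrow> moment_functional m' (gap_poly l p r * f) =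
       moment_functional m (gap_poly l p r) * (\<integral>x. poly f x \<partial>arcsine))"
proof -
  define pr where "pr = rec_nat (p, r) (\<lambda>j (p, r). (next_lower 1 (l + j) p r, next_upper 1 (l + j) p r))"
  define P where "P j = fst (pr j)" for j
  define R where "R j = snd (pr j)" for j
  have P0: "P 0 = p" and R0: "R 0 = r" by (simp_all add: P_def R_def pr_def)
  have P: "P (Suc j) = next_lower 1 (l + j) (P j) (R j)"
    and R: "R (Suc j) = next_upper 1 (l + j) (P j) (R j)" for j
    by (simp_all add: P_def R_def pr_def split_beta)
  obtain m' where m': "\<forall>i\<le>l. m' i = m i" "strictly_positive (l + 2 * n) m'"
    "\<forall>i\<le>2 * n. orthogonal_pair (l + i) m' (P i) (R i)"
    using exists_balanced_extension[of P l R m "2 * n"] P R sp o mp P0 R0 by auto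
  let ?G = "gap_poly l p r"
  have G: "moment_functional m' ?G = moment_functional m ?G"
    using m'(1) degree_gap_poly[OF mp] by (intro moment_functional_cong) auto
  have "moment_functional m' (?G * f) = moment_functional m ?G * (\<integral>x. poly f x \<partial>arcsine)"
    if "degree f \<le> n" for f
  proof (rule eq_on_chebyshev[where n = n])
    fix j assume j: "j \<le> n"
    show "moment_functional m' (?G * fst (chebyshev j)) =
      moment_functional m ?G * (\<integral>x. poly (fst (chebyshev j)) x \<partial>arcsine)"
    proof (cases "j = 0")
      case True
      then show ?thesis using G arcsine.prob_space by simp
    next
      case False
      have oj: "orthogonal_pair (l + 2 * j) m' (P (2 * j)) (R (2 * j))" using m'(3) j by simp
      have of: "odd_factor (Suc (l + 2 * j)) = odd_factor (Suc l)" by (simp flip: add_Suc)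
      have d: "Suc (l + 2 * j) div 2 = Suc l div 2 + j" "(l + 2 * j) div 2 = l div 2 + j" by simp_all
      have "moment_functional m' (odd_factor (Suc l) * P (2 * j) * p) = 0"
        using oj mp False unfolding orthogonal_pair_def of d monic_pair_def by (auto simp: coeff_eq_0)
      moreover have "moment_functional m' (odd_factor l * [:1, -1:] * R (2 * j) * r) = 0"
        using oj mp False unfolding orthogonal_pair_def odd_factor_add_even d monic_pair_def
        by (auto simp: coeff_eq_0 simp del: mult_pCons_right)
      ultimately show ?thesis
        unfolding gap_poly_times_chebyshev[of P l R j, OF P R, unfolded P0 R0]
        using False by (simp only: moment_functional_smult moment_functional_add integral_chebyshev) simp
    qed
  qed (use that in \<open>simp_all add: moment_functional_add moment_functional_smult distrib_left\<close>)
  then show ?thesis using m'(1,2) by blast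
qed

section \<open>Approximation, and integrals against the arcsine distribution divided by a
  polynomial\<close>

lemma poly_approximation:
  assumes "continuous_on {0..1} (f :: real \<Rightarrow> real)" "0 < e"
  obtains g :: "real poly" where "\<And>x. x \<in> {0..1} \<Longrightarrow> \<bar>poly g x - f x\<bar> < e"
proof -
  obtain n where n: "\<And>x. x \<in> {0..1} \<Longrightarrow> \<bar>f x - (\<Sum>k\<le>n. f (k / n) * Bernstein n k x)\<bar> < e"
    using Bernstein_Weierstrass[OF assms] by blast
  define g where
    "g = (\<Sum>k\<le>n. smult (f (k / n) * of_nat (n choose k)) ([:0, 1:] ^ k * [:1, -1:] ^ (n - k)))"
  have "poly g x = (\<Sum>k\<le>n. f (k / n) * Bernstein n k x)" for x
    by (simp add: g_def Bernstein_def poly_sum poly_power mult_ac)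
  then show ?thesis using n that[of g] by (simp add: abs_minus_commute)
qed

lemma bounded_on_unit_interval:
  assumes "continuous_on {0..1} (f :: real \<Rightarrow> real)"
  obtains B where "1 \<le> B" "\<And>x. x \<in> {0..1} \<Longrightarrow> \<bar>f x\<bar> \<le> B"
proof -
  have "bounded (f ` {0..1})"
    using assms by (intro compact_imp_bounded compact_continuous_image) auto
  then obtain B where "\<forall>x\<in>{0..1}. \<bar>f x\<bar> \<le> B" unfolding bounded_iff by auto
  then show ?thesis by (intro that[of "max 1 B"]) (auto simp: le_max_iff_disj)
qed

lemma integrable_arcsine_poly_square: "integrable arcsine (\<lambda>x. (poly f x)\<^sup>2)"
  by (intro integrable_arcsine_continuous continuous_intros) measurable

lemma integrable_arcsine_poly_divide:
  assumes "\<And>x. x \<in> {0..1} \<Longrightarrow> 0 < poly q x"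
  shows "integrable arcsine (\<lambda>x. poly f x / poly q x)"
  using assms by (intro integrable_arcsine_continuous continuous_intros) (auto simp: less_le)

lemma moment_functional_arcsine:
  assumes "\<And>x. x \<in> {0..1} \<Longrightarrow> 0 < poly q x"
    and "\<And>i. i \<le> n \<Longrightarrow> m i = (\<integral>x. x ^ i / poly q x \<partial>arcsine)" and "degree f \<le> n"
  shows "moment_functional m f = (\<integral>x. poly f x / poly q x \<partial>arcsine)"
proof -
  have "integrable arcsine (\<lambda>x. x ^ i * (1 / poly q x))" for i
    using integrable_arcsine_poly_divide[OF assms(1), of "monom 1 i"] by (simp add: poly_monom)
  then show ?thesis
    using moment_functional_integral[of n arcsine "\<lambda>x. 1 / poly q x" m f] assms(2,3) by simp
qed

lemma moment_functional_self:
  assumes "\<And>x. x \<in> {0..1} \<Longrightarrow> 0 < poly q x"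
    and "\<And>i. i \<le> n \<Longrightarrow> m i = (\<integral>x. x ^ i / poly q x \<partial>arcsine)" and "degree q \<le> n"
  shows "moment_functional m q = 1"
proof -
  have "moment_functional m q = (\<integral>x. poly q x / poly q x \<partial>arcsine)"
    by (rule moment_functional_arcsine[OF assms])
  also have "\<dots> = (\<integral>x. 1 \<partial>arcsine)"
  proof (rule integral_cong_AE)
    show "AE x in arcsine. poly q x / poly q x = 1"
      using AE_arcsine by eventually_elim (use assms(1) in force)
  qed simp_all
  finally show ?thesis using arcsine.prob_space by simp
qed

text \<open>
  A Bernstein--Szego theorem. Both sides represent the arcsine distribution on a balanced
  extension; evaluating that extension at squares \<open>q * (1 - G * f)\<^sup>2\<close> with \<open>f\<close> close to
  \<open>1 / (\<rho> * q)\<close> and perturbing \<open>f\<close> in the direction \<open>\<rho> * q - G\<close> forces equality.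
\<close>

lemma gap_poly_eq_smult:
  assumes sp: "strictly_positive l m" and o: "orthogonal_pair l m p r" and mp: "monic_pair l p r"
    and q: "degree q \<le> l" "\<And>x. x \<in> {0..1} \<Longrightarrow> 0 < poly q x"
    and m: "\<And>i. i \<le> l \<Longrightarrow> m i = (\<integral>x. x ^ i / poly q x \<partial>arcsine)"
  shows "gap_poly l p r = smult (moment_functional m (gap_poly l p r)) q"
proof -
  define G where "G = gap_poly l p r"
  define \<rho> where "\<rho> = moment_functional m G"
  have \<rho>: "\<rho> > 0" unfolding \<rho>_def G_def by (rule moment_functional_gap_pos[OF sp mp])
  have G\<rho>: "(\<integral>x. poly G x / poly q x \<partial>arcsine) = \<rho>"
    unfolding \<rho>_def using moment_functional_arcsine[OF q(2) m, where f = G] degree_gap_poly[OF mp] by (simp add: G_def)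
  have Lq: "moment_functional m q = 1"
    by (rule moment_functional_self[OF q(2) m q(1)])
  \<comment> \<open>The value of the extension at \<open>q * (1 - G * f)\<^sup>2\<close>. For
    \<open>f = 1 / (\<rho> * q)\<close>, which polynomials approximate, the integral is 0 and hence
    minimal, so its first variation, with the factor \<open>G - \<rho> * q\<close>, must
    vanish.\<close>
  have J: "0 \<le> (\<integral>x. 1 - 2 * \<rho> * poly q x * poly f x + \<rho> * poly q x * poly G x * (poly f x)\<^sup>2 \<partial>arcsine)" for f
  proof -
    let ?Q = "q * (1 - G * f)\<^sup>2"
    define n where "n = degree ?Q + degree (q * f) + degree (q * G * f\<^sup>2)"
    obtain m' where m': "\<forall>i\<le>l. m' i = m i" "strictly_positive (l + 2 * n) m'"
      "\<forall>f. degree f \<le> n \<longrightarrow> moment_functional m' (G * f) = \<rho> * (\<integral>x. poly f x \<partial>arcsine)"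
      using exists_arcsine_extension[OF sp o mp] unfolding G_def \<rho>_def by blast
    have "0 \<le> moment_functional m' ?Q"
    proof (cases "?Q = 0")
      case False
      then have "0 < moment_functional m' ?Q"
        using q(2) by (intro strictly_positiveD[OF m'(2)])
          (auto simp: n_def poly_power less_imp_le simp del: mult_eq_0_iff)
      then show ?thesis by simp
    qed (auto simp only: moment_functional_0)
    also have "?Q = q + smult (-2) (G * (q * f)) + G * (q * G * f\<^sup>2)"
    proof -
      have "smult (-2) R = - R - R" for R :: "real poly"
        using smult_add_left[of "-1" "-1" R] by simp
      then show ?thesis by (simp only:) (simp add: power2_eq_square algebra_simps)
    qed
    also have "moment_functional m' \<dots> = 1 - 2 * (\<rho> * (\<integral>x. poly (q * f) x \<partial>arcsine)) + \<rho> * (\<integral>x. poly (q * G * f\<^sup>2) x \<partial>arcsine)"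
    proof -
      have "moment_functional m' q = 1" using Lq m'(1) q(1) by (metis moment_functional_cong)
      moreover have "degree (q * f) \<le> n" "degree (q * G * f\<^sup>2) \<le> n" by (simp_all add: n_def)
      ultimately show ?thesis using m'(3) by (simp only: moment_functional_add moment_functional_smult)
    qed
    also have "\<dots> = (\<integral>x. 1 - 2 * \<rho> * poly (q * f) x + \<rho> * poly (q * G * f\<^sup>2) x \<partial>arcsine)"
    proof -
      have "(\<integral>x. 1 - a * u x + b * v x \<partial>arcsine) = 1 - a * (\<integral>x. u x \<partial>arcsine) + b * (\<integral>x. v x \<partial>arcsine)"
        if "integrable arcsine u" "integrable arcsine v" for a b :: real and u v
        using that arcsine.prob_space by simp
      from this[of "poly (q * f)" "poly (q * G * f\<^sup>2)" "2 * \<rho>" \<rho>] show ?thesis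
        by (simp only: integrable_arcsine_poly simp_thms mult.assoc)
    qed
    finally show ?thesis by (simp add: poly_power mult.assoc)
  qed
  define \<psi> where "\<psi> = G - smult \<rho> q"
  obtain K where K: "1 \<le> K" "\<And>x. x \<in> {0..1} \<Longrightarrow> \<bar>poly \<psi> x\<bar> \<le> K"
    by (rule bounded_on_unit_interval[of "poly \<psi>"]) (auto intro!: continuous_intros)
  obtain M where M: "1 \<le> M" "\<And>x. x \<in> {0..1} \<Longrightarrow> \<bar>poly (q * G) x\<bar> \<le> M"
    by (rule bounded_on_unit_interval[of "poly (q * G)"]) (auto intro!: continuous_intros)
  define S where "S = (\<integral>x. (poly \<psi> x)\<^sup>2 \<partial>arcsine)"
  \<comment> \<open>Collects what is of second order in \<open>t\<close>: \<open>K\<close> bounds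
    the contribution of the approximation error, the rest bounds the quadratic term.\<close>
  define C where "C = K + \<rho> * M * (1 + K\<^sup>2)"
  have le: "S \<le> t * C" if t: "0 < t" "t \<le> 1" for t
  proof -
    have "continuous_on {0..1} (\<lambda>x. 1 / (\<rho> * poly q x))"
      using \<rho> q(2) by (intro continuous_intros) (auto simp: less_le)
    \<comment> \<open>The accuracy \<open>t\<^sup>2\<close> keeps the error below the gain of first
      order in \<open>t\<close>.\<close>
    then obtain g where g: "\<And>x. x \<in> {0..1} \<Longrightarrow> \<bar>poly g x - 1 / (\<rho> * poly q x)\<bar> < t\<^sup>2"
      using poly_approximation[of _ "t\<^sup>2"] t by (metis zero_less_power)
    define f where "f = g - smult t \<psi>"
    have "0 \<le> (\<integral>x. 1 - 2 * \<rho> * poly q x * poly f x + \<rho> * poly q x * poly G x * (poly f x)\<^sup>2 \<partial>arcsine)"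
      by (rule J)
    also have "\<dots> \<le> (\<integral>x. (poly G x / poly q x / \<rho> - 1) - 2 * t * (poly \<psi> x)\<^sup>2 + 2 * t\<^sup>2 * C \<partial>arcsine)"
    proof (rule integral_mono_AE)
      show "integrable arcsine (\<lambda>x. 1 - 2 * \<rho> * poly q x * poly f x + \<rho> * poly q x * poly G x * (poly f x)\<^sup>2)"
        by (intro integrable_arcsine_continuous continuous_intros) measurable
      show "integrable arcsine (\<lambda>x. (poly G x / poly q x / \<rho> - 1) - 2 * t * (poly \<psi> x)\<^sup>2 + 2 * t\<^sup>2 * C)"
        using q(2) \<rho> by (intro integrable_arcsine_continuous continuous_intros) (auto simp: less_le)
      show "AE x in arcsine. 1 - 2 * \<rho> * poly q x * poly f x + \<rho> * poly q x * poly G x * (poly f x)\<^sup>2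
          \<le> (poly G x / poly q x / \<rho> - 1) - 2 * t * (poly \<psi> x)\<^sup>2 + 2 * t\<^sup>2 * C"
        using AE_arcsine
      proof eventually_elim
        case (elim x)
        define Q Gx s e where "Q = poly q x" and "Gx = poly G x" and "s = poly \<psi> x"
          and "e = poly g x - 1 / (\<rho> * Q)"
        have Q: "Q > 0" using q(2) elim by (simp add: Q_def)
        have s: "s = Gx - \<rho> * Q" by (simp add: s_def \<psi>_def Gx_def Q_def)
        have e: "\<bar>e\<bar> \<le> t\<^sup>2" using g[OF elim] by (simp add: e_def Q_def)
        have f: "poly f x = 1 / (\<rho> * Q) + (e - t * s)" by (simp add: f_def e_def s_def)
        \<comment> \<open>Expansion around \<open>1 / (\<rho> * Q)\<close>; by
          \<open>G\<rho>\<close> the part without \<open>y\<close> integrates to 0.\<close>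
        have "1 - 2 * \<rho> * Q * (1 / (\<rho> * Q) + y) + \<rho> * Q * Gx * (1 / (\<rho> * Q) + y)\<^sup>2 =
            (Gx / Q / \<rho> - 1) + 2 * s * y + \<rho> * (Q * Gx) * y\<^sup>2" for y
          using Q \<rho> unfolding s by (simp add: field_simps power2_eq_square)
        moreover have "2 * s * (e - t * s) + \<rho> * (Q * Gx) * (e - t * s)\<^sup>2 \<le> - 2 * t * s\<^sup>2 + 2 * t\<^sup>2 * C"
        proof -
          have sK: "\<bar>s\<bar> \<le> K" using K(2) elim by (simp add: s_def)
          have "s * e \<le> \<bar>s\<bar> * \<bar>e\<bar>" by (simp flip: abs_mult)
          also have "\<dots> \<le> K * t\<^sup>2" using sK e K(1) by (intro mult_mono) auto
          finally have 1: "s * e \<le> K * t\<^sup>2" .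
          have "(e - t * s)\<^sup>2 \<le> 2 * e\<^sup>2 + 2 * (t * s)\<^sup>2"
            using zero_le_power2[of "e + t * s"] by (simp add: power2_eq_square algebra_simps)
          also have "e\<^sup>2 \<le> t\<^sup>2"
          proof -
            have "\<bar>e\<bar> \<le> t" using e t power_decreasing[of 1 2 t] by simp
            then show ?thesis using t by (simp add: abs_le_square_iff[symmetric])
          qed
          also have "(t * s)\<^sup>2 \<le> t\<^sup>2 * K\<^sup>2"
            using sK K(1) by (simp add: power_mult_distrib abs_le_square_iff[symmetric] mult_left_mono)
          finally have 2: "(e - t * s)\<^sup>2 \<le> 2 * t\<^sup>2 * (1 + K\<^sup>2)" by (simp add: algebra_simps)
          have "Q * Gx \<le> M" using M(2)[OF elim] by (simp add: Q_def Gx_def)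
          then have "\<rho> * (Q * Gx) * (e - t * s)\<^sup>2 \<le> \<rho> * M * (e - t * s)\<^sup>2"
            using \<rho> by (intro mult_right_mono mult_left_mono) auto
          also have "\<dots> \<le> \<rho> * M * (2 * t\<^sup>2 * (1 + K\<^sup>2))"
            using 2 \<rho> M(1) by (intro mult_left_mono) auto
          finally show ?thesis using 1 by (simp add: C_def power2_eq_square algebra_simps)
        qed
        ultimately show ?case
          unfolding f Q_def[symmetric] Gx_def[symmetric] s_def[symmetric] by (simp add: mult.assoc)
      qed
    qed
    also have "\<dots> = - 2 * t * S + 2 * t\<^sup>2 * C"
    proof -
      have i: "integrable arcsine (\<lambda>x. poly G x / poly q x)" "integrable arcsine (\<lambda>x. (poly \<psi> x)\<^sup>2)"
        using integrable_arcsine_poly_divide[OF q(2), of G] integrable_arcsine_poly_square[of \<psi>]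
        by simp_all
      have "(\<integral>x. (u x / \<rho> - 1) - a * v x + b \<partial>arcsine) = (\<integral>x. u x \<partial>arcsine) / \<rho> - 1 - a * (\<integral>x. v x \<partial>arcsine) + b"
        if "integrable arcsine u" "integrable arcsine v" for a b :: real and u v
        using that arcsine.prob_space by simp
      from this[OF i] show ?thesis using \<rho> by (simp only: G\<rho>) (simp add: S_def)
    qed
    finally have "2 * t * S \<le> 2 * t * (t * C)" by (simp add: power2_eq_square)
    then show ?thesis using t by (simp add: mult.assoc)
  qed
  have "S \<le> 0"
  proof (rule ccontr)
    assume "\<not> S \<le> 0"
    then have S: "S > 0" by simp
    have C: "C > 0" unfolding C_def using K(1) M(1) \<rho> by (intro add_pos_nonneg) auto
    have "S \<le> min 1 (S / (2 * C)) * C" using S C by (intro le) auto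
    also have "\<dots> \<le> S / (2 * C) * C" using C by (intro mult_right_mono) auto
    also have "\<dots> < S" using S C by simp
    finally show False by simp
  qed
  moreover have "integrable arcsine (\<lambda>x. (poly \<psi> x)\<^sup>2)"
    by (rule integrable_arcsine_poly_square)
  ultimately have "AE x in arcsine. (poly \<psi> x)\<^sup>2 = 0"
    using integral_nonneg_eq_0_iff_AE[where M = arcsine and f = "\<lambda>x. (poly \<psi> x)\<^sup>2"]
      integral_nonneg_AE[where M = arcsine and f = "\<lambda>x. (poly \<psi> x)\<^sup>2"]
    by (simp add: S_def order_antisym)
  then have "poly \<psi> x = 0" if "x \<in> {0..1}" for x
    using that by (intro arcsine_continuous_eq_0) (auto intro!: continuous_intros)
  then have "{0..1} \<subseteq> {x. poly \<psi> x = 0}" by blast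
  then have "\<psi> = 0"
    using poly_roots_finite[of \<psi>] by (metis finite_subset infinite_Icc zero_less_one)
  then show ?thesis by (simp add: \<psi>_def G_def \<rho>_def)
qed

section \<open>Representing densities\<close>

lemma bounded_functions_subseq:
  fixes f :: "nat \<Rightarrow> 'a \<Rightarrow> real"
  assumes "finite I" and "\<And>k i. i \<in> I \<Longrightarrow> \<bar>f k i\<bar> \<le> B"
  obtains g r where "strict_mono r" "\<And>i. i \<in> I \<Longrightarrow> (\<lambda>k. f (r k) i) \<longlonglongrightarrow> g i"
proof -
  have "\<forall>d\<subseteq>I. \<exists>l::'a \<Rightarrow> real. \<exists>r. strict_mono r \<and>
      (\<forall>e>0. \<forall>\<^sub>F n in sequentially. \<forall>i\<in>d. dist (f (r n) i) (l i) < e)"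
    by (rule compact_lemma_general[where unproj = "\<lambda>x. x"])
      (use assms in \<open>auto simp: bounded_iff\<close>)
  then obtain g r where r: "strict_mono r"
    and lim: "\<And>e. e > 0 \<Longrightarrow> \<forall>\<^sub>F n in sequentially. \<forall>i\<in>I. dist (f (r n) i) (g i) < e"
    by blast
  have "(\<lambda>k. f (r k) i) \<longlonglongrightarrow> g i" if "i \<in> I" for i
  proof (rule tendstoI)
    fix e :: real assume "e > 0"
    from lim[OF this] show "\<forall>\<^sub>F n in sequentially. dist (f (r n) i) (g i) < e"
      by eventually_elim (use that in auto)
  qed
  then show ?thesis using r that by blast
qed

lemma ln_one_plus_ge: "\<bar>w\<bar> \<le> 1/2 \<Longrightarrow> w - 2 * w\<^sup>2 \<le> ln (1 + w)" for w :: real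
proof (cases "0 \<le> w")
  case True
  assume "\<bar>w\<bar> \<le> 1/2"
  then show ?thesis using True ln_one_plus_pos_lower_bound[of w] zero_le_power2[of w] by linarith
next
  case False
  assume "\<bar>w\<bar> \<le> 1/2"
  then show ?thesis using False ln_one_minus_pos_lower_bound[of "- w"]
    by (simp add: power2_eq_square)
qed

context
  fixes I :: "nat set" and m :: "nat \<Rightarrow> real"
begin

text \<open>Polynomials with exponents in \<open>I\<close> only are handled through their
  coefficient functions; the values of \<open>y\<close> outside \<open>I\<close> are
  ignored.\<close>

definition sparse_poly :: "(nat \<Rightarrow> real) \<Rightarrow> real poly" where
  "sparse_poly y = (\<Sum>i\<in>I. monom (y i) i)"

definition sparse_eval :: "(nat \<Rightarrow> real) \<Rightarrow> real \<Rightarrow> real" where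
  "sparse_eval y x = (\<Sum>i\<in>I. y i * x ^ i)"

definition sparse_mean :: "(nat \<Rightarrow> real) \<Rightarrow> real" where
  "sparse_mean y = (\<Sum>i\<in>I. y i * m i)"

definition feasible :: "(nat \<Rightarrow> real) set" where
  "feasible = {y. (\<forall>x\<in>{0..1}. 0 \<le> sparse_eval y x) \<and> sparse_mean y = 1}"

context
  assumes fin: "finite I" and I0: "0 \<in> I" and m0: "m 0 = 1"
    and pos: "\<And>P. (\<And>i. i \<notin> I \<Longrightarrow> coeff P i = 0) \<Longrightarrow> P \<noteq> 0 \<Longrightarrow>
      (\<And>x. x \<in> {0..1} \<Longrightarrow> 0 \<le> poly P x) \<Longrightarrow> 0 < moment_functional m P"
begin

lemma coeff_sparse_poly: "coeff (sparse_poly y) i = (if i \<in> I then y i else 0)"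
  using fin by (simp add: sparse_poly_def coeff_sum)

lemma poly_sparse_poly: "poly (sparse_poly y) x = sparse_eval y x"
  by (simp add: sparse_poly_def sparse_eval_def poly_sum poly_monom)

lemma moment_functional_sparse_poly: "moment_functional m (sparse_poly y) = sparse_mean y"
proof -
  have "moment_functional m (\<Sum>i\<in>J. monom (y i) i) = (\<Sum>i\<in>J. y i * m i)" if "finite J" for J
    using that by induction (simp_all add: moment_functional_add moment_functional_monom)
  then show ?thesis using fin by (simp add: sparse_poly_def sparse_mean_def)
qed

lemma sparse_mean_pos:
  assumes "\<And>x. x \<in> {0..1} \<Longrightarrow> 0 \<le> sparse_eval y x" "i \<in> I" "y i \<noteq> 0"
  shows "0 < sparse_mean y"
proof -
  have "sparse_poly y \<noteq> 0" using assms(2,3) coeff_sparse_poly[of y i] by auto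
  then show ?thesis
    unfolding moment_functional_sparse_poly[symmetric]
    using assms(1) by (intro pos) (auto simp: coeff_sparse_poly poly_sparse_poly)
qed

lemma sparse_eval_linear: "sparse_eval (\<lambda>i. a * y i + b * z i) x = a * sparse_eval y x + b * sparse_eval z x"
  by (simp add: sparse_eval_def sum.distrib sum_distrib_left algebra_simps)

lemma sparse_mean_linear: "sparse_mean (\<lambda>i. a * y i + b * z i) = a * sparse_mean y + b * sparse_mean z"
  by (simp add: sparse_mean_def sum.distrib sum_distrib_left algebra_simps)

text \<open>Compactness: unbounded feasible coefficients, rescaled to absolute sum 1, would have a
  nonzero limit that is nonnegative on \<open>{0..1}\<close> and has mean 0, against strict
  positivity.\<close>

lemma feasible_bound:
  obtains D where "1 \<le> D" "\<And>y i. y \<in> feasible \<Longrightarrow> i \<in> I \<Longrightarrow> \<bar>y i\<bar> \<le> D"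
proof -
  have "\<exists>D. \<forall>y\<in>feasible. (\<Sum>i\<in>I. \<bar>y i\<bar>) \<le> D"
  proof (rule ccontr)
    assume "\<not> ?thesis"
    then have "\<forall>k. \<exists>y\<in>feasible. (\<Sum>i\<in>I. \<bar>y i\<bar>) > real (Suc k)"
      by (metis linorder_not_le)
    then obtain y where y: "\<And>k. y k \<in> feasible" "\<And>k. (\<Sum>i\<in>I. \<bar>y k i\<bar>) > real (Suc k)"
      by metis
    define s where "s k = (\<Sum>i\<in>I. \<bar>y k i\<bar>)" for k
    have s: "s k > real (Suc k)" for k using y by (simp add: s_def)
    have s0: "s k > 0" for k using s[of k] by simp
    define z where "z k i = y k i / s k" for k i
    have z1: "(\<Sum>i\<in>I. \<bar>z k i\<bar>) = 1" for k
    proof -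
      have "(\<Sum>i\<in>I. \<bar>z k i\<bar>) = (\<Sum>i\<in>I. \<bar>y k i\<bar> / s k)" using s0[of k] by (simp add: z_def)
      also have "\<dots> = s k / s k" unfolding sum_divide_distrib[symmetric] by (simp only: s_def)
      finally show ?thesis using s0[of k] by (simp only: divide_self)
    qed
    have "\<bar>z k i\<bar> \<le> 1" if "i \<in> I" for k i
      using member_le_sum[OF that, of "\<lambda>i. \<bar>z k i\<bar>"] fin z1 by simp
    then obtain g r where r: "strict_mono r" and g: "\<And>i. i \<in> I \<Longrightarrow> (\<lambda>k. z (r k) i) \<longlonglongrightarrow> g i"
      by (rule bounded_functions_subseq[OF fin, of z 1]) auto
    have "(\<lambda>k. \<Sum>i\<in>I. \<bar>z (r k) i\<bar>) \<longlonglongrightarrow> (\<Sum>i\<in>I. \<bar>g i\<bar>)"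
      using g by (intro tendsto_sum tendsto_rabs)
    then have g1: "(\<Sum>i\<in>I. \<bar>g i\<bar>) = 1" using z1 by (simp add: LIMSEQ_const_iff)
    have nn: "0 \<le> sparse_eval g x" if "x \<in> {0..1}" for x
    proof (rule LIMSEQ_le_const)
      show "(\<lambda>k. sparse_eval (z (r k)) x) \<longlonglongrightarrow> sparse_eval g x"
        unfolding sparse_eval_def using g by (intro tendsto_sum tendsto_mult_right)
      have "sparse_eval (z k) x = sparse_eval (y k) x / s k" for k
        by (simp add: sparse_eval_def z_def sum_divide_distrib)
      then show "\<exists>N. \<forall>n\<ge>N. 0 \<le> sparse_eval (z (r n)) x"
        using y(1) that s0 by (auto simp: feasible_def less_imp_le intro!: exI[of _ 0] divide_nonneg_pos)
    qed
    have "(\<lambda>k. sparse_mean (z (r k))) \<longlonglongrightarrow> sparse_mean g"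
      unfolding sparse_mean_def using g by (intro tendsto_sum tendsto_mult_right)
    moreover have "sparse_mean (z k) = 1 / s k" for k
    proof -
      have "sparse_mean (z k) = sparse_mean (y k) / s k"
        by (simp add: sparse_mean_def z_def sum_divide_distrib)
      then show ?thesis using y(1)[of k] by (simp add: feasible_def)
    qed
    moreover have "(\<lambda>k. 1 / s (r k)) \<longlonglongrightarrow> 0"
    proof (rule tendsto_sandwich[where f = "\<lambda>_. 0" and h = "\<lambda>k. inverse (real (Suc k))"])
      have "1 / s (r k) \<le> inverse (real (Suc k))" for k
        using s[of "r k"] seq_suble[OF r, of k] by (simp add: field_simps)
      then show "\<forall>\<^sub>F k in sequentially. 1 / s (r k) \<le> inverse (real (Suc k))" by simp
    qed (use s0 LIMSEQ_inverse_real_of_nat in \<open>auto simp: less_imp_le\<close>)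
    ultimately have "sparse_mean g = 0" by (simp add: LIMSEQ_unique)
    moreover have "\<exists>i\<in>I. g i \<noteq> 0" using g1 by (metis abs_zero sum.neutral zero_neq_one)
    ultimately show False using sparse_mean_pos[of g] nn by auto
  qed
  then obtain D where D: "\<And>y. y \<in> feasible \<Longrightarrow> (\<Sum>i\<in>I. \<bar>y i\<bar>) \<le> D" by blast
  show ?thesis
  proof (rule that[of "max 1 D"])
    fix y i assume "y \<in> feasible" "i \<in> I"
    then show "\<bar>y i\<bar> \<le> max 1 D"
      using member_le_sum[of i I "\<lambda>i. \<bar>y i\<bar>"] D[of y] fin by fastforce
  qed simp
qed

lemma continuous_on_sparse_eval [continuous_intros]: "continuous_on A (sparse_eval y)"
  unfolding sparse_eval_def by (intro continuous_intros)

lemma borel_measurable_sparse_eval [measurable]: "sparse_eval y \<in> borel_measurable borel"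
  by (intro borel_measurable_continuous_onI continuous_intros)

lemma feasible_const: "(\<lambda>i. if i = 0 then 1 else 0) \<in> feasible"
  using fin I0 m0 by (simp add: feasible_def sparse_eval_def sparse_mean_def if_distrib[of "\<lambda>x. x * _"] cong: if_cong)

text \<open>
  Near-maximizers of the regularized entropy \<open>\<integral> ln (q + e) \<partial>arcsine\<close>: the derivative
  towards any competitor is almost nonpositive.
\<close>

lemma exists_near_maximizer:
  assumes e: "0 < e" "e \<le> 1"
  obtains z where "z \<in> feasible"
    "\<And>y. y \<in> feasible \<Longrightarrow> (\<integral>x. sparse_eval y x / (sparse_eval z x + e) \<partial>arcsine) \<le> 1 + 2 * e"
proof -
  obtain D where D: "1 \<le> D" "\<And>y i. y \<in> feasible \<Longrightarrow> i \<in> I \<Longrightarrow> \<bar>y i\<bar> \<le> D"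
    by (rule feasible_bound) blast
  define B where "B = real (card I) * D"
  have "card I \<ge> 1" using fin I0 by (auto simp: Suc_le_eq card_gt_0_iff)
  then have B: "B \<ge> 1" unfolding B_def using D(1) mult_mono[of 1 "real (card I)" 1 D] by simp
  have bd: "\<bar>sparse_eval y x\<bar> \<le> B" if "y \<in> feasible" "x \<in> {0..1}" for y x
  proof -
    have "\<bar>sparse_eval y x\<bar> \<le> (\<Sum>i\<in>I. \<bar>y i * x ^ i\<bar>)" unfolding sparse_eval_def by (rule sum_abs)
    also have "\<dots> \<le> (\<Sum>i\<in>I. D)"
    proof (rule sum_mono)
      fix i assume "i \<in> I"
      then have "\<bar>y i\<bar> * \<bar>x ^ i\<bar> \<le> D * 1"
        using D that by (intro mult_mono) (auto simp: power_le_one)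
      then show "\<bar>y i * x ^ i\<bar> \<le> D" by (simp add: abs_mult)
    qed
    finally show ?thesis by (simp add: B_def)
  qed
  have nn: "0 \<le> sparse_eval y x" if "y \<in> feasible" "x \<in> {0..1}" for y x
    using that by (simp add: feasible_def)
  \<comment> \<open>A feasible polynomial may vanish in \<open>{0..1}\<close>; the shift by
    \<open>e\<close> keeps logarithms and quotients bounded.\<close>
  define F where "F y = (\<integral>x. ln (sparse_eval y x + e) \<partial>arcsine)" for y
  have int_ln: "integrable arcsine (\<lambda>x. ln (sparse_eval y x + e))" if "y \<in> feasible" for y
    using nn[OF that] e by (intro integrable_arcsine_continuous continuous_intros) (auto simp: add_nonneg_eq_0_iff)
  have Fle: "F y \<le> ln (B + 1)" if "y \<in> feasible" for y
  proof -
    have "F y \<le> (\<integral>x. ln (B + 1) \<partial>arcsine)"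
      unfolding F_def
    proof (rule integral_mono_AE)
      show "AE x in arcsine. ln (sparse_eval y x + e) \<le> ln (B + 1)"
        using AE_arcsine
      proof eventually_elim
        case (elim x)
        then show ?case using nn[OF that elim] bd[OF that elim] e by (intro ln_mono) auto
      qed
    qed (use int_ln[OF that] in auto)
    then show ?thesis using arcsine.prob_space by simp
  qed
  define W where "W = 2 * B / e"
  have W: "W \<ge> 1" unfolding W_def using B e by (simp add: field_simps)
  \<comment> \<open>\<open>W\<close> will bound the relative change \<open>w\<close>. The step
    \<open>t\<close> is so short that \<open>\<bar>t * w\<bar> \<le> 1/2\<close>, as the quadratic
    bound on the logarithm demands, and that the loss \<open>2 * t\<^sup>2 * W\<^sup>2\<close> is
    only \<open>t * e / 2\<close>.\<close>
  define t where "t = e / (4 * W\<^sup>2)"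
  have W2: "W \<le> W\<^sup>2" using W by (simp add: power2_eq_square mult_le_cancel_left1)
  have t: "0 < t" "t \<le> 1" "t * W \<le> 1/2" "t * W\<^sup>2 = e / 4"
  proof -
    show "0 < t" "t * W\<^sup>2 = e / 4" using e W by (simp_all add: t_def)
    then show "t * W \<le> 1/2" using e mult_left_mono[OF W2, of t] by linarith
    then show "t \<le> 1" using \<open>0 < t\<close> mult_left_mono[OF W, of t] by linarith
  qed
  define S where "S = (SUP y\<in>feasible. F y)"
  have bddF: "bdd_above (F ` feasible)" using Fle by (auto intro!: bdd_aboveI)
  \<comment> \<open>The slack below the supremum is proportional to \<open>t\<close>, so it costs
    only \<open>e\<close> after the division by \<open>t\<close>.\<close>
  have "\<exists>z\<in>feasible. S - t * e < F z"
    unfolding S_def using feasible_const bddF t(1) e(1)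
    by (subst less_cSUP_iff[symmetric]) (auto intro!: diff_less)
  then obtain z where z: "z \<in> feasible" "S - t * e < F z" by blast
  show ?thesis
  proof (rule that[OF z(1)])
    fix y assume y: "y \<in> feasible"
    define w where "w x = (sparse_eval y x - sparse_eval z x) / (sparse_eval z x + e)" for x
    have wW: "\<bar>w x\<bar> \<le> W" if "x \<in> {0..1}" for x
    proof -
      have "\<bar>sparse_eval y x - sparse_eval z x\<bar> \<le> 2 * B" using bd[OF y that] bd[OF z(1) that] by linarith
      moreover have "e \<le> sparse_eval z x + e" using nn[OF z(1) that] by simp
      ultimately show ?thesis unfolding w_def W_def using e B by (auto intro!: frac_le)
    qed
    have iw: "integrable arcsine w"
      unfolding w_def using nn[OF z(1)] e
      by (intro integrable_arcsine_continuous continuous_intros) (auto simp: add_nonneg_eq_0_iff)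
    define y' where "y' i = (1 - t) * z i + t * y i" for i
    have y': "y' \<in> feasible"
      using y z(1) t unfolding y'_def feasible_def by (auto simp: sparse_eval_linear sparse_mean_linear)
    have "F z + (t * (\<integral>x. w x \<partial>arcsine) - 2 * (t\<^sup>2 * W\<^sup>2)) = (\<integral>x. ln (sparse_eval z x + e) + (t * w x - 2 * (t\<^sup>2 * W\<^sup>2)) \<partial>arcsine)"
      using int_ln[OF z(1)] iw arcsine.prob_space unfolding F_def by simp
    also have "\<dots> \<le> F y'"
      unfolding F_def
    proof (rule integral_mono_AE)
      show "AE x in arcsine. ln (sparse_eval z x + e) + (t * w x - 2 * (t\<^sup>2 * W\<^sup>2)) \<le> ln (sparse_eval y' x + e)"
        using AE_arcsine
      proof eventually_elim
        case (elim x)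
        have p: "sparse_eval z x + e > 0" using nn[OF z(1) elim] e by simp
        have "\<bar>t * w x\<bar> \<le> t * W" using wW[OF elim] t(1) by (simp add: abs_mult)
        then have tw: "\<bar>t * w x\<bar> \<le> 1/2" using t(3) by simp
        have "(w x)\<^sup>2 \<le> W\<^sup>2" using wW[OF elim] by (simp add: abs_le_square_iff[symmetric])
        then have "t * w x - 2 * (t\<^sup>2 * W\<^sup>2) \<le> t * w x - 2 * (t * w x)\<^sup>2"
          by (simp add: power_mult_distrib mult_left_mono)
        also have "\<dots> \<le> ln (1 + t * w x)" by (rule ln_one_plus_ge[OF tw])
        finally have "ln (sparse_eval z x + e) + (t * w x - 2 * (t\<^sup>2 * W\<^sup>2)) \<le> ln (sparse_eval z x + e) + ln (1 + t * w x)"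
          by simp
        also have "\<dots> = ln ((sparse_eval z x + e) * (1 + t * w x))" using p tw by (simp add: ln_mult)
        also have "(sparse_eval z x + e) * (1 + t * w x) = sparse_eval y' x + e"
          unfolding y'_def sparse_eval_linear w_def using p by (simp add: field_simps)
        finally show ?case .
      qed
    qed (use int_ln[OF z(1)] int_ln[OF y'] iw in auto)
    also have "F y' \<le> S" unfolding S_def using y' bddF by (intro cSUP_upper)
    also have "S \<le> F z + t * e" using z(2) by simp
    finally have "t * (\<integral>x. w x \<partial>arcsine) \<le> t * (2 * (t * W\<^sup>2) + e)"
      by (simp add: power2_eq_square algebra_simps)
    then have "(\<integral>x. w x \<partial>arcsine) \<le> e / 2 + e" using t(1,4) by simp
    moreover have "(\<integral>x. sparse_eval y x / (sparse_eval z x + e) \<partial>arcsine) \<le> (\<integral>x. 1 + w x \<partial>arcsine)"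
    proof (rule integral_mono_AE)
      show "AE x in arcsine. sparse_eval y x / (sparse_eval z x + e) \<le> 1 + w x"
        using AE_arcsine
      proof eventually_elim
        case (elim x)
        have p: "sparse_eval z x + e > 0" using nn[OF z(1) elim] e by simp
        then have "1 + w x = (sparse_eval y x + e) / (sparse_eval z x + e)"
          unfolding w_def by (simp add: field_simps)
        then show ?case using e p by (simp add: divide_right_mono)
      qed
      show "integrable arcsine (\<lambda>x. sparse_eval y x / (sparse_eval z x + e))"
        using nn[OF z(1)] e
        by (intro integrable_arcsine_continuous continuous_intros) (auto simp: add_nonneg_eq_0_iff)
    qed (use iw in auto)
    moreover have "(\<integral>x. 1 + w x \<partial>arcsine) = 1 + (\<integral>x. w x \<partial>arcsine)"
      using iw arcsine.prob_space by simp
    ultimately show "(\<integral>x. sparse_eval y x / (sparse_eval z x + e) \<partial>arcsine) \<le> 1 + 2 * e"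
      using e by simp
  qed
qed

text \<open>As the regularization tends to 0, Fatou turns near-optimality into
  \<open>\<integral> y / g \<le> 1\<close> for all feasible \<open>y\<close>. The case
  \<open>y = 1\<close> forces \<open>g\<close> to be free of zeros in \<open>{0..1}\<close>. Then
  small perturbations of \<open>g\<close> in any direction stay nonnegative, and using both signs of
  a direction gives equality; monomials yield the moments.\<close>

lemma exists_density_poly:
  obtains q where "\<And>i. i \<notin> I \<Longrightarrow> coeff q i = 0" "\<And>x. x \<in> {0..1} \<Longrightarrow> 0 < poly q x"
    "\<And>i. i \<in> I \<Longrightarrow> (\<integral>x. x ^ i / poly q x \<partial>arcsine) = m i"
proof -
  define e where "e k = inverse (real (Suc k))" for k
  have e: "0 < e k" "e k \<le> 1" for k by (auto simp: e_def field_simps)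
  have "\<exists>z. z \<in> feasible \<and> (\<forall>y\<in>feasible. (\<integral>x. sparse_eval y x / (sparse_eval z x + e k) \<partial>arcsine) \<le> 1 + 2 * e k)" for k
    by (rule exists_near_maximizer[OF e[of k]]) blast
  then obtain z where z: "\<And>k. z k \<in> feasible"
    and opt: "\<And>k y. y \<in> feasible \<Longrightarrow> (\<integral>x. sparse_eval y x / (sparse_eval (z k) x + e k) \<partial>arcsine) \<le> 1 + 2 * e k"
    by metis
  obtain D where D: "\<And>y i. y \<in> feasible \<Longrightarrow> i \<in> I \<Longrightarrow> \<bar>y i\<bar> \<le> D"
    by (rule feasible_bound) blast
  obtain g r where r: "strict_mono r" and g: "\<And>i. i \<in> I \<Longrightarrow> (\<lambda>k. z (r k) i) \<longlonglongrightarrow> g i"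
    by (rule bounded_functions_subseq[OF fin, of z D]) (use D z in auto)
  have e0: "(\<lambda>k. e (r k)) \<longlonglongrightarrow> 0"
    using LIMSEQ_subseq_LIMSEQ[OF LIMSEQ_inverse_real_of_nat r] by (simp add: e_def o_def)
  have ev0: "(\<lambda>k. sparse_eval (z (r k)) x) \<longlonglongrightarrow> sparse_eval g x" for x
    unfolding sparse_eval_def using g by (intro tendsto_sum tendsto_mult_right)
  have ev: "(\<lambda>k. sparse_eval (z (r k)) x + e (r k)) \<longlonglongrightarrow> sparse_eval g x" for x
    using tendsto_add[OF ev0 e0] by simp
  have nn: "0 \<le> sparse_eval y x" if "y \<in> feasible" "x \<in> {0..1}" for y x
    using that by (simp add: feasible_def)
  have gnn: "0 \<le> sparse_eval g x" if "x \<in> {0..1}" for x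
    by (rule LIMSEQ_le_const[OF ev0]) (use nn[OF z that] in auto)
  have "(\<lambda>k. sparse_mean (z (r k))) \<longlonglongrightarrow> sparse_mean g"
    unfolding sparse_mean_def using g by (intro tendsto_sum tendsto_mult_right)
  then have g1: "sparse_mean g = 1" using z by (simp add: feasible_def LIMSEQ_const_iff)
  have pos_e: "0 < sparse_eval (z k) x + e k" if "x \<in> {0..1}" for k x
    using nn[OF z that, of k] e[of k] by simp
  \<comment> \<open>The limit \<open>h\<close> is extended-valued because this is used twice: while
    \<open>g\<close> may still have zeros, with \<open>h\<close> the possibly infinite reciprocal,
    and later with a finite quotient.\<close>
  have fatou: "(\<integral>\<^sup>+x. h x \<partial>arcsine) \<le> 1"
    if y: "y \<in> feasible" and h: "\<And>x. x \<in> {0..1} \<Longrightarrow>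
      (\<lambda>k. ennreal (sparse_eval y x / (sparse_eval (z (r k)) x + e (r k)))) \<longlonglongrightarrow> h x" for y h
  proof -
    let ?u = "\<lambda>k x. sparse_eval y x / (sparse_eval (z (r k)) x + e (r k))"
    have iu: "integrable arcsine (?u k)" for k
    proof (intro integrable_arcsine_continuous continuous_intros)
      show "\<forall>x\<in>{0..1}. sparse_eval (z (r k)) x + e (r k) \<noteq> 0"
        using pos_e by (metis less_irrefl)
    qed measurable
    have "(\<integral>\<^sup>+x. h x \<partial>arcsine) = (\<integral>\<^sup>+x. liminf (\<lambda>k. ennreal (?u k x)) \<partial>arcsine)"
    proof (rule nn_integral_cong_AE)
      show "AE x in arcsine. h x = liminf (\<lambda>k. ennreal (?u k x))"
        using AE_arcsine by eventually_elim (use h lim_imp_Liminf in force)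
    qed
    also have "\<dots> \<le> liminf (\<lambda>k. \<integral>\<^sup>+x. ennreal (?u k x) \<partial>arcsine)"
      by (rule nn_integral_liminf) measurable
    also have "\<dots> \<le> liminf (\<lambda>k. ennreal (1 + 2 * e (r k)))"
    proof (rule Liminf_mono, rule always_eventually, rule allI)
      fix k
      have "AE x in arcsine. 0 \<le> ?u k x"
        using AE_arcsine
      proof eventually_elim
        case (elim x)
        then show ?case using nn[OF y elim] pos_e[OF elim, of "r k"] by simp
      qed
      then have "(\<integral>\<^sup>+x. ennreal (?u k x) \<partial>arcsine) = ennreal (\<integral>x. ?u k x \<partial>arcsine)"
        by (intro nn_integral_eq_integral iu)
      then show "(\<integral>\<^sup>+x. ennreal (?u k x) \<partial>arcsine) \<le> ennreal (1 + 2 * e (r k))"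
        using opt[OF y, of "r k"] by (simp add: ennreal_leI)
    qed
    also have "\<dots> = ennreal (1 + 2 * 0)"
      by (intro lim_imp_Liminf tendsto_ennrealI tendsto_intros e0) auto
    finally show ?thesis by simp
  qed
  have g_pos: "0 < sparse_eval g x0" if x0: "x0 \<in> {0..1}" for x0
  proof (rule ccontr)
    assume "\<not> 0 < sparse_eval g x0"
    then have "poly (sparse_poly g) x0 = 0" using gnn[OF x0] by (simp add: poly_sparse_poly)
    then obtain R where R: "sparse_poly g = [:-x0, 1:] * R" by (auto simp: poly_eq_0_iff_dvd elim: dvdE)
    obtain K where K: "1 \<le> K" "\<And>x. x \<in> {0..1} \<Longrightarrow> \<bar>poly R x\<bar> \<le> K"
      by (rule bounded_on_unit_interval[of "poly R"]) (auto intro!: continuous_intros)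
    let ?one = "\<lambda>i::nat. if i = 0 then 1 else 0 :: real"
    have one: "sparse_eval ?one x = 1" for x
      using fin I0 by (simp add: sparse_eval_def if_distrib[of "\<lambda>x. x * _"] cong: if_cong)
    have "(\<integral>\<^sup>+x. inverse (ennreal (sparse_eval g x)) \<partial>arcsine) \<le> 1"
    proof (rule fatou[OF feasible_const])
      fix x :: real assume x: "x \<in> {0..1}"
      have "(\<lambda>k. inverse (ennreal (sparse_eval (z (r k)) x + e (r k)))) \<longlonglongrightarrow> inverse (ennreal (sparse_eval g x))"
        using ev by (intro continuous_on_tendsto_compose[where f = inverse and s = UNIV]
          continuous_on_inverse_ennreal continuous_on_id tendsto_ennrealI) auto
      then show "(\<lambda>k. ennreal (sparse_eval ?one x / (sparse_eval (z (r k)) x + e (r k)))) \<longlonglongrightarrow>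
          inverse (ennreal (sparse_eval g x))"
        using pos_e[OF x] by (simp add: one inverse_ennreal inverse_eq_divide)
    qed
    then have "ennreal K * (\<integral>\<^sup>+x. inverse (ennreal (sparse_eval g x)) \<partial>arcsine) \<noteq> \<infinity>"
      by (auto simp: ennreal_mult_eq_top_iff top_unique)
    moreover have "(\<integral>\<^sup>+x. inverse (ennreal \<bar>x - x0\<bar>) \<partial>arcsine) \<le>
        ennreal K * (\<integral>\<^sup>+x. inverse (ennreal (sparse_eval g x)) \<partial>arcsine)"
    proof (subst nn_integral_cmult[symmetric])
      show "(\<integral>\<^sup>+x. inverse (ennreal \<bar>x - x0\<bar>) \<partial>arcsine) \<le>
        (\<integral>\<^sup>+x. ennreal K * inverse (ennreal (sparse_eval g x)) \<partial>arcsine)"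
      proof (rule nn_integral_mono_AE)
        show "AE x in arcsine. inverse (ennreal \<bar>x - x0\<bar>) \<le> ennreal K * inverse (ennreal (sparse_eval g x))"
          using AE_arcsine
        proof eventually_elim
          case (elim x)
          have "sparse_eval g x = (x - x0) * poly R x"
            using arg_cong[OF R, of "\<lambda>P. poly P x"] by (simp add: poly_sparse_poly algebra_simps)
          then have le: "sparse_eval g x \<le> K * \<bar>x - x0\<bar>"
            using gnn[OF elim] K(2)[OF elim] by (metis abs_ge_self abs_ge_zero abs_mult mult.commute mult_right_mono order_trans)
          show ?case
          proof (cases "sparse_eval g x = 0")
            case True
            then show ?thesis using K(1) by (simp add: ennreal_mult_top)
          next
            case False
            then have gp: "0 < sparse_eval g x" using gnn[OF elim] by simp
            then have xp: "0 < \<bar>x - x0\<bar>" using le K(1) by (cases "x = x0") auto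
            have "inverse \<bar>x - x0\<bar> \<le> K * inverse (sparse_eval g x)"
              using le gp xp by (simp add: field_simps)
            then show ?thesis
              using gp xp K(1) by (simp add: inverse_ennreal ennreal_mult'[symmetric] ennreal_leI)
          qed
        qed
      qed
    qed measurable
    ultimately show False
      using nn_integral_arcsine_inverse_dist[OF x0] by (simp add: top_unique)
  qed
  have ig: "integrable arcsine (\<lambda>x. sparse_eval y x / sparse_eval g x)" for y
  proof (intro integrable_arcsine_continuous continuous_intros)
    show "\<forall>x\<in>{0..1}. sparse_eval g x \<noteq> 0" using g_pos by (metis less_irrefl)
  qed measurable
  have le1: "(\<integral>x. sparse_eval y x / sparse_eval g x \<partial>arcsine) \<le> 1" if y: "y \<in> feasible" for y
  proof -
    have "(\<integral>\<^sup>+x. ennreal (sparse_eval y x / sparse_eval g x) \<partial>arcsine) \<le> 1"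
    proof (rule fatou[OF y])
      fix x :: real assume "x \<in> {0..1}"
      then show "(\<lambda>k. ennreal (sparse_eval y x / (sparse_eval (z (r k)) x + e (r k)))) \<longlonglongrightarrow>
          ennreal (sparse_eval y x / sparse_eval g x)"
        using g_pos[of x] by (intro tendsto_ennrealI tendsto_divide tendsto_const ev) auto
    qed
    moreover have "AE x in arcsine. 0 \<le> sparse_eval y x / sparse_eval g x"
      using AE_arcsine by eventually_elim (use nn[OF y] g_pos in \<open>auto simp: less_imp_le\<close>)
    ultimately show ?thesis
      using nn_integral_eq_integral[OF ig, of y] by simp
  qed
  have key: "(\<integral>x. sparse_eval y x / sparse_eval g x \<partial>arcsine) \<le> sparse_mean y" for y
  proof -
    obtain c where c: "0 < c" "\<And>x. x \<in> {0..1} \<Longrightarrow> c \<le> sparse_eval g x"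
    proof -
      have "continuous_on {0..1} (sparse_eval g)" by (intro continuous_intros)
      then obtain x0 where "x0 \<in> {0..1}" "\<And>x. x \<in> {0..1} \<Longrightarrow> sparse_eval g x0 \<le> sparse_eval g x"
        using continuous_attains_inf[of "{0..1::real}" "sparse_eval g"] by auto
      then show ?thesis using that g_pos by blast
    qed
    obtain B where B: "0 < B" "\<And>x. x \<in> {0..1} \<Longrightarrow> \<bar>sparse_eval y x\<bar> \<le> B"
      using bounded_on_unit_interval[OF continuous_on_sparse_eval] by (metis less_le_trans zero_less_one)
    \<comment> \<open>At this size the perturbation \<open>t * y\<close> consumes at most half of
      the lower bound \<open>c\<close> of \<open>g\<close>.\<close>
    define t where "t = c / (2 * B)"
    have t: "t > 0" using c B by (simp add: t_def)
    define w where "w = (\<lambda>i. 1 * g i + t * y i)"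
    have w: "sparse_eval w x = sparse_eval g x + t * sparse_eval y x" for x
      unfolding w_def sparse_eval_linear by simp
    have wm: "sparse_mean w = 1 + t * sparse_mean y"
      unfolding w_def sparse_mean_linear using g1 by simp
    have wpos: "0 < sparse_eval w x" if "x \<in> {0..1}" for x
    proof -
      have "\<bar>t * sparse_eval y x\<bar> \<le> t * B" using B(2)[OF that] t by (simp add: abs_mult)
      also have "t * B = c / 2" using B by (simp add: t_def)
      finally show ?thesis using c(1) c(2)[OF that] unfolding w by linarith
    qed
    have "\<exists>i\<in>I. w i \<noteq> 0"
    proof (rule ccontr)
      assume "\<not> ?thesis"
      then have "sparse_eval w 0 = 0" by (simp add: sparse_eval_def)
      then show False using wpos[of 0] by simp
    qed
    then have wm0: "0 < sparse_mean w" using wpos sparse_mean_pos[of w] by (meson less_imp_le)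
    define v where "v = (\<lambda>i. (1 / sparse_mean w) * w i + 0 * w i)"
    have v: "sparse_eval v x = sparse_eval w x / sparse_mean w" "sparse_mean v = 1" for x
      using wm0 unfolding v_def sparse_eval_linear sparse_mean_linear by simp_all
    have "v \<in> feasible" using v wpos wm0 by (auto simp: feasible_def less_imp_le)
    then have "(\<integral>x. sparse_eval v x / sparse_eval g x \<partial>arcsine) \<le> 1" by (rule le1)
    moreover have "(\<integral>x. sparse_eval v x / sparse_eval g x \<partial>arcsine) =
        (\<integral>x. (1 + t * (sparse_eval y x / sparse_eval g x)) / sparse_mean w \<partial>arcsine)"
    proof (rule integral_cong_AE)
      show "AE x in arcsine. sparse_eval v x / sparse_eval g x =
          (1 + t * (sparse_eval y x / sparse_eval g x)) / sparse_mean w"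
        using AE_arcsine
      proof eventually_elim
        case (elim x)
        then show ?case using g_pos[of x] unfolding v w by (simp add: field_simps)
      qed
    qed measurable
    moreover have "\<dots> = (1 + t * (\<integral>x. sparse_eval y x / sparse_eval g x \<partial>arcsine)) / sparse_mean w"
    proof -
      have "(\<integral>x. (1 + t * u x) / c \<partial>arcsine) = (1 + t * (\<integral>x. u x \<partial>arcsine)) / c"
        if "integrable arcsine u" for u and c :: real
        using that arcsine.prob_space by simp
      then show ?thesis using ig[of y] .
    qed
    ultimately have "1 + t * (\<integral>x. sparse_eval y x / sparse_eval g x \<partial>arcsine) \<le> sparse_mean w"
      using wm0 by simp
    then show ?thesis unfolding wm using t by simp
  qed
  have eq: "(\<integral>x. sparse_eval y x / sparse_eval g x \<partial>arcsine) = sparse_mean y" for y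
  proof (rule antisym[OF key])
    have "sparse_eval (\<lambda>i. - y i) x = - sparse_eval y x" for x
      by (simp add: sparse_eval_def sum_negf)
    moreover have "sparse_mean (\<lambda>i. - y i) = - sparse_mean y"
      by (simp add: sparse_mean_def sum_negf)
    ultimately show "sparse_mean y \<le> (\<integral>x. sparse_eval y x / sparse_eval g x \<partial>arcsine)"
      using key[of "\<lambda>i. - y i"] by simp
  qed
  show ?thesis
  proof (rule that[of "sparse_poly g"])
    fix i assume i: "i \<in> I"
    have "sparse_eval (\<lambda>j. if j = i then 1 else 0) x = x ^ i" for x
      using fin i by (simp add: sparse_eval_def if_distrib[of "\<lambda>x. x * _"] cong: if_cong)
    moreover have "sparse_mean (\<lambda>j. if j = i then 1 else 0) = m i"
      using fin i by (simp add: sparse_mean_def if_distrib[of "\<lambda>x. x * _"] cong: if_cong)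
    ultimately show "(\<integral>x. x ^ i / poly (sparse_poly g) x \<partial>arcsine) = m i"
      using eq[of "\<lambda>j. if j = i then 1 else 0"] by (simp add: poly_sparse_poly)
  qed (use g_pos in \<open>auto simp: coeff_sparse_poly poly_sparse_poly\<close>)
qed

end

end

section \<open>Minimizing the Kullback--Leibler divergence\<close>

definition tilted_arcsine :: "real poly \<Rightarrow> real measure" where
  "tilted_arcsine q = density arcsine (\<lambda>x. ennreal (1 / poly q x))"

lemma tilted_arcsine_eq_density:
  assumes "\<And>x. x \<in> {0..1} \<Longrightarrow> 0 < poly q x"
  shows "tilted_arcsine q = density lborel
    (\<lambda>x. ennreal (indicat_real {0..1} x / (poly (smult pi q) x * sqrt (x * (1 - x)))))"
  unfolding tilted_arcsine_def arcsine_def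
proof (subst density_density_eq)
  show "density lborel (\<lambda>x. ennreal (arcsine_density x) * ennreal (1 / poly q x)) =
    density lborel (\<lambda>x. ennreal (indicat_real {0..1} x / (poly (smult pi q) x * sqrt (x * (1 - x)))))"
  proof (rule density_cong)
    show "AE x in lborel. ennreal (arcsine_density x) * ennreal (1 / poly q x) =
      ennreal (indicat_real {0..1} x / (poly (smult pi q) x * sqrt (x * (1 - x))))"
    proof (rule AE_I2)
      fix x
      show "ennreal (arcsine_density x) * ennreal (1 / poly q x) =
        ennreal (indicat_real {0..1} x / (poly (smult pi q) x * sqrt (x * (1 - x))))"
      proof (cases "x \<in> {0..1}")
        case True
        then show ?thesis
          using assms[of x] by (subst ennreal_mult[symmetric]) (auto simp: mult_ac)
      qed simp
    qed
  qed measurable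
qed measurable

context
  fixes q :: "real poly"
  assumes q_pos: "\<And>x. x \<in> {0..1} \<Longrightarrow> 0 < poly q x"
    and q_mean: "(\<integral>x. 1 / poly q x \<partial>arcsine) = 1"
begin

lemma sets_tilted_arcsine [simp, measurable_cong]: "sets (tilted_arcsine q) = sets borel"
  by (simp add: tilted_arcsine_def)

lemma space_tilted_arcsine [simp]: "space (tilted_arcsine q) = UNIV"
  by (simp add: tilted_arcsine_def)

lemma AE_arcsine_q_pos: "AE x in arcsine. 0 < poly q x"
  using AE_arcsine by eventually_elim (rule q_pos)

lemma prob_space_tilted_arcsine: "prob_space (tilted_arcsine q)"
proof
  have "emeasure (tilted_arcsine q) (space (tilted_arcsine q)) = (\<integral>\<^sup>+x. ennreal (1 / poly q x) \<partial>arcsine)"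
    by (simp add: tilted_arcsine_def emeasure_density)
  also have "\<dots> = ennreal (\<integral>x. 1 / poly q x \<partial>arcsine)"
    using integrable_arcsine_poly_divide[OF q_pos, of 1] AE_arcsine_q_pos
    by (intro nn_integral_eq_integral) (auto elim!: eventually_mono)
  finally show "emeasure (tilted_arcsine q) (space (tilted_arcsine q)) = 1"
    by (simp add: q_mean)
qed

interpretation tilted: prob_space "tilted_arcsine q" by (rule prob_space_tilted_arcsine)

lemma
  assumes [measurable]: "f \<in> borel_measurable borel"
  shows integrable_tilted_arcsine:
      "integrable (tilted_arcsine q) f \<longleftrightarrow> integrable arcsine (\<lambda>x. f x / poly q x :: real)"
    and integral_tilted_arcsine: "(\<integral>x. f x \<partial>tilted_arcsine q) = (\<integral>x. f x / poly q x \<partial>arcsine)"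
proof -
  have *: "AE x in arcsine. 0 \<le> 1 / poly q x"
    using AE_arcsine_q_pos by eventually_elim simp
  show "integrable (tilted_arcsine q) f \<longleftrightarrow> integrable arcsine (\<lambda>x. f x / poly q x)"
    unfolding tilted_arcsine_def using * by (subst integrable_density) auto
  show "(\<integral>x. f x \<partial>tilted_arcsine q) = (\<integral>x. f x / poly q x \<partial>arcsine)"
    unfolding tilted_arcsine_def using * by (subst integral_density) auto
qed

lemma tilted_arcsine_moment_measure: "tilted_arcsine q \<in> moment_measures {0..1}"
proof -
  have "AE x in tilted_arcsine q. x \<in> {0..1}"
    unfolding tilted_arcsine_def
  proof (subst AE_density)
    show "AE x in arcsine. 0 < ennreal (1 / poly q x) \<longrightarrow> x \<in> {0..1}"
      using AE_arcsine by eventually_elim blast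
  qed measurable
  then have "emeasure (tilted_arcsine q) {0..1} = 1"
    by (intro tilted.emeasure_eq_1_AE) auto
  moreover have "integrable (tilted_arcsine q) (\<lambda>x. x ^ j)" for j
    using integrable_arcsine_poly_divide[OF q_pos, of "monom 1 j"]
    by (subst integrable_tilted_arcsine) (auto simp: poly_monom)
  ultimately show ?thesis
    using prob_space_tilted_arcsine by (simp add: moment_measures_def)
qed

lemma moment_tilted_arcsine: "moment j (tilted_arcsine q) = (\<integral>x. x ^ j / poly q x \<partial>arcsine)"
  unfolding moment_def by (rule integral_tilted_arcsine) measurable

lemma arcsine_eq_density_tilted: "density (tilted_arcsine q) (\<lambda>x. ennreal (poly q x)) = arcsine"
proof -
  have "density (tilted_arcsine q) (\<lambda>x. ennreal (poly q x)) =
      density arcsine (\<lambda>x. ennreal (1 / poly q x) * ennreal (poly q x))"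
    unfolding tilted_arcsine_def by (rule density_density_eq) measurable
  also have "\<dots> = density arcsine (\<lambda>x. 1)"
  proof (rule density_cong)
    show "AE x in arcsine. ennreal (1 / poly q x) * ennreal (poly q x) = 1"
      using AE_arcsine_q_pos by eventually_elim (simp add: ennreal_mult[symmetric])
  qed measurable
  finally show ?thesis by (simp add: density_1)
qed

lemma integrable_arcsine_ln: "integrable arcsine (\<lambda>x. ln (poly q x))"
  using q_pos by (intro integrable_arcsine_continuous continuous_intros) (auto simp: less_le)

lemma kullback_leibler_tilted_arcsine:
  "kullback_leibler arcsine (tilted_arcsine q) = ereal (\<integral>x. ln (poly q x) \<partial>arcsine)"
proof -
  let ?M = "tilted_arcsine q"
  have ac: "absolutely_continuous ?M arcsine"
    by (subst arcsine_eq_density_tilted[symmetric], rule absolutely_continuousI_density) measurable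
  have "AE x in ?M. ennreal (poly q x) = RN_deriv ?M arcsine x"
    by (rule tilted.RN_deriv_unique) (use arcsine_eq_density_tilted in auto)
  then have "AE x in arcsine. ennreal (poly q x) = RN_deriv ?M arcsine x"
    by (rule absolutely_continuous_AE[OF _ ac, rotated]) simp
  then have *: "AE x in arcsine. entropy_density (exp 1) ?M arcsine x = ln (poly q x)"
    using AE_arcsine_q_pos
  proof eventually_elim
    case (elim x)
    then show ?case by (simp add: entropy_density_def log_def flip: elim(1))
  qed
  have [measurable]: "entropy_density (exp 1) ?M arcsine \<in> borel_measurable borel"
    using borel_measurable_RN_deriv[of ?M arcsine] unfolding entropy_density_def comp_def
    by (simp cong: measurable_cong_sets)
  have "integrable arcsine (entropy_density (exp 1) ?M arcsine)"
    using * integrable_arcsine_ln by (subst integrable_cong_AE[where g = "\<lambda>x. ln (poly q x)"]) auto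
  then have "kullback_leibler arcsine ?M = ereal (KL_divergence (exp 1) ?M arcsine)"
    using ac by (intro kullback_leibler_eq_KL_divergence)
  also have "KL_divergence (exp 1) ?M arcsine = (\<integral>x. ln (poly q x) \<partial>arcsine)"
    unfolding KL_divergence_def by (intro integral_cong_AE *) auto
  finally show ?thesis .
qed

text \<open>Concluding equality from \<open>\<le>\<close> yields minimality and uniqueness at once.
  The slack \<open>D\<close> of the logarithm inequality at \<open>q / G\<close>, with
  \<open>G\<close> the density of the arcsine distribution with respect to \<open>\<nu>\<close>, is
  nonnegative but has integral at most 0, so \<open>q = G\<close> almost everywhere. A part of
  \<open>\<nu>\<close> singular to the arcsine distribution is excluded last, by comparing total
  masses.\<close>

lemma eq_tilted_arcsine_if_kullback_leibler_le:
  assumes "prob_space \<nu>" and sets [measurable_cong, simp]: "sets \<nu> = sets borel" and supp: "emeasure \<nu> {0..1} = 1"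
    and int: "integrable \<nu> (poly q)" and mean: "(\<integral>x. poly q x \<partial>\<nu>) = 1"
    and le: "kullback_leibler arcsine \<nu> \<le> kullback_leibler arcsine (tilted_arcsine q)"
  shows "\<nu> = tilted_arcsine q"
proof -
  interpret \<nu>: prob_space \<nu> by fact
  have space [simp]: "space \<nu> = UNIV" using sets_eq_imp_space_eq[OF sets] by simp
  have AE01: "AE x in \<nu>. x \<in> {0..1}" 
    using supp \<nu>.prob_eq_1[of "{0..1}"] by (simp add: \<nu>.emeasure_eq_measure del: atLeastAtMost_iff)
  define h where "h = entropy_density (exp 1) \<nu> arcsine"
  have ac: "absolutely_continuous \<nu> arcsine"
    using le unfolding kullback_leibler_tilted_arcsine
    by (rule contrapos_pp) (simp add: kullback_leibler_def)
  define g where "g = RN_deriv \<nu> arcsine"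
  define G where "G x = enn2real (g x)" for x
  have [measurable]: "g \<in> borel_measurable borel"
    using borel_measurable_RN_deriv[of \<nu> arcsine] by (simp add: g_def cong: measurable_cong_sets)
  have [measurable]: "G \<in> borel_measurable borel" unfolding G_def by measurable
  have dens: "density \<nu> g = arcsine"
    unfolding g_def by (rule \<nu>.density_RN_deriv[OF ac]) simp
  have fin: "AE x in \<nu>. g x \<noteq> \<infinity>"
    unfolding g_def by (rule \<nu>.RN_deriv_finite[OF _ ac]) (simp_all add: arcsine.sigma_finite_measure_axioms)
  have gG: "AE x in arcsine. 0 < G x \<and> g x = ennreal (G x)"
    unfolding dens[symmetric] using fin
    by (subst AE_density) (auto elim!: eventually_mono simp: G_def enn2real_positive_iff less_top)
  have h: "h x = ln (G x)" for x
    by (simp add: h_def entropy_density_def log_def G_def g_def)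
  \<comment> \<open>Only an inequality: where \<open>G\<close> vanishes the quotient is
    \<open>_ / 0 = 0\<close>, while \<open>\<nu>\<close> may have mass there.\<close>
  have transfer: "(\<integral>\<^sup>+x. ennreal (c x / G x) \<partial>arcsine) \<le> (\<integral>\<^sup>+x. ennreal (c x) \<partial>\<nu>)"
    if [measurable]: "c \<in> borel_measurable borel" and c: "AE x in \<nu>. 0 \<le> c x" for c
  proof -
    have "(\<integral>\<^sup>+x. ennreal (c x / G x) \<partial>arcsine) = (\<integral>\<^sup>+x. g x * ennreal (c x / G x) \<partial>\<nu>)"
      by (subst dens[symmetric], subst nn_integral_density) auto
    also have "\<dots> \<le> (\<integral>\<^sup>+x. ennreal (c x) \<partial>\<nu>)"
    proof (rule nn_integral_mono_AE)
      show "AE x in \<nu>. g x * ennreal (c x / G x) \<le> ennreal (c x)"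
        using fin c
      proof eventually_elim
        case (elim x)
        then have "g x = ennreal (G x)" by (simp add: G_def less_top)
        moreover have "0 \<le> G x" by (simp add: G_def)
        ultimately show ?case
          using elim(2) by (cases "G x = 0") (simp_all add: ennreal_mult[symmetric])
      qed
    qed
    finally show ?thesis .
  qed
  \<comment> \<open>A finite negative part makes the difference of extended reals in the divergence
    well defined; since the divergence is bounded by a real number, the positive part is finite as
    well and \<open>h\<close> is integrable.\<close>
  have neg: "(\<integral>\<^sup>+x. ennreal (- h x) \<partial>arcsine) \<noteq> \<infinity>"
  proof -
    have "(\<integral>\<^sup>+x. ennreal (- h x) \<partial>arcsine) \<le> (\<integral>\<^sup>+x. ennreal (1 / G x) \<partial>arcsine)"
    proof (rule nn_integral_mono_AE)
      show "AE x in arcsine. ennreal (- h x) \<le> ennreal (1 / G x)"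
        using gG
      proof eventually_elim
        case (elim x)
        then have "- h x = ln (1 / G x)" by (simp add: h ln_div)
        also have "\<dots> \<le> 1 / G x" using ln_le_minus_one[of "1 / G x"] elim by simp
        finally show ?case by (rule ennreal_leI)
      qed
    qed
    also have "\<dots> \<le> (\<integral>\<^sup>+x. ennreal 1 \<partial>\<nu>)" by (rule transfer) auto
    also have "\<dots> = 1" using \<nu>.emeasure_space_1 by simp
    finally show ?thesis by (auto simp: top_unique)
  qed
  have [measurable]: "h \<in> borel_measurable borel" unfolding h by measurable
  have "(\<integral>\<^sup>+x. ennreal (h x) \<partial>arcsine) \<noteq> \<infinity>"
  proof
    assume "(\<integral>\<^sup>+x. ennreal (h x) \<partial>arcsine) = \<infinity>"
    then have "kullback_leibler arcsine \<nu> = \<infinity>"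
      using neg ac unfolding kullback_leibler_def h_def[symmetric]
      by (cases "\<integral>\<^sup>+x. ennreal (- h x) \<partial>arcsine") (auto simp: enn2ereal_ennreal)
    then show False using le by (simp add: kullback_leibler_tilted_arcsine)
  qed
  then have ih: "integrable arcsine h" using neg by (simp add: real_integrable_def)
  then have "kullback_leibler arcsine \<nu> = ereal (KL_divergence (exp 1) \<nu> arcsine)"
    using ac unfolding h_def by (intro kullback_leibler_eq_KL_divergence)
  then have hle: "(\<integral>x. h x \<partial>arcsine) \<le> (\<integral>x. ln (poly q x) \<partial>arcsine)"
    using le unfolding kullback_leibler_tilted_arcsine by (simp add: KL_divergence_def h_def)
  have qG: "(\<integral>\<^sup>+x. ennreal (poly q x / G x) \<partial>arcsine) \<le> 1"
  proof -
    have q0: "AE x in \<nu>. 0 \<le> poly q x" using AE01 by eventually_elim (use q_pos in \<open>auto simp: less_imp_le\<close>)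
    then have "(\<integral>\<^sup>+x. ennreal (poly q x / G x) \<partial>arcsine) \<le> (\<integral>\<^sup>+x. ennreal (poly q x) \<partial>\<nu>)"
      by (intro transfer) auto
    also have "\<dots> = 1" using nn_integral_eq_integral[OF int q0] mean by simp
    finally show ?thesis .
  qed
  have qG0: "AE x in arcsine. 0 \<le> poly q x / G x"
    using gG AE_arcsine_q_pos by eventually_elim simp
  have iqG: "integrable arcsine (\<lambda>x. poly q x / G x)"
    using qG qG0 by (intro integrableI_nonneg) (auto simp: le_less_trans)
  have qG1: "(\<integral>x. poly q x / G x \<partial>arcsine) \<le> 1"
    using qG nn_integral_eq_integral[OF iqG qG0] by simp
  define D where "D x = (poly q x / G x - 1) - (ln (poly q x) - h x)" for x
  have iD: "integrable arcsine D" unfolding D_def using iqG ih integrable_arcsine_ln by simp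
  have D0: "AE x in arcsine. 0 \<le> D x"
    using gG AE_arcsine_q_pos
  proof eventually_elim
    case (elim x)
    then show ?case using ln_le_minus_one[of "poly q x / G x"] by (simp add: D_def h ln_div)
  qed
  have "(\<integral>x. D x \<partial>arcsine) = ((\<integral>x. poly q x / G x \<partial>arcsine) - 1) - ((\<integral>x. ln (poly q x) \<partial>arcsine) - (\<integral>x. h x \<partial>arcsine))"
    unfolding D_def using iqG ih integrable_arcsine_ln arcsine.prob_space by simp
  then have "(\<integral>x. D x \<partial>arcsine) \<le> 0" using qG1 hle by simp
  then have "AE x in arcsine. D x = 0"
    using integral_nonneg_eq_0_iff_AE[OF iD D0] integral_nonneg_AE[OF D0] by simp
  then have eq: "AE x in arcsine. poly q x = G x"
    using gG AE_arcsine_q_pos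
  proof eventually_elim
    case (elim x)
    then have "ln (poly q x / G x) = poly q x / G x - 1" by (simp add: D_def h ln_div)
    then have "poly q x / G x = 1" using elim by (intro ln_eq_minus_one) auto
    then show ?case using elim by simp
  qed
  \<comment> \<open>One probability measure lies below another on every set; applied to a set and
    its complement, this forces equality.\<close>
  have leA: "emeasure (tilted_arcsine q) A \<le> emeasure \<nu> A" if [measurable]: "A \<in> sets borel" for A
  proof -
    have "emeasure (tilted_arcsine q) A = (\<integral>\<^sup>+x. ennreal (1 / poly q x) * indicator A x \<partial>arcsine)"
      unfolding tilted_arcsine_def by (subst emeasure_density) auto
    also have "\<dots> = (\<integral>\<^sup>+x. ennreal (indicat_real A x / G x) \<partial>arcsine)"
      by (rule nn_integral_cong_AE) (use eq in \<open>eventually_elim, auto simp: indicator_def\<close>)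
    also have "\<dots> \<le> (\<integral>\<^sup>+x. ennreal (indicat_real A x) \<partial>\<nu>)" by (rule transfer) auto
    also have "\<dots> = emeasure \<nu> A" by (simp add: ennreal_indicator)
    finally show ?thesis .
  qed
  show "\<nu> = tilted_arcsine q"
  proof (rule measure_eqI)
    fix A assume "A \<in> sets \<nu>"
    then have A: "A \<in> sets borel" by simp
    have "tilted.prob A \<le> \<nu>.prob A" "tilted.prob (- A) \<le> \<nu>.prob (- A)"
      using leA[of A] leA[of "- A"] A by (simp_all add: tilted.emeasure_eq_measure \<nu>.emeasure_eq_measure)
    moreover have "tilted.prob (- A) = 1 - tilted.prob A" "\<nu>.prob (- A) = 1 - \<nu>.prob A"
      using A tilted.prob_compl[of A] \<nu>.prob_compl[of A] by (simp_all add: Compl_eq_Diff_UNIV)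
    ultimately show "emeasure \<nu> A = emeasure (tilted_arcsine q) A"
      by (simp add: tilted.emeasure_eq_measure \<nu>.emeasure_eq_measure)
  qed simp
qed

end

section \<open>Moment spaces and the volumes of their fibres\<close>

definition representable :: "nat \<Rightarrow> (nat \<Rightarrow> real) \<Rightarrow> bool" where
  "representable n m \<longleftrightarrow> (\<exists>\<mu>\<in>moment_measures {0..1}. \<forall>i\<le>n. m i = moment i \<mu>)"

section \<open>The truncated moment problem on the unit interval\<close>

lemma moment_measures_AE:
  assumes "\<mu> \<in> moment_measures {0..1}"
  shows "AE x in \<mu>. x \<in> {0..1}"
proof -
  interpret prob_space \<mu> using assms by (simp add: moment_measures_def)
  show ?thesis
    using assms prob_eq_1[of "{0..1}"]
    by (simp add: moment_measures_def emeasure_eq_measure del: atLeastAtMost_iff)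
qed

lemma moment_0:
  assumes "\<mu> \<in> moment_measures E"
  shows "moment 0 \<mu> = 1"
proof -
  interpret prob_space \<mu> using assms by (simp add: moment_measures_def)
  show ?thesis by (simp add: moment_def prob_space)
qed

lemma moment_functional_moment:
  assumes "\<mu> \<in> moment_measures E" "\<And>i. i \<le> n \<Longrightarrow> m i = moment i \<mu>" "degree P \<le> n"
  shows "moment_functional m P = (\<integral>x. poly P x \<partial>\<mu>)"
  using assms moment_functional_integral[of n \<mu> "\<lambda>_. 1" m P]
  by (simp add: moment_measures_def moment_def)

lemma integrable_poly_moment_measure:
  assumes "\<mu> \<in> moment_measures E"
  shows "integrable \<mu> (poly P)"
  unfolding poly_altdef using assms
  by (intro Bochner_Integration.integrable_sum integrable_mult_right) (simp add: moment_measures_def)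

lemma representable_nonneg:
  assumes "representable n m" "degree P \<le> n" "\<And>x. x \<in> {0..1} \<Longrightarrow> 0 \<le> poly P x"
  shows "0 \<le> moment_functional m P"
proof -
  obtain \<mu> where \<mu>: "\<mu> \<in> moment_measures {0..1}" "\<forall>i\<le>n. m i = moment i \<mu>"
    using assms(1) by (auto simp: representable_def)
  have "moment_functional m P = (\<integral>x. poly P x \<partial>\<mu>)"
    using \<mu> assms(2) by (intro moment_functional_moment) auto
  also have "\<dots> \<ge> 0"
  proof (rule integral_nonneg_AE)
    show "AE x in \<mu>. 0 \<le> poly P x"
      using moment_measures_AE[OF \<mu>(1)] by eventually_elim (rule assms(3))
  qed
  finally show ?thesis .
qed

lemma representable_0: "representable n m \<Longrightarrow> m 0 = 1"
  using moment_0 by (auto simp: representable_def)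

lemma representable_mono: "representable n m \<Longrightarrow> k \<le> n \<Longrightarrow> representable k m"
  unfolding representable_def by (meson order_trans)

lemma representable_cong:
  "representable n m \<Longrightarrow> (\<And>i. i \<le> n \<Longrightarrow> m i = m' i) \<Longrightarrow> representable n m'"
  unfolding representable_def by metis

lemma representable_bounds:
  assumes "representable n m" "i \<le> n"
  shows "0 \<le> m i" "m i \<le> 1"
proof -
  have "0 \<le> moment_functional m (monom 1 i)"
    using assms by (intro representable_nonneg) (auto simp: degree_monom_eq poly_monom)
  then show "0 \<le> m i" by (simp add: moment_functional_monom)
  have "0 \<le> moment_functional m (1 - monom 1 i)"
    using assms by (intro representable_nonneg degree_diff_le)
      (auto simp: degree_monom_eq poly_monom power_le_one)
  then show "m i \<le> 1"
    using representable_0[OF assms(1)] by (simp add: moment_functional_monom moment_functional_diff)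
qed

lemma exists_full_density_poly:
  assumes "strictly_positive l m" "m 0 = 1"
  obtains q where "degree q \<le> l" "\<And>x. x \<in> {0..1} \<Longrightarrow> 0 < poly q x"
    "\<And>i. i \<le> l \<Longrightarrow> m i = (\<integral>x. x ^ i / poly q x \<partial>arcsine)"
proof -
  obtain q where q: "\<And>i. i \<notin> {..l} \<Longrightarrow> coeff q i = 0" "\<And>x. x \<in> {0..1} \<Longrightarrow> 0 < poly q x"
    "\<And>i. i \<in> {..l} \<Longrightarrow> (\<integral>x. x ^ i / poly q x \<partial>arcsine) = m i"
  proof (rule exists_density_poly[of "{..l}" m])
    fix P :: "real poly"
    assume P: "\<And>i. i \<notin> {..l} \<Longrightarrow> coeff P i = 0" "P \<noteq> 0" "\<And>x. x \<in> {0..1} \<Longrightarrow> 0 \<le> poly P x"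
    then have "degree P \<le> l" by (intro degree_le) auto
    then show "0 < moment_functional m P" using P assms(1) by (auto simp: strictly_positive_def)
  qed (use assms(2) in auto)
  then show ?thesis by (intro that[of q] degree_le) auto
qed

text \<open>The density construction with all powers up to \<open>n\<close> allowed solves the
  moment problem for such sequences, by a measure with a density of the form \<open>1 / q\<close>
  against the arcsine distribution.\<close>

lemma representable_if_strictly_positive:
  assumes "strictly_positive n m" "m 0 = 1"
  shows "representable n m"
proof -
  obtain q where q: "\<And>x. x \<in> {0..1} \<Longrightarrow> 0 < poly q x"
    "\<And>i. i \<le> n \<Longrightarrow> m i = (\<integral>x. x ^ i / poly q x \<partial>arcsine)"
    by (rule exists_full_density_poly[OF assms]) blast
  have q1: "(\<integral>x. 1 / poly q x \<partial>arcsine) = 1" using q(2)[of 0] assms(2) by simp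
  have "m i = moment i (tilted_arcsine q)" if "i \<le> n" for i
    using moment_tilted_arcsine[OF q(1) q1, of i] q(2)[of i] that by simp
  then show ?thesis
    unfolding representable_def using tilted_arcsine_moment_measure[OF q(1) q1] by blast
qed

text \<open>Measures on the unit interval are tight, so a subsequence converges weakly; the limit
  stays on \<open>{0..1}\<close> and inherits the moments.\<close>

lemma representable_limit:
  assumes rep: "\<And>k. representable n (M k)" and lim: "\<And>i. i \<le> n \<Longrightarrow> (\<lambda>k. M k i) \<longlonglongrightarrow> m i"
  shows "representable n m"
proof -
  obtain \<mu> where \<mu>: "\<And>k. \<mu> k \<in> moment_measures {0..1}" "\<And>k i. i \<le> n \<Longrightarrow> M k i = moment i (\<mu> k)"
    using rep unfolding representable_def by metis
  have rd: "real_distribution (\<mu> k)" for k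
    using \<mu>(1)[of k] by (simp add: moment_measures_def real_distribution_def real_distribution_axioms_def)
  \<comment> \<open>Tightness is formulated with half-open intervals, so the left end is moved to -1
    in order to include the point 0.\<close>
  have full: "measure (\<mu> k) {-1<..1} = 1" for k
  proof -
    interpret real_distribution "\<mu> k" by (rule rd)
    show ?thesis
      using moment_measures_AE[OF \<mu>(1)[of k]]
      by (subst prob_eq_1) (auto elim!: eventually_mono)
  qed
  have "tight \<mu>"
    unfolding tight_def
  proof (intro conjI allI impI)
    fix e :: real assume "e > 0"
    then have "(-1::real) < 1 \<and> (\<forall>k. 1 - e < measure (\<mu> k) {-1<..1})"
      using full by simp
    then show "\<exists>a b. a < b \<and> (\<forall>k. 1 - e < measure (\<mu> k) {a<..b})" by blast
  qed (rule rd)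
  then obtain r N where r: "strict_mono r" and N: "real_distribution N" and "weak_conv_m (\<mu> \<circ> id \<circ> r) N"
    using tight_imp_convergent_subsubsequence[of \<mu> id] by (auto simp: strict_mono_def)
  then have wc: "weak_conv_m (\<lambda>k. \<mu> (r k)) N" by (simp add: o_def)
  interpret N: real_distribution N by (rule N)
  have conv: "(\<lambda>k. \<integral>x. f x \<partial>\<mu> (r k)) \<longlonglongrightarrow> (\<integral>x. f x \<partial>N)"
    if "\<And>x. isCont f x" "\<And>x. \<bar>f x\<bar> \<le> B" for f :: "real \<Rightarrow> real" and B
    using weak_conv_imp_integral_bdd_continuous_conv[OF rd N wc, of f B] that by simp
  \<comment> \<open>The distance to \<open>{0..1}\<close>, truncated to be bounded; its integrals
    vanish along the sequence, hence also for the limit.\<close>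
  let ?d = "\<lambda>x::real. min 1 (max 0 (max (- x) (x - 1)))"
  have "(\<lambda>k. \<integral>x. ?d x \<partial>\<mu> (r k)) \<longlonglongrightarrow> (\<integral>x. ?d x \<partial>N)"
    by (rule conv[of _ 1]) (auto intro!: continuous_intros)
  moreover have "(\<integral>x. ?d x \<partial>\<mu> (r k)) = 0" for k
    by (rule integral_eq_zero_AE) (use moment_measures_AE[OF \<mu>(1)[of "r k"]] in \<open>eventually_elim, auto\<close>)
  ultimately have "(\<integral>x. ?d x \<partial>N) = 0" by (simp add: LIMSEQ_const_iff)
  moreover have "integrable N ?d" by (rule N.integrable_const_bound[of _ 1]) auto
  ultimately have "AE x in N. ?d x = 0" by (subst (asm) integral_nonneg_eq_0_iff_AE) auto
  then have N01: "AE x in N. x \<in> {0..1}" by eventually_elim (auto simp: min_def max_def split: if_splits)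
  have int: "integrable N (\<lambda>x. x ^ j)" for j
  proof (rule N.integrable_const_bound[of _ 1])
    show "AE x in N. norm (x ^ j) \<le> 1"
      using N01 by eventually_elim (auto simp: power_le_one power_abs)
  qed simp
  have Nm: "N \<in> moment_measures {0..1}"
    using int N01 N.prob_eq_1[of "{0..1}"] N.prob_space_axioms
    by (simp add: moment_measures_def N.emeasure_eq_measure del: atLeastAtMost_iff)
  have "m i = moment i N" if i: "i \<le> n" for i
  proof (rule LIMSEQ_unique)
    show "(\<lambda>k. M (r k) i) \<longlonglongrightarrow> m i"
      using LIMSEQ_subseq_LIMSEQ[OF lim[OF i] r] by (simp add: o_def)
    \<comment> \<open>Weak convergence tests bounded continuous functions, so the power is replaced
      by one that is clamped outside \<open>{0..1}\<close>.\<close>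
    let ?c = "\<lambda>x::real. (max 0 (min 1 x)) ^ i"
    have c: "(\<integral>x. ?c x \<partial>L) = moment i L" if L: "AE x in L. x \<in> {0..1}" "sets L = sets borel" for L
      unfolding moment_def
    proof (rule integral_cong_AE)
      show "AE x in L. ?c x = x ^ i" using L(1) by eventually_elim auto
    qed (simp_all add: measurable_cong_sets[OF L(2) refl])
    have "(\<lambda>k. \<integral>x. ?c x \<partial>\<mu> (r k)) \<longlonglongrightarrow> (\<integral>x. ?c x \<partial>N)"
      by (rule conv[of _ 1]) (auto intro!: continuous_intros simp: power_le_one)
    moreover have "sets (\<mu> k) = sets borel" for k using \<mu>(1)[of k] by (simp add: moment_measures_def)
    ultimately show "(\<lambda>k. M (r k) i) \<longlonglongrightarrow> moment i N"
      using c[OF moment_measures_AE[OF \<mu>(1)]] c[OF N01] \<mu>(2)[OF i] by simp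
  qed
  then show ?thesis using Nm by (auto simp: representable_def)
qed

lemma strictly_positive_arcsine:
  assumes "\<And>x. x \<in> {0..1} \<Longrightarrow> 0 < poly q x" "\<And>i. i \<le> n \<Longrightarrow> m i = (\<integral>x. x ^ i / poly q x \<partial>arcsine)"
  shows "strictly_positive n m"
  unfolding strictly_positive_def
proof (intro allI impI)
  fix P :: "real poly"
  assume P: "P \<noteq> 0" "degree P \<le> n" "\<forall>x\<in>{0..1}. 0 \<le> poly P x"
  let ?f = "\<lambda>x. poly P x / poly q x"
  have i: "integrable arcsine ?f" by (rule integrable_arcsine_poly_divide[OF assms(1)])
  have nn: "AE x in arcsine. 0 \<le> ?f x"
    using AE_arcsine by eventually_elim (use P(3) assms(1) in \<open>auto simp: less_imp_le\<close>)
  have "(\<integral>x. ?f x \<partial>arcsine) \<noteq> 0"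
  proof
    assume "(\<integral>x. ?f x \<partial>arcsine) = 0"
    then have "AE x in arcsine. ?f x = 0" using integral_nonneg_eq_0_iff_AE[OF i nn] by simp
    then have "?f x = 0" if "x \<in> {0..1}" for x
      using that assms(1) by (intro arcsine_continuous_eq_0[of ?f])
        (auto intro!: continuous_intros simp: less_le)
    then have "{0..1} \<subseteq> {x. poly P x = 0}" using assms(1) by force
    then show False
      using poly_roots_finite[OF P(1)] by (metis finite_subset infinite_Icc zero_less_one)
  qed
  then have "0 < (\<integral>x. ?f x \<partial>arcsine)" using integral_nonneg_AE[OF nn] by simp
  then show "0 < moment_functional m P"
    using moment_functional_arcsine[of q n m P] assms P(2) by simp
qed

text \<open>Mixing a nonnegative functional with the arcsine moments makes it strictly positive and
  thus representable; then the weight of the mixture tends to 0.\<close>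

lemma representable_iff:
  "representable n m \<longleftrightarrow> m 0 = 1 \<and>
     (\<forall>P. degree P \<le> n \<longrightarrow> (\<forall>x\<in>{0..1}. 0 \<le> poly P x) \<longrightarrow> 0 \<le> moment_functional m P)"
proof (intro iffI conjI)
  assume R: "m 0 = 1 \<and> (\<forall>P. degree P \<le> n \<longrightarrow> (\<forall>x\<in>{0..1}. 0 \<le> poly P x) \<longrightarrow> 0 \<le> moment_functional m P)"
  define a where "a i = (\<integral>x. x ^ i / poly 1 x \<partial>arcsine)" for i :: nat
  have a: "strictly_positive n a" by (rule strictly_positive_arcsine[of 1]) (simp_all add: a_def)
  have a0: "a 0 = 1" using arcsine.prob_space by (simp add: a_def)
  define t where "t k = inverse (real (Suc k))" for k
  have t: "0 < t k" "t k \<le> 1" for k by (auto simp: t_def field_simps)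
  define M where "M k = (\<lambda>i. (1 - t k) * m i + t k * a i)" for k
  show "representable n m"
  proof (rule representable_limit)
    fix k
    show "representable n (M k)"
    proof (rule representable_if_strictly_positive)
      show "strictly_positive n (M k)"
        unfolding strictly_positive_def M_def moment_functional_affine
        using R a t[of k] by (auto simp: strictly_positive_def intro!: add_nonneg_pos)
    qed (use R a0 in \<open>simp add: M_def\<close>)
  next
    fix i
    have "(\<lambda>k. (1 - t k) * m i + t k * a i) \<longlonglongrightarrow> (1 - 0) * m i + 0 * a i"
      unfolding t_def by (intro tendsto_intros LIMSEQ_inverse_real_of_nat)
    then show "(\<lambda>k. M k i) \<longlonglongrightarrow> m i" by (simp add: M_def)
  qed
qed (use representable_0 representable_nonneg in blast)+

lemma representable_convex:
  assumes "representable n m" "representable n m'" "0 \<le> e" "e \<le> 1"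
  shows "representable n (\<lambda>i. (1 - e) * m i + e * m' i)"
  using assms unfolding representable_iff moment_functional_affine by auto

lemma strictly_positive_convex:
  assumes "strictly_positive n m" "representable n m'" "0 \<le> e" "e < 1"
  shows "strictly_positive n (\<lambda>i. (1 - e) * m i + e * m' i)"
  using assms unfolding representable_iff strictly_positive_def moment_functional_affine
  by (auto intro!: add_pos_nonneg)

section \<open>Fibres of the moment space as iterated integrals\<close>

abbreviation sequence_space :: "(nat \<Rightarrow> real) measure" where
  "sequence_space \<equiv> \<Pi>\<^sub>M _\<in>UNIV. borel"

text \<open>Duality writes the set as an intersection of closed half-spaces with a closed
  hyperplane. The family is uncountable, so measurability is obtained from closedness.\<close>

lemma sets_representable: "{m. representable n m} \<in> sets sequence_space"
proof -
  have cont: "continuous_on UNIV (\<lambda>m. moment_functional m P)" for P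
    unfolding moment_functional_def by (intro continuous_intros continuous_on_product_coordinates)
  have "{m. representable n m} = {m. m 0 = 1} \<inter>
      (\<Inter>P\<in>{P. degree P \<le> n \<and> (\<forall>x\<in>{0..1}. 0 \<le> poly P x)}. {m. 0 \<le> moment_functional m P})"
    unfolding representable_iff by auto
  moreover have "closed {m :: nat \<Rightarrow> real. m 0 = 1}"
    by (intro closed_Collect_eq continuous_intros continuous_on_product_coordinates)
  ultimately have "closed {m. representable n m}"
    by (auto intro!: closed_INT closed_Int closed_Collect_le cont continuous_intros)
  then show ?thesis by (simp add: sets_PiM_equal_borel)
qed

text \<open>
  The volume of the fibre of the moment space of order \<open>l + k\<close> over the first \<open>l\<close> moments.
\<close>

primrec tail_volume :: "nat \<Rightarrow> nat \<Rightarrow> (nat \<Rightarrow> real) \<Rightarrow> ennreal" where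
  "tail_volume 0 l m = indicator {m. representable l m} m"
| "tail_volume (Suc k) l m = (\<integral>\<^sup>+t. tail_volume k (Suc l) (m(Suc l := t)) \<partial>lborel)"

lemma measurable_upd [measurable]:
  "(\<lambda>(m, t). m(i := t)) \<in> sequence_space \<Otimes>\<^sub>M lborel \<rightarrow>\<^sub>M sequence_space"
  unfolding split_beta by (rule measurable_fun_upd[where J = UNIV]) auto

lemma measurable_tail_volume [measurable]: "tail_volume k l \<in> borel_measurable sequence_space"
proof (induction k arbitrary: l)
  case 0
  show ?case using sets_representable[of l] by (simp add: fun_eq_iff[symmetric])
next
  case (Suc k)
  have "(\<lambda>p. tail_volume k (Suc l) ((\<lambda>(m, t). m(Suc l := t)) p)) \<in> borel_measurable (sequence_space \<Otimes>\<^sub>M lborel)"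
    by (rule measurable_compose[OF measurable_upd Suc])
  then have "(\<lambda>m. \<integral>\<^sup>+t. tail_volume k (Suc l) (m(Suc l := t)) \<partial>lborel) \<in> borel_measurable sequence_space"
    by (intro lborel.borel_measurable_nn_integral) (simp add: split_beta)
  then show ?case by (simp cong: measurable_cong)
qed

lemma measurable_tail_volume_upd [measurable]:
  "(\<lambda>t. tail_volume k l (m(i := t))) \<in> borel_measurable borel"
proof -
  have "(\<lambda>t. m(i := t)) \<in> borel \<rightarrow>\<^sub>M sequence_space"
    by (rule measurable_fun_upd[where J = UNIV]) (auto simp: space_PiM)
  then show ?thesis by (rule measurable_compose[OF _ measurable_tail_volume])
qed

lemma tail_volume_cong:
  "(\<And>i. i \<le> l \<Longrightarrow> m i = m' i) \<Longrightarrow> tail_volume k l m = tail_volume k l m'"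
proof (induction k arbitrary: l m m')
  case 0
  then show ?case using representable_cong[of l m m'] representable_cong[of l m' m]
    by (auto simp: indicator_def)
next
  case (Suc k)
  have "tail_volume k (Suc l) (m(Suc l := t)) = tail_volume k (Suc l) (m'(Suc l := t))" for t
    using Suc.prems by (intro Suc.IH) (auto simp: le_Suc_eq)
  then show ?case by simp
qed

lemma tail_volume_eq_0: "\<not> representable l m \<Longrightarrow> tail_volume k l m = 0"
proof (induction k arbitrary: l m)
  case (Suc k)
  have "\<not> representable (Suc l) (m(Suc l := t))" for t
    using Suc.prems representable_cong[of l "m(Suc l := t)" m] representable_mono[of "Suc l" _ l]
    by auto
  then have "tail_volume k (Suc l) (m(Suc l := t)) = 0" for t by (rule Suc.IH)
  then show ?case by simp
qed simp

text \<open>Mixing with the fixed sequence \<open>m'\<close> contracts the fibre over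
  \<open>m\<close> by \<open>1 - e\<close> in each of its \<open>k\<close> directions and places it
  inside the fibre over the mixture. The fibre reaches up to order \<open>l + k\<close>, hence the
  representability of \<open>m'\<close> at every order.\<close>

lemma tail_volume_convex:
  assumes "\<And>n. representable n m'" "0 \<le> e" "e < 1"
  shows "ennreal ((1 - e) ^ k) * tail_volume k l m \<le> tail_volume k l (\<lambda>i. (1 - e) * m i + e * m' i)"
proof (induction k arbitrary: l m)
  case 0
  then show ?case using representable_convex[OF _ assms(1), of l m e] assms(2,3)
    by (auto simp: indicator_def)
next
  case (Suc k)
  let ?mix = "\<lambda>m i. (1 - e) * m i + e * m' i"
  have upd: "(?mix m)(Suc l := e * m' (Suc l) + (1 - e) * t) = ?mix (m(Suc l := t))" for t
    by (auto simp: fun_eq_iff)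
  have "ennreal ((1 - e) ^ Suc k) * tail_volume (Suc k) l m =
      ennreal (1 - e) * (\<integral>\<^sup>+t. ennreal ((1 - e) ^ k) * tail_volume k (Suc l) (m(Suc l := t)) \<partial>lborel)"
    using assms(2,3) by (simp add: nn_integral_cmult ennreal_mult mult.assoc)
  also have "\<dots> \<le> ennreal (1 - e) * (\<integral>\<^sup>+t. tail_volume k (Suc l) (?mix (m(Suc l := t))) \<partial>lborel)"
    by (intro mult_left_mono nn_integral_mono Suc.IH) simp
  also have "\<dots> = ennreal \<bar>1 - e\<bar> * (\<integral>\<^sup>+t. tail_volume k (Suc l) ((?mix m)(Suc l := e * m' (Suc l) + (1 - e) * t)) \<partial>lborel)"
    unfolding upd using assms by simp
  also have "\<dots> = (\<integral>\<^sup>+t. tail_volume k (Suc l) ((?mix m)(Suc l := t)) \<partial>lborel)"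
    using assms by (intro nn_integral_real_affine[symmetric]) auto
  finally show ?case by simp
qed

text \<open>The value of the Beta function at \<open>(k + 1, k + 1)\<close>. Only positivity and
  finiteness are established, because these values cancel in the quotient of volumes.\<close>

definition beta_integral :: "nat \<Rightarrow> ennreal" where
  "beta_integral k = (\<integral>\<^sup>+u. indicator {0<..<1} u * ennreal ((u * (1 - u)) ^ k) \<partial>lborel)"

lemma beta_integral_pos: "0 < beta_integral k"
proof -
  have "\<not> (AE u in lborel. indicator {0<..<1} u * ennreal ((u * (1 - u)) ^ k) = 0)"
  proof
    assume "AE u in lborel. indicator {0<..<1} u * ennreal ((u * (1 - u)) ^ k) = 0"
    then have "AE u in lborel. u \<notin> {0<..<1::real}"
    proof eventually_elim
      case (elim u)
      have "0 < (u * (1 - u)) ^ k" if "u \<in> {0<..<1}" using that by simp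
      then show ?case using elim by (fastforce simp: indicator_def ennreal_eq_0_iff)
    qed
    then have "emeasure lborel {0<..<1::real} = 0"
      by (subst (asm) AE_iff_measurable[of "{0<..<1}"]) auto
    then show False by simp
  qed
  then show ?thesis
    unfolding beta_integral_def by (subst (asm) nn_integral_0_iff_AE[symmetric]) (auto simp: zero_less_iff_neq_zero)
qed

lemma beta_integral_less_top: "beta_integral k < \<infinity>"
proof -
  have "beta_integral k \<le> (\<integral>\<^sup>+u. indicator {0<..<1::real} u \<partial>lborel)"
    unfolding beta_integral_def
    by (intro nn_integral_mono) (auto simp: indicator_def intro!: power_le_one mult_le_one)
  then show ?thesis by (simp add: le_less_trans)
qed

text \<open>For a range of width \<open>\<rho>\<close> starting at \<open>\<alpha>\<close>, the base
  of the power is the width of the range one order later when the next moment is \<open>t\<close>.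
  Rescaling to the unit interval gives one factor \<open>\<rho>\<close> from the base to the power
  \<open>k\<close> and one more from \<open>dt\<close>.\<close>

lemma nn_integral_scaled_beta:
  assumes "0 < \<rho>"
  shows "(\<integral>\<^sup>+t. indicator {\<alpha><..<\<alpha> + \<rho>} t * ennreal (((t - \<alpha>) * (\<rho> - (t - \<alpha>)) / \<rho>) ^ k) \<partial>lborel) =
    ennreal (\<rho> ^ Suc k) * beta_integral k"
proof -
  have "(\<integral>\<^sup>+t. indicator {\<alpha><..<\<alpha> + \<rho>} t * ennreal (((t - \<alpha>) * (\<rho> - (t - \<alpha>)) / \<rho>) ^ k) \<partial>lborel) =
     ennreal \<bar>\<rho>\<bar> * (\<integral>\<^sup>+u. indicator {\<alpha><..<\<alpha> + \<rho>} (\<alpha> + \<rho> * u) *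
       ennreal (((\<alpha> + \<rho> * u - \<alpha>) * (\<rho> - (\<alpha> + \<rho> * u - \<alpha>)) / \<rho>) ^ k) \<partial>lborel)"
    using assms by (intro nn_integral_real_affine) auto
  also have "\<dots> = ennreal \<rho> * (\<integral>\<^sup>+u. ennreal (\<rho> ^ k) * (indicator {0<..<1} u * ennreal ((u * (1 - u)) ^ k)) \<partial>lborel)"
  proof -
    have "indicator {\<alpha><..<\<alpha> + \<rho>} (\<alpha> + \<rho> * u) *
       ennreal (((\<alpha> + \<rho> * u - \<alpha>) * (\<rho> - (\<alpha> + \<rho> * u - \<alpha>)) / \<rho>) ^ k) =
       ennreal (\<rho> ^ k) * (indicator {0<..<1} u * ennreal ((u * (1 - u)) ^ k))" for u
    proof -
      have "(\<alpha> + \<rho> * u - \<alpha>) * (\<rho> - (\<alpha> + \<rho> * u - \<alpha>)) / \<rho> = \<rho> * (u * (1 - u))"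
        using assms by (simp add: field_simps)
      moreover have "\<alpha> + \<rho> * u \<in> {\<alpha><..<\<alpha> + \<rho>} \<longleftrightarrow> u \<in> {0<..<1}"
        using assms by (auto simp: zero_less_mult_iff)
      ultimately show ?thesis
        using assms by (auto simp: indicator_def power_mult_distrib ennreal_mult[symmetric])
    qed
    then show ?thesis using assms by simp
  qed
  also have "\<dots> = ennreal (\<rho> ^ Suc k) * beta_integral k"
    using assms by (simp add: nn_integral_cmult beta_integral_def ennreal_mult mult.assoc)
  finally show ?thesis .
qed

text \<open>The volume of the whole moment space of order \<open>k\<close>: for \<open>l = 0\<close>
  the gap polynomial of the pair \<open>(1, 1)\<close> is \<open>x + (1 - x) = 1\<close>.\<close>

definition volume_constant :: "nat \<Rightarrow> ennreal" where
  "volume_constant k = (\<Prod>j<k. beta_integral j)"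

lemma volume_constant_simps [simp]:
  "volume_constant 0 = 1" "volume_constant (Suc k) = volume_constant k * beta_integral k"
  by (simp_all add: volume_constant_def)

lemma volume_constant_pos: "0 < volume_constant k"
  by (induction k) (simp_all add: ennreal_zero_less_mult_iff beta_integral_pos)

lemma volume_constant_less_top: "volume_constant k < \<infinity>"
  using beta_integral_less_top by (induction k) (simp_all add: ennreal_mult_less_top)

section \<open>Two-sided volume bounds from pairs of polynomials\<close>

lemma lower_poly_upd:
  assumes "monic_pair l p r"
  shows "moment_functional (m(Suc l := t)) (lower_poly l p) = moment_functional m (lower_poly l p) + (t - m (Suc l))"
  using degree_lower_poly[OF assms] coeff_lower_poly[OF assms] by (subst moment_functional_upd) auto

lemma upper_poly_upd:
  assumes "monic_pair l p r"
  shows "moment_functional (m(Suc l := t)) (upper_poly l r) = moment_functional m (upper_poly l r) - (t - m (Suc l))"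
  using degree_upper_poly[OF assms] coeff_upper_poly[OF assms] by (subst moment_functional_upd) auto

lemma moment_functional_gap_next:
  assumes a: "moment_functional m (lower_poly l p) = a" "0 < a"
    and b: "moment_functional m (upper_poly l r) = b" "0 < b"
  shows "moment_functional m (gap_poly (Suc l) (next_lower (a / b) l p r) (next_upper (a / b) l p r)) = a * b / (a + b)"
proof -
  have c: "a / b \<noteq> -1" "1 + a / b = (a + b) / b" using a(2) b(2) by (auto simp: field_simps)
  have "moment_functional m (gap_poly (Suc l) (next_lower (a / b) l p r) (next_upper (a / b) l p r)) =
      (a + (a / b)\<^sup>2 * b) / ((a + b) / b)\<^sup>2"
    unfolding gap_poly_next[OF c(1)] c(2) by (simp add: moment_functional_smult moment_functional_add a b)
  also have "a + (a / b)\<^sup>2 * b = a * (a + b) / b"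
    using b(2) by (simp add: field_simps power2_eq_square)
  also have "a * s / b / (s / b)\<^sup>2 = a * b / s" if "s \<noteq> 0" for s
    using that b(2) by (simp add: power2_eq_square)
  then have "a * (a + b) / b / ((a + b) / b)\<^sup>2 = a * b / (a + b)" using a(2) b(2) by simp
  finally show ?thesis .
qed

text \<open>Nonnegativity at the two polynomials confines the next moment to an interval of length
  \<open>\<rho>\<close>, whatever the pair. The ratio of the distances to its ends, which depends on
  \<open>t\<close>, selects the pair for the next order.\<close>

lemma tail_volume_upper:
  assumes "representable l m" "monic_pair l p r"
  shows "tail_volume k l m \<le> volume_constant k * ennreal (moment_functional m (gap_poly l p r) ^ k)"
  using assms
proof (induction k arbitrary: l m p r)
  case 0
  then show ?case by (simp add: indicator_def)
next
  case (Suc k)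
  let ?A = "lower_poly l p" and ?B = "upper_poly l r"
  define \<rho> where "\<rho> = moment_functional m (gap_poly l p r)"
  define \<alpha> where "\<alpha> = m (Suc l) - moment_functional m ?A"
  define f where "f t = indicator {\<alpha><..<\<alpha> + \<rho>} t * ennreal (((t - \<alpha>) * (\<rho> - (t - \<alpha>)) / \<rho>) ^ k)" for t
  have \<rho>0: "0 \<le> \<rho>"
    unfolding \<rho>_def using Suc.prems degree_gap_poly[OF Suc.prems(2)]
    by (intro representable_nonneg) (auto simp: gap_poly_def lower_poly_nonneg upper_poly_nonneg)
  have a: "moment_functional (m(Suc l := t)) ?A = t - \<alpha>" for t
    using lower_poly_upd[OF Suc.prems(2)] by (simp add: \<alpha>_def)
  have b: "moment_functional (m(Suc l := t)) ?B = \<rho> - (t - \<alpha>)" for t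
    using upper_poly_upd[OF Suc.prems(2)] by (simp add: \<alpha>_def \<rho>_def gap_poly_def moment_functional_add)
  have "tail_volume (Suc k) l m \<le> (\<integral>\<^sup>+t. volume_constant k * f t \<partial>lborel)"
    unfolding tail_volume.simps
  proof (rule nn_integral_mono_AE)
    \<comment> \<open>At the ends of the interval one distance is 0 and the strict positivity behind
      the next step fails; the ends form a null set.\<close>
    have "AE t in lborel. t \<noteq> \<alpha> \<and> t \<noteq> \<alpha> + \<rho>"
      using AE_lborel_singleton[of \<alpha>] AE_lborel_singleton[of "\<alpha> + \<rho>"] by eventually_elim simp
    then show "AE t in lborel. tail_volume k (Suc l) (m(Suc l := t)) \<le> volume_constant k * f t"
    proof eventually_elim
      case (elim t)
      show ?case
      proof (cases "representable (Suc l) (m(Suc l := t))")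
        case True
        have "0 \<le> moment_functional (m(Suc l := t)) ?A"
          by (rule representable_nonneg[OF True degree_lower_poly[OF Suc.prems(2)]]) (simp add: lower_poly_nonneg)
        moreover have "0 \<le> moment_functional (m(Suc l := t)) ?B"
          by (rule representable_nonneg[OF True degree_upper_poly[OF Suc.prems(2)]]) (simp add: upper_poly_nonneg)
        ultimately have "0 \<le> t - \<alpha>" "0 \<le> \<rho> - (t - \<alpha>)" unfolding a b .
        then have pos: "0 < t - \<alpha>" "0 < \<rho> - (t - \<alpha>)" using elim by auto
        let ?c = "(t - \<alpha>) / (\<rho> - (t - \<alpha>))"
        have "?c \<noteq> -1" using pos by (auto simp: field_simps)
        note IH = Suc.IH[OF True monic_pair_next[OF Suc.prems(2) this]]
        have sum: "(t - \<alpha>) + (\<rho> - (t - \<alpha>)) = \<rho>" by simp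
        have "tail_volume k (Suc l) (m(Suc l := t)) \<le>
            volume_constant k * ennreal (((t - \<alpha>) * (\<rho> - (t - \<alpha>)) / \<rho>) ^ k)"
          using IH unfolding moment_functional_gap_next[OF a pos(1) b pos(2)] sum .
        then show ?thesis using pos by (simp add: f_def)
      qed (simp add: tail_volume_eq_0)
    qed
  qed
  also have "\<dots> = volume_constant k * (\<integral>\<^sup>+t. f t \<partial>lborel)"
    unfolding f_def by (rule nn_integral_cmult) measurable
  finally have le1: "tail_volume (Suc k) l m \<le> volume_constant k * (\<integral>\<^sup>+t. f t \<partial>lborel)" .
  have le2: "(\<integral>\<^sup>+t. f t \<partial>lborel) \<le> ennreal (\<rho> ^ Suc k) * beta_integral k"
  proof (cases "\<rho> = 0")
    case True
    then show ?thesis by (simp add: f_def)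
  next
    case False
    then show ?thesis using \<rho>0 nn_integral_scaled_beta[of \<rho> \<alpha> k] by (simp add: f_def)
  qed
  have "tail_volume (Suc k) l m \<le> volume_constant k * (ennreal (\<rho> ^ Suc k) * beta_integral k)"
    by (rule order_trans[OF le1 mult_left_mono[OF le2]]) simp
  then show ?case by (simp only: \<rho>_def volume_constant_simps mult_ac)
qed

text \<open>For the orthogonal pair nothing is lost: at each \<open>t\<close> strictly inside the
  interval both distances are positive, so strict positivity passes to the next order and the pair
  built from their ratio is orthogonal again.\<close>

lemma tail_volume_lower:
  assumes "strictly_positive l m" "m 0 = 1" "orthogonal_pair l m p r" "monic_pair l p r"
  shows "volume_constant k * ennreal (moment_functional m (gap_poly l p r) ^ k) \<le> tail_volume k l m"
  using assms
proof (induction k arbitrary: l m p r)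
  case 0
  then show ?case using representable_if_strictly_positive by simp
next
  case (Suc k)
  let ?A = "lower_poly l p" and ?B = "upper_poly l r"
  define \<rho> where "\<rho> = moment_functional m (gap_poly l p r)"
  define \<alpha> where "\<alpha> = m (Suc l) - moment_functional m ?A"
  define f where "f t = indicator {\<alpha><..<\<alpha> + \<rho>} t * ennreal (((t - \<alpha>) * (\<rho> - (t - \<alpha>)) / \<rho>) ^ k)" for t
  have \<rho>0: "0 < \<rho>"
    unfolding \<rho>_def by (rule moment_functional_gap_pos[OF Suc.prems(1,4)])
  have a: "moment_functional (m(Suc l := t)) ?A = t - \<alpha>" for t
    using lower_poly_upd[OF Suc.prems(4)] by (simp add: \<alpha>_def)
  have b: "moment_functional (m(Suc l := t)) ?B = \<rho> - (t - \<alpha>)" for t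
    using upper_poly_upd[OF Suc.prems(4)] by (simp add: \<alpha>_def \<rho>_def gap_poly_def moment_functional_add)
  have "volume_constant (Suc k) * ennreal (\<rho> ^ Suc k) = volume_constant k * (\<integral>\<^sup>+t. f t \<partial>lborel)"
    using nn_integral_scaled_beta[OF \<rho>0, of \<alpha> k] by (simp add: f_def mult_ac)
  also have "\<dots> = (\<integral>\<^sup>+t. volume_constant k * f t \<partial>lborel)"
    unfolding f_def by (rule nn_integral_cmult[symmetric]) measurable
  also have "\<dots> \<le> tail_volume (Suc k) l m"
    unfolding tail_volume.simps
  proof (rule nn_integral_mono)
    fix t
    let ?m = "m(Suc l := t)"
    show "volume_constant k * f t \<le> tail_volume k (Suc l) ?m"
    proof (cases "t \<in> {\<alpha><..<\<alpha> + \<rho>}")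
      case True
      then have pos: "0 < t - \<alpha>" "0 < \<rho> - (t - \<alpha>)" by auto
      let ?c = "(t - \<alpha>) / (\<rho> - (t - \<alpha>))"
      have c: "?c \<noteq> -1" using pos by (auto simp: field_simps)
      have sp: "strictly_positive l ?m"
        by (rule strictly_positive_cong[OF Suc.prems(1)]) auto
      have o: "orthogonal_pair l ?m p r"
        by (rule orthogonal_pair_cong[OF Suc.prems(3,4)]) auto
      have sp': "strictly_positive (Suc l) ?m"
        using pos by (intro strictly_positive_Suc[OF sp o Suc.prems(4)]) (simp_all add: a b)
      have o': "orthogonal_pair (Suc l) ?m (next_lower ?c l p r) (next_upper ?c l p r)"
        using pos by (intro orthogonal_pair_next[OF o Suc.prems(4)]) (simp add: a b)
      have m0: "?m 0 = 1" using Suc.prems(2) by simp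
      have sum: "(t - \<alpha>) + (\<rho> - (t - \<alpha>)) = \<rho>" by simp
      have "volume_constant k * ennreal (((t - \<alpha>) * (\<rho> - (t - \<alpha>)) / \<rho>) ^ k) \<le> tail_volume k (Suc l) ?m"
        using Suc.IH[OF sp' m0 o' monic_pair_next[OF Suc.prems(4) c]]
        unfolding moment_functional_gap_next[OF a pos(1) b pos(2)] sum .
      then show ?thesis using True by (simp add: f_def)
    qed (simp add: f_def)
  qed
  finally show ?case by (simp add: \<rho>_def)
qed

text \<open>Generated from \<open>(1, 1)\<close> by the step of the volume recursion, with the ratio
  dictated by the next moment.\<close>

lemma exists_orthogonal_pair:
  assumes "strictly_positive l m"
  shows "\<exists>p r. monic_pair l p r \<and> orthogonal_pair l m p r"
  using assms
proof (induction l)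
  case 0
  have "orthogonal_pair 0 m 1 1"
    unfolding orthogonal_pair_def by (auto elim: degree_eq_zeroE)
  then show ?case using monic_pair_0 by blast
next
  case (Suc l)
  then have "strictly_positive l m" by (simp add: strictly_positive_def)
  then obtain p r where mp: "monic_pair l p r" and o: "orthogonal_pair l m p r" using Suc.IH by blast
  define a where "a = moment_functional m (lower_poly l p)"
  define b where "b = moment_functional m (upper_poly l r)"
  have nz: "lower_poly l p \<noteq> 0" "upper_poly l r \<noteq> 0"
    using coeff_lower_poly[OF mp] coeff_upper_poly[OF mp] by auto
  have "0 < a"
    unfolding a_def by (intro strictly_positiveD[OF Suc.prems] degree_lower_poly[OF mp] nz lower_poly_nonneg)
  moreover have "0 < b"
    unfolding b_def by (intro strictly_positiveD[OF Suc.prems] degree_upper_poly[OF mp] nz upper_poly_nonneg)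
  ultimately have "a / b \<noteq> -1" "a = a / b * b" by (auto simp: field_simps)
  then show ?case
    using monic_pair_next[OF mp] orthogonal_pair_next[OF o mp, of "a / b"] unfolding a_def b_def by blast
qed

text \<open>Nonnegative polynomials scaled to mean 1 have coefficients bounded by one constant
  \<open>D\<close>. Moving \<open>l + 1\<close> moments by at most \<open>d\<close> changes such a
  mean by at most \<open>(l + 1) * D * d = 1/2\<close>.\<close>

lemma strictly_positive_perturb:
  assumes sp: "strictly_positive l m" and m0: "m 0 = 1"
  obtains d where "0 < d" "\<And>m'. (\<And>i. i \<le> l \<Longrightarrow> \<bar>m' i - m i\<bar> \<le> d) \<Longrightarrow> strictly_positive l m'"
proof -
  have pos: "0 < moment_functional m P"
    if P: "\<And>i. i \<notin> {..l} \<Longrightarrow> coeff P i = 0" "P \<noteq> 0" "\<And>x. x \<in> {0..1} \<Longrightarrow> 0 \<le> poly P x" for P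
  proof -
    have "degree P \<le> l" using P(1) by (intro degree_le) auto
    then show ?thesis using P sp by (auto simp: strictly_positive_def)
  qed
  obtain D where D: "1 \<le> D" "\<And>y i. y \<in> feasible {..l} m \<Longrightarrow> i \<in> {..l} \<Longrightarrow> \<bar>y i\<bar> \<le> D"
    by (rule feasible_bound[of "{..l}" m]) (use m0 pos in auto)
  define d where "d = 1 / (2 * (real (Suc l) * D))"
  have d: "d > 0" "real (Suc l) * D * d = 1/2" 
  proof -
    have "real (Suc l) * D > 0" using D(1) by (intro mult_pos_pos) auto
    moreover have "x * (1 / (2 * x)) = 1/2" if "x > 0" for x :: real using that by simp
    ultimately show "real (Suc l) * D * d = 1/2" unfolding d_def by blast
    show "d > 0" unfolding d_def using \<open>real (Suc l) * D > 0\<close> by simp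
  qed
  show ?thesis
  proof (rule that[OF d(1)])
    fix m' :: "nat \<Rightarrow> real" assume m': "\<And>i. i \<le> l \<Longrightarrow> \<bar>m' i - m i\<bar> \<le> d"
    show "strictly_positive l m'"
      unfolding strictly_positive_def
    proof (intro allI impI)
      fix P :: "real poly"
      assume P: "P \<noteq> 0" "degree P \<le> l" "\<forall>x\<in>{0..1}. 0 \<le> poly P x"
      define s where "s = moment_functional m P"
      have s: "s > 0" unfolding s_def using P sp by (simp add: strictly_positive_def)
      define y where "y i = coeff P i / s" for i
      have "y \<in> feasible {..l} m"
      proof -
        have "sparse_eval {..l} y x = poly P x / s" for x
        proof -
          have "poly P x = (\<Sum>i\<le>l. coeff P i * x ^ i)"
            unfolding poly_altdef using P(2)
            by (intro sum.mono_neutral_left) (auto simp: coeff_eq_0)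
          then show ?thesis by (simp add: sparse_eval_def y_def sum_divide_distrib)
        qed
        moreover have "sparse_mean {..l} m y = 1"
        proof -
          have "sparse_mean {..l} m y = (\<Sum>i\<le>l. coeff P i * m i) / s"
            by (simp add: sparse_mean_def y_def sum_divide_distrib)
          also have "(\<Sum>i\<le>l. coeff P i * m i) = s"
            by (simp add: s_def moment_functional_eq_sum[OF P(2)])
          finally have "sparse_mean {..l} m y = s / s" .
          then show ?thesis using s by simp
        qed
        ultimately show ?thesis using P(3) s by (auto simp: feasible_def)
      qed
      then have c: "\<bar>coeff P i\<bar> \<le> D * s" if "i \<le> l" for i
        using D(2)[of y i] that s by (simp add: y_def field_simps)
      have "s - moment_functional m' P = (\<Sum>i\<le>l. coeff P i * (m i - m' i))"
        by (simp add: s_def moment_functional_eq_sum[OF P(2)] sum_subtractf algebra_simps)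
      also have "\<dots> \<le> (\<Sum>i\<le>l. D * s * d)"
      proof (rule sum_mono)
        fix i assume i: "i \<in> {..l}"
        have "coeff P i * (m i - m' i) \<le> \<bar>coeff P i\<bar> * \<bar>m i - m' i\<bar>" by (simp flip: abs_mult)
        also have "\<dots> \<le> D * s * d"
          using c[of i] m'[of i] i D(1) s by (intro mult_mono) (auto simp: abs_minus_commute)
        finally show "coeff P i * (m i - m' i) \<le> D * s * d" .
      qed
      also have "\<dots> = real (Suc l) * D * d * s" by simp
      also have "\<dots> = s / 2" unfolding d(2) by simp
      finally show "0 < moment_functional m' P" using s by simp
    qed
  qed
qed

section \<open>Strict maximality of the fibre over the optimal point\<close>

lemma linear_coefficient_eq_0:
  assumes "\<And>t :: real. 0 \<le> 2 * t * b + t\<^sup>2 * c"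
  shows "b = 0"
proof (rule ccontr)
  assume "b \<noteq> 0"
  define e where "e = 1 / (\<bar>c\<bar> + 1)"
  have e: "e > 0" "e * \<bar>c\<bar> < 1" by (simp_all add: e_def field_simps)
  have "0 \<le> 2 * (- e * b) * b + (- e * b)\<^sup>2 * c" by (rule assms)
  also have "\<dots> = e * b\<^sup>2 * (e * c - 2)" by (simp add: power2_eq_square algebra_simps)
  finally have "0 \<le> e * b\<^sup>2 * (e * c - 2)" .
  moreover have "e * c - 2 < 0"
    using e abs_ge_self[of c] mult_left_mono[of c "\<bar>c\<bar>" e] by linarith
  moreover have "0 < e * b\<^sup>2" using e \<open>b \<noteq> 0\<close> by simp
  ultimately show False by (simp add: zero_le_mult_iff)
qed

lemma orthogonal_if_minimal:
  assumes "\<And>t. moment_functional m (W * p\<^sup>2) \<le> moment_functional m (W * (p + smult t u)\<^sup>2)"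
  shows "moment_functional m (W * p * u) = 0"
proof (rule linear_coefficient_eq_0)
  fix t
  have "W * (p + smult t u)\<^sup>2 = W * p\<^sup>2 + (smult (2 * t) (W * p * u) + smult (t\<^sup>2) (W * u\<^sup>2))"
    unfolding power2_eq_square mult_2 smult_add_left by (simp add: algebra_simps)
  then show "0 \<le> 2 * t * moment_functional m (W * p * u) + t\<^sup>2 * moment_functional m (W * u\<^sup>2)"
    using assms[of t] by (simp only: moment_functional_add moment_functional_smult le_add_same_cancel1)
qed

text \<open>The members of the pair vary independently, so a minimum of the sum is a minimum of each
  term, and a vanishing first variation is orthogonality.\<close>

lemma orthogonal_pair_if_minimal:
  assumes mp: "monic_pair l p r"
    and min: "\<And>p' r'. monic_pair l p' r' \<Longrightarrow> moment_functional m (gap_poly l p r) \<le> moment_functional m (gap_poly l p' r')"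
  shows "orthogonal_pair l m p r"
  unfolding orthogonal_pair_def
proof (intro conjI allI impI orthogonal_if_minimal)
  fix u :: "real poly" and t
  assume u: "degree u \<le> Suc l div 2" "coeff u (Suc l div 2) = 0"
  have "monic_pair l (p + smult t u) r"
    using mp u unfolding monic_pair_def
    by (auto intro!: degree_add_le order_trans[OF degree_smult_le])
  from min[OF this]
  show "moment_functional m (odd_factor (Suc l) * p\<^sup>2) \<le> moment_functional m (odd_factor (Suc l) * (p + smult t u)\<^sup>2)"
    unfolding gap_poly_def lower_poly_def moment_functional_add by simp
next
  fix u :: "real poly" and t
  assume u: "degree u \<le> l div 2" "coeff u (l div 2) = 0"
  have "monic_pair l p (r + smult t u)"
    using mp u unfolding monic_pair_def
    by (auto intro!: degree_add_le order_trans[OF degree_smult_le])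
  from min[OF this]
  show "moment_functional m (odd_factor l * [:1, -1:] * r\<^sup>2) \<le>
      moment_functional m (odd_factor l * [:1, -1:] * (r + smult t u)\<^sup>2)"
    unfolding gap_poly_def upper_poly_def moment_functional_add by (simp only: add_le_cancel_left)
qed

context
  fixes l :: nat and m :: "nat \<Rightarrow> real" and q p r :: "real poly" and \<rho> :: real
  assumes q_deg: "degree q \<le> l" and q_pos: "\<And>x. x \<in> {0..1} \<Longrightarrow> 0 < poly q x"
    and m_eq: "\<And>i. m i = (\<integral>x. x ^ i / poly q x \<partial>arcsine)" and m0: "m 0 = 1"
    and mp: "monic_pair l p r" and orth: "orthogonal_pair l m p r"
    and gap: "gap_poly l p r = smult \<rho> q" and \<rho>_pos: "0 < \<rho>"
begin

text \<open>The pair of \<open>m\<close> has the value \<open>\<rho>\<close> at every slice point.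
  If no pair did better at \<open>m'\<close>, it would be orthogonal for \<open>m'\<close> too,
  hence for the midpoint of \<open>m\<close> and \<open>m'\<close>, and the midpoint would have the
  same density polynomial as \<open>m\<close>.\<close>

lemma exists_smaller_gap:
  assumes rep: "representable l m'" and slice: "moment_functional m' q = 1" and ne: "i \<le> l" "m' i \<noteq> m i"
  shows "\<exists>p' r'. monic_pair l p' r' \<and> moment_functional m' (gap_poly l p' r') < \<rho>"
proof (rule ccontr)
  assume "\<not> ?thesis"
  then have min: "\<rho> \<le> moment_functional m' (gap_poly l p' r')" if "monic_pair l p' r'" for p' r'
    using that by force
  have gm': "moment_functional m' (gap_poly l p r) = \<rho>"
    by (simp add: gap moment_functional_smult slice)
  have orth': "orthogonal_pair l m' p r"
    using min by (intro orthogonal_pair_if_minimal[OF mp]) (simp add: gm')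
  \<comment> \<open>The point \<open>m'\<close> may lie on the boundary; the midpoint with
    \<open>m\<close> is strictly positive and so has a density polynomial.\<close>
  define a where "a i = (1 - 1/2) * m i + 1/2 * m' i" for i
  have spm: "strictly_positive l m" by (rule strictly_positive_arcsine[OF q_pos m_eq])
  have sp: "strictly_positive l a"
    unfolding a_def by (rule strictly_positive_convex[OF spm rep]) auto
  have a0: "a 0 = 1" using m0 representable_0[OF rep] by (simp add: a_def)
  have o: "orthogonal_pair l a p r"
    using orth orth' unfolding a_def orthogonal_pair_def moment_functional_affine by simp
  obtain q' where q': "degree q' \<le> l" "\<And>x. x \<in> {0..1} \<Longrightarrow> 0 < poly q' x"
    "\<And>i. i \<le> l \<Longrightarrow> a i = (\<integral>x. x ^ i / poly q' x \<partial>arcsine)"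
    by (rule exists_full_density_poly[OF sp a0]) blast
  have "moment_functional m q = 1" by (rule moment_functional_self[OF q_pos m_eq q_deg])
  then have "moment_functional a (gap_poly l p r) = \<rho>"
    unfolding a_def moment_functional_affine by (simp add: gap moment_functional_smult slice)
  then have "smult \<rho> q = smult \<rho> q'"
    using gap_poly_eq_smult[OF sp o mp q'] by (simp add: gap)
  then have "smult (1 / \<rho>) (smult \<rho> q) = smult (1 / \<rho>) (smult \<rho> q')" by (rule arg_cong)
  then have "q = q'" using \<rho>_pos by simp
  then have "a i = m i" using q'(3)[OF ne(1)] by (simp add: m_eq)
  then show False using ne(2) by (simp add: a_def)
qed

text \<open>A compactness argument makes the gain uniform: representable moments have convergent
  subsequences with representable limits, and the value of a fixed pair is continuous in the
  moments.\<close>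

lemma gap_bound_far:
  assumes e: "0 < e"
  obtains \<eta> where "0 < \<eta>" "\<And>m' j. representable l m' \<Longrightarrow> moment_functional m' q = 1 \<Longrightarrow> j \<le> l \<Longrightarrow>
    e \<le> \<bar>m' j - m j\<bar> \<Longrightarrow> \<exists>p' r'. monic_pair l p' r' \<and> moment_functional m' (gap_poly l p' r') \<le> \<rho> - \<eta>"
proof -
  define bad where "bad k m' \<longleftrightarrow> representable l m' \<and> moment_functional m' q = 1 \<and>
      (\<exists>j\<le>l. e \<le> \<bar>m' j - m j\<bar>) \<and>
      (\<forall>p' r'. monic_pair l p' r' \<longrightarrow> \<rho> - inverse (real (Suc k)) < moment_functional m' (gap_poly l p' r'))" for k m'
  have "\<exists>k. \<forall>m'. \<not> bad k m'"
  proof (rule ccontr)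
    assume "\<not> ?thesis"
    then obtain M where M: "\<And>k. bad k (M k)" by metis
    have rep: "representable l (M k)" for k using M by (simp add: bad_def)
    have "\<bar>M k i\<bar> \<le> 1" if "i \<in> {..l}" for k i
      using representable_bounds[OF rep, of i k] that by simp
    then obtain g r' where r': "strict_mono r'" and g: "\<And>i. i \<in> {..l} \<Longrightarrow> (\<lambda>k. M (r' k) i) \<longlonglongrightarrow> g i"
      by (rule bounded_functions_subseq[of "{..l}" M 1, OF finite_atMost]) auto
    have repg: "representable l g" by (rule representable_limit[where M = "\<lambda>k. M (r' k)"]) (use rep g in auto)
    have limL: "(\<lambda>k. moment_functional (M (r' k)) P) \<longlonglongrightarrow> moment_functional g P" if "degree P \<le> l" for P
      unfolding moment_functional_def using that g by (intro tendsto_sum tendsto_mult_left) auto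
    have "(\<lambda>k. \<Sum>j\<le>l. \<bar>M (r' k) j - m j\<bar>) \<longlonglongrightarrow> (\<Sum>j\<le>l. \<bar>g j - m j\<bar>)"
      using g by (intro tendsto_intros) auto
    moreover have "e \<le> (\<Sum>j\<le>l. \<bar>M k j - m j\<bar>)" for k
    proof -
      obtain j where "j \<le> l" "e \<le> \<bar>M k j - m j\<bar>" using M[of k] by (auto simp: bad_def)
      then show ?thesis using member_le_sum[of j "{..l}" "\<lambda>j. \<bar>M k j - m j\<bar>"] by simp
    qed
    ultimately have "e \<le> (\<Sum>j\<le>l. \<bar>g j - m j\<bar>)" by (intro LIMSEQ_le_const) auto
    then obtain i where i: "i \<le> l" "g i \<noteq> m i"
      using e by (metis (no_types, lifting) abs_zero atMost_iff diff_self leD sum.neutral)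
    have "moment_functional g q = 1"
      using limL[OF q_deg] M by (simp add: bad_def LIMSEQ_const_iff)
    then obtain p' s' where ps: "monic_pair l p' s'" "moment_functional g (gap_poly l p' s') < \<rho>"
      using exists_smaller_gap[OF repg _ i] by blast
    have "(\<lambda>k. \<rho> - inverse (real (Suc (r' k)))) \<longlonglongrightarrow> \<rho> - 0"
      using LIMSEQ_subseq_LIMSEQ[OF LIMSEQ_inverse_real_of_nat r'] by (intro tendsto_intros) (simp add: o_def)
    then have "\<rho> - 0 \<le> moment_functional g (gap_poly l p' s')"
      by (rule LIMSEQ_le[OF _ limL[OF degree_gap_poly[OF ps(1)]]])
        (use M ps(1) in \<open>auto simp: bad_def less_imp_le\<close>)
    then show False using ps(2) by simp
  qed
  then obtain k where k: "\<And>m'. \<not> bad k m'" by blast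
  show ?thesis
  proof (rule that[of "inverse (real (Suc k))"])
    fix m' j
    assume "representable l m'" "moment_functional m' q = 1" "j \<le> l" "e \<le> \<bar>m' j - m j\<bar>"
    then show "\<exists>p' r'. monic_pair l p' r' \<and> moment_functional m' (gap_poly l p' r') \<le> \<rho> - inverse (real (Suc k))"
      using k[of m'] unfolding bad_def by (meson not_less)
  qed simp
qed

end

section \<open>Constrained moments\<close>

text \<open>The moment of order 0 joins the constraint with value 1; the value 0 at other
  unconstrained indices is a filler.\<close>

definition constraint_value :: "(nat \<rightharpoonup> real) \<Rightarrow> nat \<Rightarrow> real" where
  "constraint_value C i = (case C i of Some c \<Rightarrow> c | None \<Rightarrow> if i = 0 then 1 else 0)"

text \<open>Total sequences live in one space for all \<open>n\<close>, so the fibre volumes can be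
  composed with this map. For \<open>last_index C \<le> n\<close> the entries above \<open>n\<close>
  are fillers.\<close>

definition complete_moments :: "(nat \<rightharpoonup> real) \<Rightarrow> nat \<Rightarrow> (nat \<Rightarrow> real) \<Rightarrow> (nat \<Rightarrow> real)" where
  "complete_moments C n x = (\<lambda>i. if i \<in> free_indices C n then x i else constraint_value C i)"

lemma last_index_ge: "is_constraint C \<Longrightarrow> i \<in> dom C \<Longrightarrow> i \<le> last_index C"
  by (auto simp: is_constraint_def last_index_def)

lemma constraint_value_moment:
  assumes "is_constraint C" "\<mu> \<in> constrained_measures C E" "i \<in> insert 0 (dom C)"
  shows "constraint_value C i = moment i \<mu>"
proof (cases "C i")
  case None
  then have "i = 0" using assms(3) by auto
  then show ?thesis
    using None assms(2) moment_0 by (auto simp: constraint_value_def constrained_measures_def)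
next
  case (Some c)
  then show ?thesis using assms(2) by (simp add: constraint_value_def constrained_measures_def)
qed

lemma moment_functional_cong_support:
  "(\<And>i. coeff P i \<noteq> 0 \<Longrightarrow> m i = m' i) \<Longrightarrow> moment_functional m P = moment_functional m' P"
  unfolding moment_functional_def by (rule sum.cong) auto

text \<open>
  Interiority is used through a perturbation of the moments against the coefficients of \<open>P\<close>.
\<close>

lemma constraint_value_positive:
  assumes C: "is_constraint C" and adm: "admissible C {0..1}"
    and supp: "\<And>i. i \<notin> insert 0 (dom C) \<Longrightarrow> coeff P i = 0" and P0: "P \<noteq> 0"
    and nn: "\<And>x. x \<in> {0..1} \<Longrightarrow> 0 \<le> poly P x"
  shows "0 < moment_functional (constraint_value C) P"
proof -
  define n where "n = last_index C"
  obtain \<mu> where \<mu>: "\<mu> \<in> constrained_measures C {0..1}"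
    and int: "moment_vector n \<mu> \<in> product_topology (\<lambda>_. euclideanreal) {1..n} interior_of moment_space n {0..1}"
    using adm by (auto simp: admissible_def constrained_moment_space_def n_def)
  have \<mu>m: "\<mu> \<in> moment_measures {0..1}" using \<mu> by (simp add: constrained_measures_def)
  have deg: "degree P \<le> n"
  proof (rule degree_le, intro allI impI)
    fix i assume "n < i"
    then have "i \<notin> insert 0 (dom C)" using last_index_ge[OF C, of i] by (auto simp: n_def)
    then show "coeff P i = 0" by (rule supp)
  qed
  let ?m = "\<lambda>i. moment i \<mu>"
  have eq: "moment_functional (constraint_value C) P = moment_functional ?m P"
    by (rule moment_functional_cong_support) (use supp constraint_value_moment[OF C \<mu>] in blast)
  have rep: "representable n ?m" using \<mu>m by (auto simp: representable_def)
  have "moment_functional ?m P \<noteq> 0"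
  proof
    assume zero: "moment_functional ?m P = 0"
    obtain T where T: "openin (product_topology (\<lambda>_. euclideanreal) {1..n}) T" "moment_vector n \<mu> \<in> T"
      "T \<subseteq> moment_space n {0..1}"
      using int by (auto simp: interior_of_def)
    define v where "v k = restrict (\<lambda>j. ?m j - inverse (real (Suc k)) * coeff P j) {1..n}" for k
    have "limitin (product_topology (\<lambda>_. euclideanreal) {1..n}) v (moment_vector n \<mu>) sequentially"
      unfolding limitin_componentwise
    proof (intro conjI ballI)
      fix i assume i: "i \<in> {1..n}"
      have "(\<lambda>k. ?m i - inverse (real (Suc k)) * coeff P i) \<longlonglongrightarrow> ?m i - 0 * coeff P i"
        by (intro tendsto_intros LIMSEQ_inverse_real_of_nat)
      then show "limitin euclideanreal (\<lambda>k. v k i) (moment_vector n \<mu> i) sequentially"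
        using i by (simp add: v_def moment_vector_def)
    qed (auto simp: moment_vector_def v_def)
    then have "\<forall>\<^sub>F k in sequentially. v k \<in> T" using T(1,2) by (auto simp: limitin_def)
    then obtain k where "v k \<in> T" by (auto simp: eventually_sequentially)
    then obtain \<nu> where \<nu>: "\<nu> \<in> moment_measures {0..1}" "v k = moment_vector n \<nu>"
      using T(3) by (auto simp: moment_space_def)
    define t where "t = inverse (real (Suc k))"
    have t: "t > 0" by (simp add: t_def)
    have \<nu>j: "moment j \<nu> = ?m j - t * coeff P j" if "j \<in> {1..n}" for j
      using fun_cong[OF \<nu>(2), of j] that by (simp add: v_def moment_vector_def t_def)
    have "0 \<le> moment_functional (\<lambda>i. moment i \<nu>) P"
      using \<nu>(1) by (intro representable_nonneg[OF _ deg nn]) (auto simp: representable_def)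
    \<comment> \<open>Both measures have moment 1 at index 0, so this index contributes no square; a
      constant \<open>P\<close> is treated at the end, where its value is its coefficient.\<close>
    also have "\<dots> = (\<Sum>j\<le>n. coeff P j * ?m j - (if j = 0 then 0 else t * (coeff P j)\<^sup>2))"
      unfolding moment_functional_eq_sum[OF deg]
    proof (rule sum.cong)
      fix j assume "j \<in> {..n}"
      then show "coeff P j * moment j \<nu> = coeff P j * ?m j - (if j = 0 then 0 else t * (coeff P j)\<^sup>2)"
        using \<nu>j[of j] moment_0[OF \<nu>(1)] moment_0[OF \<mu>m]
        by (cases "j = 0") (auto simp: power2_eq_square right_diff_distrib mult.left_commute)
    qed simp
    also have "\<dots> = - (\<Sum>j\<le>n. if j = 0 then 0 else t * (coeff P j)\<^sup>2)"
      using zero by (simp add: sum_subtractf moment_functional_eq_sum[OF deg])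
    finally have sum_le: "(\<Sum>j\<le>n. if j = 0 then 0 else t * (coeff P j)\<^sup>2) \<le> 0" by simp
    have nonneg: "0 \<le> (if j = 0 then 0 else t * (coeff P j)\<^sup>2)" for j using t by simp
    have "0 \<le> (\<Sum>j\<le>n. if j = 0 then 0 else t * (coeff P j)\<^sup>2)"
      by (rule sum_nonneg) (rule nonneg)
    with sum_le have sum0: "(\<Sum>j\<le>n. if j = 0 then 0 else t * (coeff P j)\<^sup>2) = 0"
      by (rule antisym)
    have "coeff P j = 0" if "j \<noteq> 0" for j
    proof (cases "j \<le> n")
      case True
      then have "(if j = 0 then 0 else t * (coeff P j)\<^sup>2) = 0"
        by (intro sum_nonneg_0[OF _ nonneg sum0]) auto
      then show ?thesis using that t by simp
    next
      case False
      then show ?thesis using deg by (intro coeff_eq_0) simp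
    qed
    then have "P = [:coeff P 0:]" by (intro poly_eqI) (simp add: coeff_pCons split: nat.split)
    moreover from this have "coeff P 0 = 0"
      using zero moment_0[OF \<mu>m] by (metis moment_functional_const mult.right_neutral)
    ultimately show False using P0 by simp
  qed
  moreover have "0 \<le> moment_functional ?m P" by (rule representable_nonneg[OF rep deg nn])
  ultimately show ?thesis unfolding eq by simp
qed

lemma exists_constrained_density:
  assumes C: "is_constraint C" and adm: "admissible C {0..1}"
  obtains q where "\<And>i. i \<notin> insert 0 (dom C) \<Longrightarrow> coeff q i = 0" "\<And>x. x \<in> {0..1} \<Longrightarrow> 0 < poly q x"
    "\<And>i. i \<in> insert 0 (dom C) \<Longrightarrow> (\<integral>x. x ^ i / poly q x \<partial>arcsine) = constraint_value C i"
proof (rule exists_density_poly[of "insert 0 (dom C)" "constraint_value C"])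
  show "constraint_value C 0 = 1"
    using C by (auto simp: constraint_value_def is_constraint_def domIff)
qed (use C constraint_value_positive[OF C adm] that in \<open>auto simp: is_constraint_def\<close>)

lemma complete_moments_0: "is_constraint C \<Longrightarrow> complete_moments C n x 0 = 1"
  by (auto simp: complete_moments_def free_indices_def constraint_value_def is_constraint_def domIff)

lemma complete_moments_constrained:
  "i \<in> insert 0 (dom C) \<Longrightarrow> complete_moments C n x i = constraint_value C i"
  by (auto simp: complete_moments_def free_indices_def)

text \<open>All constrained indices are at most \<open>n\<close>, so filling in the constraint
  recovers every moment up to order \<open>n\<close>; membership becomes representability of the
  completed sequence.\<close>

lemma free_moment_space_iff:
  assumes C: "is_constraint C" and n: "last_index C \<le> n"
  shows "x \<in> free_moment_space C n \<longleftrightarrow>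
    x \<in> extensional (free_indices C n) \<and> representable n (complete_moments C n x)"
proof
  assume "x \<in> free_moment_space C n"
  then obtain \<mu> where \<mu>: "\<mu> \<in> constrained_measures C {0..1}"
    and x: "x = restrict (moment_vector n \<mu>) (free_indices C n)"
    by (auto simp: free_moment_space_def constrained_moment_space_def)
  have "complete_moments C n x i = moment i \<mu>" if "i \<le> n" for i
  proof (cases "i \<in> free_indices C n")
    case True
    then show ?thesis by (simp add: complete_moments_def x moment_vector_def free_indices_def)
  next
    case False
    then have "i \<in> insert 0 (dom C)" using that by (auto simp: free_indices_def)
    then show ?thesis using constraint_value_moment[OF C \<mu>] False by (simp add: complete_moments_def)
  qed
  then show "x \<in> extensional (free_indices C n) \<and> representable n (complete_moments C n x)"
    using \<mu> unfolding representable_def constrained_measures_def by (auto simp: x)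
next
  assume x: "x \<in> extensional (free_indices C n) \<and> representable n (complete_moments C n x)"
  then obtain \<mu> where \<mu>: "\<mu> \<in> moment_measures {0..1}" "\<forall>i\<le>n. complete_moments C n x i = moment i \<mu>"
    by (auto simp: representable_def)
  have "moment i \<mu> = c" if "C i = Some c" for i c
  proof -
    have "i \<in> dom C" using that by auto
    then show ?thesis
      using \<mu>(2) last_index_ge[OF C, of i] n that complete_moments_constrained[of i C n x]
      by (auto simp: constraint_value_def)
  qed
  then have "\<mu> \<in> constrained_measures C {0..1}" using \<mu>(1) by (simp add: constrained_measures_def)
  moreover have "x = restrict (moment_vector n \<mu>) (free_indices C n)"
  proof (rule extensionalityI[of _ "free_indices C n"])
    fix i assume i: "i \<in> free_indices C n"
    then have "i \<le> n" "i \<in> {1..n}" by (auto simp: free_indices_def)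
    then show "x i = restrict (moment_vector n \<mu>) (free_indices C n) i"
      using \<mu>(2) i by (auto simp: complete_moments_def moment_vector_def)
  qed (use x in auto)
  ultimately show "x \<in> free_moment_space C n"
    by (auto simp: free_moment_space_def constrained_moment_space_def)
qed

section \<open>Lebesgue measure on the free coordinates\<close>

abbreviation free_space :: "(nat \<rightharpoonup> real) \<Rightarrow> nat \<Rightarrow> (nat \<Rightarrow> real) measure" where
  "free_space C n \<equiv> \<Pi>\<^sub>M i\<in>free_indices C n. lborel"

lemma finite_free_indices [simp]: "finite (free_indices C n)"
  by (simp add: free_indices_def)

lemma measurable_complete_moments [measurable]:
  "complete_moments C n \<in> free_space C n \<rightarrow>\<^sub>M sequence_space"
proof (rule measurable_PiM_single')
  fix i
  show "(\<lambda>x. complete_moments C n x i) \<in> borel_measurable (free_space C n)"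
  proof (cases "i \<in> free_indices C n")
    case True
    then show ?thesis by (simp add: complete_moments_def)
  qed (simp add: complete_moments_def)
qed auto

lemma free_indices_Suc:
  assumes "is_constraint C" "last_index C \<le> n"
  shows "free_indices C (Suc n) = insert (Suc n) (free_indices C n)" "Suc n \<notin> free_indices C n"
  using last_index_ge[OF assms(1), of "Suc n"] assms(2) by (auto simp: free_indices_def)

lemma complete_moments_upd:
  assumes "is_constraint C" "last_index C \<le> n"
  shows "complete_moments C (Suc n) (x(Suc n := t)) = (complete_moments C n x)(Suc n := t)"
  unfolding complete_moments_def free_indices_Suc(1)[OF assms]
  using free_indices_Suc(2)[OF assms] by (auto simp: fun_eq_iff)

text \<open>Tonelli from the top coordinate downwards: each coordinate above \<open>n\<close> is
  free, and integrating it out raises the first argument of \<open>tail_volume\<close> by one. For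
  \<open>j = 0\<close> the volume is the indicator of the moment space, which is the form in which
  it is applied; general \<open>j\<close> carries the induction.\<close>

lemma nn_integral_free_space:
  assumes C: "is_constraint C" and n: "last_index C \<le> n" and E [measurable]: "E \<in> sets sequence_space"
    and loc: "\<And>m m'. (\<And>i. i \<le> n \<Longrightarrow> m i = m' i) \<Longrightarrow> m \<in> E \<longleftrightarrow> m' \<in> E"
  shows "(\<integral>\<^sup>+x. tail_volume j (n + k) (complete_moments C (n + k) x) *
      indicator E (complete_moments C (n + k) x) \<partial>free_space C (n + k)) =
    (\<integral>\<^sup>+x. tail_volume (k + j) n (complete_moments C n x) * indicator E (complete_moments C n x) \<partial>free_space C n)"
proof (induction k arbitrary: j)
  case (Suc k)
  interpret product_sigma_finite "\<lambda>_::nat. lborel :: real measure" by standard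
  let ?N = "n + k"
  let ?f = "\<lambda>x. tail_volume j (Suc ?N) (complete_moments C (Suc ?N) x) * indicator E (complete_moments C (Suc ?N) x)"
  have N: "last_index C \<le> ?N" using n by simp
  have f: "?f \<in> borel_measurable (free_space C (Suc ?N))" by measurable
  have "(\<integral>\<^sup>+x. ?f x \<partial>free_space C (Suc ?N)) = (\<integral>\<^sup>+x. (\<integral>\<^sup>+t. ?f (x(Suc ?N := t)) \<partial>lborel) \<partial>free_space C ?N)"
    unfolding free_indices_Suc(1)[OF C N]
    by (rule product_nn_integral_insert[OF finite_free_indices free_indices_Suc(2)[OF C N]
          f[unfolded free_indices_Suc(1)[OF C N]]])
  also have "\<dots> = (\<integral>\<^sup>+x. tail_volume (Suc j) ?N (complete_moments C ?N x) * indicator E (complete_moments C ?N x) \<partial>free_space C ?N)"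
  proof (rule nn_integral_cong)
    fix x
    let ?m = "complete_moments C ?N x"
    have "?m(Suc ?N := t) \<in> E \<longleftrightarrow> ?m \<in> E" for t by (rule loc) simp
    then have ind: "indicator E (?m(Suc ?N := t)) = (indicator E ?m :: ennreal)" for t
      by (simp add: indicator_def)
    have "(\<integral>\<^sup>+t. ?f (x(Suc ?N := t)) \<partial>lborel) = (\<integral>\<^sup>+t. tail_volume j (Suc ?N) (?m(Suc ?N := t)) * indicator E ?m \<partial>lborel)"
      unfolding complete_moments_upd[OF C N] ind ..
    also have "\<dots> = tail_volume (Suc j) ?N ?m * indicator E ?m"
      by (subst nn_integral_multc) auto
    finally show "(\<integral>\<^sup>+t. ?f (x(Suc ?N := t)) \<partial>lborel) = tail_volume (Suc j) ?N ?m * indicator E ?m" .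
  qed
  also have "\<dots> = (\<integral>\<^sup>+x. tail_volume (k + Suc j) n (complete_moments C n x) * indicator E (complete_moments C n x) \<partial>free_space C n)"
    by (rule Suc.IH)
  finally show ?case by simp
qed simp

lemma emeasure_free_cube:
  assumes "finite I" "\<And>i. i \<in> I \<Longrightarrow> a i \<le> b i"
  shows "emeasure (\<Pi>\<^sub>M i\<in>I. lborel) (\<Pi>\<^sub>E i\<in>I. {a i..b i :: real}) = ennreal (\<Prod>i\<in>I. b i - a i)"
proof -
  interpret product_sigma_finite "\<lambda>_::'a. lborel :: real measure" by standard
  have "emeasure (\<Pi>\<^sub>M i\<in>I. lborel) (\<Pi>\<^sub>E i\<in>I. {a i..b i}) = (\<Prod>i\<in>I. emeasure lborel {a i..b i})"
    by (rule emeasure_PiM) (use assms in auto)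
  also have "\<dots> = (\<Prod>i\<in>I. ennreal (b i - a i))" using assms by (intro prod.cong) auto
  also have "\<dots> = ennreal (\<Prod>i\<in>I. b i - a i)" using assms by (intro prod_ennreal) auto
  finally show ?thesis .
qed

section \<open>Deviation probabilities of the uniform distribution\<close>

lemma ennreal_inverse_antimono: "a \<le> b \<Longrightarrow> inverse b \<le> inverse a" for a b :: ennreal
proof (cases "a = 0 \<or> b = top")
  case False
  moreover assume "a \<le> b"
  ultimately obtain x y where "a = ennreal x" "b = ennreal y" "0 < x" "x \<le> y"
    by (cases a; cases b) (auto simp: top_unique)
  then show ?thesis by (simp add: inverse_ennreal ennreal_leI le_imp_inverse_le)
qed auto

lemma insert_constraint_eq:
  assumes "j \<in> {1..n}"
  shows "insert_constraint C n x j = complete_moments C n x j"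
  using assms
  by (auto simp: insert_constraint_def complete_moments_def free_indices_def constraint_value_def split: option.split)

lemma measurable_insert_constraint [measurable]:
  "insert_constraint C n \<in> free_space C n \<rightarrow>\<^sub>M (\<Pi>\<^sub>M i\<in>{1..n}. borel)"
  unfolding insert_constraint_def
proof (rule measurable_restrict)
  fix i assume "i \<in> {1..n}"
  then show "(\<lambda>m. case C i of None \<Rightarrow> m i | Some c \<Rightarrow> c) \<in> borel_measurable (free_space C n)"
    by (cases "C i") (auto simp: free_indices_def domIff)
qed

lemma sets_free_moment_space:
  assumes "is_constraint C" "last_index C \<le> n"
  shows "free_moment_space C n \<in> sets (free_space C n)"
proof -
  have "free_moment_space C n = complete_moments C n -` {m. representable n m} \<inter> space (free_space C n)"
    using free_moment_space_iff[OF assms] by (auto simp: space_PiM PiE_UNIV_domain PiE_def)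
  then show ?thesis using measurable_sets[OF measurable_complete_moments sets_representable] by simp
qed

lemma sets_deviation:
  fixes m :: "nat \<Rightarrow> real"
  assumes "l \<le> n"
  shows "{y \<in> space (\<Pi>\<^sub>M i\<in>{1..n}. borel). \<exists>j\<in>{1..l}. e \<le> \<bar>y j - m j\<bar>} \<in> sets (\<Pi>\<^sub>M i\<in>{1..n}. borel)"
    (is "?B \<in> _")
proof -
  have "?B = (\<Union>j\<in>{1..l}. {y \<in> space (\<Pi>\<^sub>M i\<in>{1..n}. borel). e \<le> \<bar>y j - m j\<bar>})" by auto
  moreover have "{y \<in> space (\<Pi>\<^sub>M i\<in>{1..n}. borel). e \<le> \<bar>y j - m j\<bar>} \<in> sets (\<Pi>\<^sub>M i\<in>{1..n}. borel)"
    if "j \<in> {1..l}" for j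
  proof -
    have [measurable]: "(\<lambda>y. y j) \<in> borel_measurable (\<Pi>\<^sub>M i\<in>{1..n}. borel :: real measure)"
      using that assms by (intro measurable_component_singleton) auto
    show ?thesis by measurable
  qed
  ultimately show ?thesis by (simp only: sets.finite_UN finite_atLeastAtMost)
qed

text \<open>The event depends on the first \<open>l\<close> moments only, so numerator and
  denominator of the uniform probability can both be integrated down to order \<open>l\<close>, with
  the same fibre volume as density.\<close>

lemma emeasure_uniform_moments_le:
  assumes C: "is_constraint C" and l: "last_index C \<le> l" "l \<le> n" and e: "0 < e"
    and E_def: "E = {s. \<exists>j\<in>{1..l}. e \<le> \<bar>s j - m j\<bar>}"
  shows "emeasure (uniform_moments C n) {y \<in> space (\<Pi>\<^sub>M i\<in>{1..n}. borel). \<exists>j\<in>{1..l}. e \<le> \<bar>y j - m j\<bar>} \<le>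
    (\<integral>\<^sup>+x. tail_volume (n - l) l (complete_moments C l x) * indicator E (complete_moments C l x) \<partial>free_space C l) /
    (\<integral>\<^sup>+x. tail_volume (n - l) l (complete_moments C l x) \<partial>free_space C l)"
proof -
  let ?M = "free_space C n" and ?F = "free_moment_space C n" and ?cm = "complete_moments C n"
  let ?B = "{y \<in> space (\<Pi>\<^sub>M i\<in>{1..n}. borel). \<exists>j\<in>{1..l}. e \<le> \<bar>y j - m j\<bar>}"
  have n: "last_index C \<le> n" using l by simp
  have [measurable]: "?F \<in> sets ?M" by (rule sets_free_moment_space[OF C n])
  have B [measurable]: "?B \<in> sets (\<Pi>\<^sub>M i\<in>{1..n}. borel)" by (rule sets_deviation[OF l(2)])
  have E [measurable]: "E \<in> sets sequence_space"
  proof -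
    have "E = (\<Union>j\<in>{1..l}. {s \<in> space sequence_space. e \<le> \<bar>s j - m j\<bar>})" by (auto simp: E_def space_PiM)
    moreover have "{s \<in> space sequence_space. e \<le> \<bar>s j - m j\<bar>} \<in> sets sequence_space" for j
    proof -
      have [measurable]: "(\<lambda>y. y j) \<in> borel_measurable sequence_space"
        by (intro measurable_component_singleton) auto
      show ?thesis by measurable
    qed
    ultimately show ?thesis by (simp only: sets.finite_UN finite_atLeastAtMost)
  qed
  let ?A = "insert_constraint C n -` ?B \<inter> space ?M"
  have A [measurable]: "?A \<in> sets ?M" by measurable
  have rep: "representable n (?cm x) \<longleftrightarrow> x \<in> ?F" if "x \<in> space ?M" for x
    using free_moment_space_iff[OF C n, of x] that by (simp add: space_PiM PiE_def)
  have "emeasure (uniform_moments C n) ?B = emeasure (uniform_measure ?M ?F) ?A"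
  proof -
    have "insert_constraint C n \<in> uniform_measure ?M ?F \<rightarrow>\<^sub>M (\<Pi>\<^sub>M i\<in>{1..n}. borel)"
      using measurable_insert_constraint by (simp add: measurable_cong_sets[OF sets_uniform_measure refl])
    then show ?thesis
      unfolding uniform_moments_def using B by (simp only: emeasure_distr space_uniform_measure)
  qed
  also have "\<dots> = emeasure ?M (?F \<inter> ?A) / emeasure ?M ?F"
    by (rule emeasure_uniform_measure) measurable
  also have "emeasure ?M ?F = (\<integral>\<^sup>+x. tail_volume (n - l) l (complete_moments C l x) \<partial>free_space C l)"
  proof -
    have "emeasure ?M ?F = (\<integral>\<^sup>+x. indicator ?F x \<partial>?M)" by simp
    also have "\<dots> = (\<integral>\<^sup>+x. tail_volume 0 n (?cm x) * indicator UNIV (?cm x) \<partial>?M)"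
      by (rule nn_integral_cong) (simp add: indicator_def rep)
    also have "\<dots> = (\<integral>\<^sup>+x. tail_volume (n - l) l (complete_moments C l x) * indicator UNIV (complete_moments C l x) \<partial>free_space C l)"
    proof -
      have "UNIV \<in> sets sequence_space" using sets.top[of sequence_space] by (simp add: space_PiM)
      from nn_integral_free_space[OF C l(1) this, where j = 0 and k = "n - l"] show ?thesis
        using l(2) by (simp only: UNIV_I le_add_diff_inverse add_0_right)
    qed
    finally show ?thesis by simp
  qed
  also have "emeasure ?M (?F \<inter> ?A) / x \<le> (\<integral>\<^sup>+x. tail_volume (n - l) l (complete_moments C l x) *
      indicator E (complete_moments C l x) \<partial>free_space C l) / x" for x
  proof (rule divide_right_mono_ennreal)
    have "emeasure ?M (?F \<inter> ?A) = (\<integral>\<^sup>+x. indicator (?F \<inter> ?A) x \<partial>?M)"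
      by (rule nn_integral_indicator[symmetric]) measurable
    also have "\<dots> \<le> (\<integral>\<^sup>+x. tail_volume 0 n (?cm x) * indicator E (?cm x) \<partial>?M)"
    proof (rule nn_integral_mono)
      fix x assume x: "x \<in> space ?M"
      show "indicator (?F \<inter> ?A) x \<le> tail_volume 0 n (?cm x) * indicator E (?cm x)"
      proof (cases "x \<in> ?F \<inter> ?A")
        case True
        then obtain j where "j \<in> {1..l}" "e \<le> \<bar>insert_constraint C n x j - m j\<bar>" by auto
        then have "?cm x \<in> E" using l(2) insert_constraint_eq[of j n C x] by (auto simp: E_def)
        then show ?thesis using True x rep by simp
      qed simp
    qed
    also have "\<dots> = (\<integral>\<^sup>+x. tail_volume (n - l) l (complete_moments C l x) *
      indicator E (complete_moments C l x) \<partial>free_space C l)"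
    proof -
      have "s \<in> E \<longleftrightarrow> s' \<in> E" if eq: "\<And>i. i \<le> l \<Longrightarrow> s i = s' i" for s s'
        unfolding E_def mem_Collect_eq by (rule bex_cong) (simp_all add: eq)
      from nn_integral_free_space[OF C l(1) E this, where j = 0 and k = "n - l"] show ?thesis
        using l(2) by (simp only: le_add_diff_inverse add_0_right)
    qed
    finally show "emeasure ?M (?F \<inter> ?A) \<le> (\<integral>\<^sup>+x. tail_volume (n - l) l (complete_moments C l x) *
      indicator E (complete_moments C l x) \<partial>free_space C l)" .
  qed
  finally show ?thesis .
qed

text \<open>With \<open>k = n - l\<close>, fibres over far slice points have volume at most
  \<open>volume_constant k * (\<rho> - \<eta>) ^ k\<close>, and those over a small cube around
  \<open>m\<close> at least \<open>volume_constant k * (\<rho> - \<eta> / 2) ^ k\<close>. The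
  constants cancel and leave a geometric bound.\<close>

lemma uniform_moments_deviation:
  assumes C: "is_constraint C" and l: "last_index C \<le> l" and e: "0 < e"
    and supp: "\<And>i. i \<notin> insert 0 (dom C) \<Longrightarrow> coeff q i = 0"
    and q_pos: "\<And>x. x \<in> {0..1} \<Longrightarrow> 0 < poly q x"
    and m_eq: "\<And>i. m i = (\<integral>x. x ^ i / poly q x \<partial>arcsine)"
    and m_con: "\<And>i. i \<in> insert 0 (dom C) \<Longrightarrow> m i = constraint_value C i"
  obtains B \<theta> where "0 \<le> B" "0 \<le> \<theta>" "\<theta> < 1"
    "\<And>n. l \<le> n \<Longrightarrow> emeasure (uniform_moments C n)
      {y \<in> space (\<Pi>\<^sub>M i\<in>{1..n}. borel). \<exists>j\<in>{1..l}. e \<le> \<bar>y j - m j\<bar>} \<le> ennreal (B * \<theta> ^ (n - l))"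
proof -
  let ?J = "free_indices C l" and ?cm = "complete_moments C l"
  have q_deg: "degree q \<le> l"
  proof (rule degree_le, intro allI impI)
    fix i assume "l < i"
    then have "i \<notin> insert 0 (dom C)" using last_index_ge[OF C, of i] l by auto
    then show "coeff q i = 0" by (rule supp)
  qed
  have m0: "m 0 = 1" using m_con[of 0] complete_moments_0[OF C] complete_moments_constrained[of 0 C] by simp
  have sp: "strictly_positive l m" by (rule strictly_positive_arcsine[OF q_pos m_eq])
  obtain p r where mp: "monic_pair l p r" and o: "orthogonal_pair l m p r"
    using exists_orthogonal_pair[OF sp] by blast
  define \<rho> where "\<rho> = moment_functional m (gap_poly l p r)"
  have gap: "gap_poly l p r = smult \<rho> q"
    unfolding \<rho>_def by (rule gap_poly_eq_smult[OF sp o mp q_deg q_pos m_eq])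
  have \<rho>: "0 < \<rho>" unfolding \<rho>_def by (rule moment_functional_gap_pos[OF sp mp])
  \<comment> \<open>Only constrained powers occur in \<open>q\<close>, so its mean is the same at
    every completed point.\<close>
  have slice: "moment_functional (?cm x) q = 1" for x
  proof -
    have "moment_functional (?cm x) q = moment_functional m q"
      by (rule moment_functional_cong_support) (use supp m_con complete_moments_constrained in metis)
    then show ?thesis using moment_functional_self[OF q_pos m_eq q_deg] by simp
  qed
  obtain \<eta>0 where \<eta>0: "0 < \<eta>0" "\<And>m' j. representable l m' \<Longrightarrow> moment_functional m' q = 1 \<Longrightarrow> j \<le> l \<Longrightarrow>
      e \<le> \<bar>m' j - m j\<bar> \<Longrightarrow> \<exists>p' r'. monic_pair l p' r' \<and> moment_functional m' (gap_poly l p' r') \<le> \<rho> - \<eta>0"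
  proof (rule gap_bound_far[OF q_deg q_pos m_eq m0 mp o gap \<rho> e])
    fix \<eta>
    assume "0 < \<eta>" and "\<And>m' j. representable l m' \<Longrightarrow> moment_functional m' q = 1 \<Longrightarrow> j \<le> l \<Longrightarrow>
      e \<le> \<bar>m' j - m j\<bar> \<Longrightarrow> \<exists>p' r'. monic_pair l p' r' \<and> moment_functional m' (gap_poly l p' r') \<le> \<rho> - \<eta>"
    then show thesis by (rule that)
  qed
  \<comment> \<open>The cap \<open>\<rho> / 2\<close> keeps the base \<open>\<rho> - \<eta>\<close>
    of the upper bound nonnegative.\<close>
  define \<eta> where "\<eta> = min \<eta>0 (\<rho> / 2)"
  have \<eta>: "0 < \<eta>" "\<eta> \<le> \<eta>0" "\<eta> \<le> \<rho> / 2" using \<eta>0(1) \<rho> by (auto simp: \<eta>_def)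
  obtain d where d: "0 < d" "\<And>m'. (\<And>i. i \<le> l \<Longrightarrow> \<bar>m' i - m i\<bar> \<le> d) \<Longrightarrow> strictly_positive l m'"
    by (rule strictly_positive_perturb[OF sp m0]) blast
  \<comment> \<open>The mixing weight that spends half of the gain \<open>\<eta>\<close>.\<close>
  define \<epsilon> where "\<epsilon> = \<eta> / (2 * \<rho>)"
  have \<epsilon>: "0 < \<epsilon>" "\<epsilon> < 1" "(1 - \<epsilon>) * \<rho> = \<rho> - \<eta> / 2" using \<eta> \<rho> by (auto simp: \<epsilon>_def field_simps)
  \<comment> \<open>A point within \<open>\<epsilon> * d\<close> of \<open>m\<close> is a mixture of
    \<open>m\<close>, with weight \<open>1 - \<epsilon>\<close>, and a point within \<open>d\<close>
    of \<open>m\<close>, which is still strictly positive.\<close>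
  define \<delta> where "\<delta> = \<epsilon> * d"
  have \<delta>: "0 < \<delta>" using \<epsilon> d by (simp add: \<delta>_def)
  define E where "E = {s :: nat \<Rightarrow> real. \<exists>j\<in>{1..l}. e \<le> \<bar>s j - m j\<bar>}"
  define a where "a = \<rho> - \<eta>"
  define b where "b = (1 - \<epsilon>) * \<rho>"
  have ab: "0 \<le> a" "a < b" using \<eta> \<rho> by (auto simp: a_def b_def \<epsilon>(3))
  define D where "D = (\<Prod>i\<in>?J. 2 * \<delta>)"
  have D: "0 < D" unfolding D_def using \<delta> by (intro prod_pos) auto
  have space: "x \<in> extensional ?J" if "x \<in> space (free_space C l)" for x
    using that by (simp add: space_PiM PiE_def)
  have num: "(\<integral>\<^sup>+x. tail_volume k l (?cm x) * indicator E (?cm x) \<partial>free_space C l) \<le> volume_constant k * ennreal (a ^ k)" for k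
  proof -
    have "(\<integral>\<^sup>+x. tail_volume k l (?cm x) * indicator E (?cm x) \<partial>free_space C l) \<le>
        (\<integral>\<^sup>+x. volume_constant k * ennreal (a ^ k) * indicator (\<Pi>\<^sub>E i\<in>?J. {0..1}) x \<partial>free_space C l)"
    proof (rule nn_integral_mono)
      fix x assume x: "x \<in> space (free_space C l)"
      show "tail_volume k l (?cm x) * indicator E (?cm x) \<le>
        volume_constant k * ennreal (a ^ k) * indicator (\<Pi>\<^sub>E i\<in>?J. {0..1}) x"
      proof (cases "representable l (?cm x) \<and> ?cm x \<in> E")
        case True
        then have rep: "representable l (?cm x)" by simp
        have "x i \<in> {0..1}" if "i \<in> ?J" for i
          using representable_bounds[OF rep, of i] that by (auto simp: complete_moments_def free_indices_def)
        then have cube: "x \<in> (\<Pi>\<^sub>E i\<in>?J. {0..1})" using space[OF x] by (auto simp: PiE_def)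
        obtain j where "j \<le> l" "e \<le> \<bar>?cm x j - m j\<bar>" using True by (auto simp: E_def)
        then obtain p' r' where mp': "monic_pair l p' r'"
          and le: "moment_functional (?cm x) (gap_poly l p' r') \<le> \<rho> - \<eta>0"
          using \<eta>0(2)[OF rep slice] by blast
        have "0 \<le> moment_functional (?cm x) (gap_poly l p' r')"
          by (rule representable_nonneg[OF rep degree_gap_poly[OF mp']])
            (simp add: gap_poly_def lower_poly_nonneg upper_poly_nonneg)
        then have "moment_functional (?cm x) (gap_poly l p' r') ^ k \<le> a ^ k"
          using le \<eta>(2) by (intro power_mono) (auto simp: a_def)
        then have "tail_volume k l (?cm x) \<le> volume_constant k * ennreal (a ^ k)"
          using tail_volume_upper[OF rep mp', of k]
          by (meson ennreal_leI mult_left_mono order_trans zero_le)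
        then show ?thesis using True cube by simp
      next
        case False
        then show ?thesis by (auto simp: tail_volume_eq_0)
      qed
    qed
    also have "\<dots> = volume_constant k * ennreal (a ^ k) * emeasure (free_space C l) (\<Pi>\<^sub>E i\<in>?J. {0..1})"
      by (rule nn_integral_cmult_indicator) (auto intro: sets_PiM_I_finite)
    also have "emeasure (free_space C l) (\<Pi>\<^sub>E i\<in>?J. {0..1}) = 1"
      by (subst emeasure_free_cube) auto
    finally show ?thesis by simp
  qed
  have den: "volume_constant k * ennreal (b ^ k) * ennreal D \<le> (\<integral>\<^sup>+x. tail_volume k l (?cm x) \<partial>free_space C l)" for k
  proof -
    let ?Q = "\<Pi>\<^sub>E i\<in>?J. {m i - \<delta>..m i + \<delta>}"
    have "emeasure (free_space C l) ?Q = ennreal D"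
      using \<delta> by (subst emeasure_free_cube) (auto simp: D_def)
    then have "volume_constant k * ennreal (b ^ k) * ennreal D =
        volume_constant k * ennreal (b ^ k) * emeasure (free_space C l) ?Q" by simp
    also have "\<dots> = (\<integral>\<^sup>+x. volume_constant k * ennreal (b ^ k) * indicator ?Q x \<partial>free_space C l)"
      by (rule nn_integral_cmult_indicator[symmetric]) (auto intro: sets_PiM_I_finite)
    also have "\<dots> \<le> (\<integral>\<^sup>+x. tail_volume k l (?cm x) \<partial>free_space C l)"
    proof (rule nn_integral_mono)
      fix x
      show "volume_constant k * ennreal (b ^ k) * indicator ?Q x \<le> tail_volume k l (?cm x)"
      proof (cases "x \<in> ?Q")
        case True
        define m' where "m' i = m i + (?cm x i - m i) / \<epsilon>" for i
        have "\<bar>m' i - m i\<bar> \<le> d" if "i \<le> l" for i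
        proof (cases "i \<in> ?J")
          case True
          then have "\<bar>?cm x i - m i\<bar> \<le> \<epsilon> * d"
            using \<open>x \<in> ?Q\<close> by (force simp: complete_moments_def \<delta>_def[symmetric] PiE_def Pi_def)
          then show ?thesis using \<epsilon>(1) by (simp add: m'_def field_simps)
        next
          case False
          then have "i \<in> insert 0 (dom C)" using that by (auto simp: free_indices_def)
          then have "?cm x i = m i" using m_con complete_moments_constrained by metis
          then show ?thesis using d(1) by (simp add: m'_def)
        qed
        then have "strictly_positive l m'" by (rule d(2))
        moreover have "m' 0 = 1" using m0 complete_moments_0[OF C] by (simp add: m'_def)
        \<comment> \<open>The moments of \<open>\<nu>\<close> extend \<open>m'\<close> to a sequence
          that is representable at every order, as the convexity bound requires.\<close>
        ultimately obtain \<nu> where \<nu>: "\<nu> \<in> moment_measures {0..1}" "\<And>i. i \<le> l \<Longrightarrow> m' i = moment i \<nu>"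
          using representable_if_strictly_positive[of l m'] by (auto simp: representable_def)
        have "b ^ k = (1 - \<epsilon>) ^ k * \<rho> ^ k" by (simp add: b_def power_mult_distrib)
        then have "volume_constant k * ennreal (b ^ k) = ennreal ((1 - \<epsilon>) ^ k) * (volume_constant k * ennreal (\<rho> ^ k))"
          using \<epsilon> \<rho> by (simp add: ennreal_mult mult_ac)
        also have "\<dots> \<le> ennreal ((1 - \<epsilon>) ^ k) * tail_volume k l m"
          unfolding \<rho>_def by (intro mult_left_mono tail_volume_lower[OF sp m0 o mp]) simp
        also have "\<dots> \<le> tail_volume k l (\<lambda>i. (1 - \<epsilon>) * m i + \<epsilon> * moment i \<nu>)"
          using \<epsilon> \<nu>(1) by (intro tail_volume_convex) (auto simp: representable_def)
        also have "\<dots> = tail_volume k l (?cm x)"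
        proof (rule tail_volume_cong)
          fix i assume "i \<le> l"
          then have "moment i \<nu> = m i + (?cm x i - m i) / \<epsilon>" using \<nu>(2) by (simp add: m'_def)
          then show "(1 - \<epsilon>) * m i + \<epsilon> * moment i \<nu> = ?cm x i"
            using \<epsilon>(1) by (simp add: field_simps)
        qed
        finally show ?thesis using True by simp
      qed simp
    qed
    finally show ?thesis .
  qed
  show ?thesis
  proof (rule that[of "1 / D" "a / b"])
    show "0 \<le> 1 / D" "0 \<le> a / b" "a / b < 1" using D ab by auto
    fix n assume n: "l \<le> n"
    let ?k = "n - l"
    obtain c where c: "volume_constant ?k = ennreal c" "0 < c"
      using volume_constant_pos[of ?k] volume_constant_less_top[of ?k]
      by (cases "volume_constant ?k") auto
    have b0: "0 < b" using ab by simp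
    have "emeasure (uniform_moments C n)
        {y \<in> space (\<Pi>\<^sub>M i\<in>{1..n}. borel). \<exists>j\<in>{1..l}. e \<le> \<bar>y j - m j\<bar>} \<le>
      (\<integral>\<^sup>+x. tail_volume ?k l (?cm x) * indicator E (?cm x) \<partial>free_space C l) /
      (\<integral>\<^sup>+x. tail_volume ?k l (?cm x) \<partial>free_space C l)"
      by (rule emeasure_uniform_moments_le[OF C l n e E_def])
    also have "\<dots> \<le> ennreal (c * a ^ ?k) / ennreal (c * b ^ ?k * D)"
    proof -
      have 1: "(\<integral>\<^sup>+x. tail_volume ?k l (?cm x) * indicator E (?cm x) \<partial>free_space C l) \<le> ennreal (c * a ^ ?k)"
        using num[of ?k] c ab by (simp add: ennreal_mult)
      have 2: "ennreal (c * b ^ ?k * D) \<le> (\<integral>\<^sup>+x. tail_volume ?k l (?cm x) \<partial>free_space C l)"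
        using den[of ?k] c ab D by (simp add: ennreal_mult)
      show ?thesis
        unfolding divide_ennreal_def using 1 2 by (intro mult_mono) (auto simp: ennreal_inverse_antimono)
    qed
    also have "\<dots> = ennreal (c * a ^ ?k / (c * b ^ ?k * D))"
      using c ab b0 D by (intro divide_ennreal) auto
    also have "c * a ^ ?k / (c * b ^ ?k * D) = 1 / D * (a / b) ^ ?k"
      using c by (simp add: power_divide)
    finally show "emeasure (uniform_moments C n)
        {y \<in> space (\<Pi>\<^sub>M i\<in>{1..n}. borel). \<exists>j\<in>{1..l}. e \<le> \<bar>y j - m j\<bar>} \<le> ennreal (1 / D * (a / b) ^ ?k)" .
  qed
qed

theorem theorem2p1:
  fixes C :: "nat \<rightharpoonup> real" and P :: "'w measure"
    and X :: "nat \<Rightarrow> 'w \<Rightarrow> (nat \<Rightarrow> real)" and N :: nat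
  assumes "is_constraint C" and "admissible C {0..1}"
    and "prob_space P"
    and "last_index C \<le> N"
    and "\<And>n. N \<le> n \<Longrightarrow> X n \<in> P \<rightarrow>\<^sub>M (\<Pi>\<^sub>M i\<in>{1..n}. borel)"
    and "\<And>n. N \<le> n \<Longrightarrow> distr P (\<Pi>\<^sub>M i\<in>{1..n}. borel) (X n) = uniform_moments C n"
  shows "\<exists>\<mu> \<in> moment_measures {0..1}.
    (\<forall>l. AE \<omega> in P. limitin (product_topology (\<lambda>_. euclideanreal) {1..l})
       (\<lambda>n. restrict (X n \<omega>) {1..l}) (moment_vector l \<mu>) sequentially) \<and>
    (\<exists>S :: real poly. degree S \<le> last_index C \<and> (\<forall>x\<in>{0..1}. 0 < poly S x) \<and>
       \<mu> = density lborel
         (\<lambda>x. ennreal (indicat_real {0..1} x / (poly S x * sqrt (x * (1 - x)))))) \<and>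
    (\<forall>\<nu>. is_arg_min (kullback_leibler arcsine) (\<lambda>\<nu>. \<nu> \<in> constrained_measures C {0..1}) \<nu>
       \<longleftrightarrow> \<nu> = \<mu>)"
proof -
  note C = assms(1)
  obtain q where supp: "\<And>i. i \<notin> insert 0 (dom C) \<Longrightarrow> coeff q i = 0"
    and q_pos: "\<And>x. x \<in> {0..1} \<Longrightarrow> 0 < poly q x"
    and val: "\<And>i. i \<in> insert 0 (dom C) \<Longrightarrow> (\<integral>x. x ^ i / poly q x \<partial>arcsine) = constraint_value C i"
    by (rule exists_constrained_density[OF assms(1,2)]) blast
  have C0: "constraint_value C 0 = 1"
    using complete_moments_0[OF C] complete_moments_constrained[of 0 C] by simp
  have mean: "(\<integral>x. 1 / poly q x \<partial>arcsine) = 1" using val[of 0] C0 by simp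
  define \<mu> where "\<mu> = tilted_arcsine q"
  define m where "m i = moment i \<mu>" for i
  have m_eq: "m i = (\<integral>x. x ^ i / poly q x \<partial>arcsine)" for i
    unfolding m_def \<mu>_def by (rule moment_tilted_arcsine[OF q_pos mean])
  have m_con: "m i = constraint_value C i" if "i \<in> insert 0 (dom C)" for i
    using val[OF that] by (simp add: m_eq)
  have \<mu>: "\<mu> \<in> moment_measures {0..1}"
    unfolding \<mu>_def by (rule tilted_arcsine_moment_measure[OF q_pos mean])
  have q_deg: "degree q \<le> last_index C"
  proof (rule degree_le, intro allI impI)
    fix i assume "last_index C < i"
    then have "i \<notin> insert 0 (dom C)" using last_index_ge[OF C, of i] by auto
    then show "coeff q i = 0" by (rule supp)
  qed
  have conv: "AE \<omega> in P. limitin (product_topology (\<lambda>_. euclideanreal) {1..l})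
      (\<lambda>n. restrict (X n \<omega>) {1..l}) (moment_vector l \<mu>) sequentially" for l
  proof -
    interpret prob_space P by (rule assms(3))
    \<comment> \<open>The deviation bound is available only when all constrained indices are among
      the coordinates considered.\<close>
    define l' where "l' = max l (last_index C)"
    have l': "last_index C \<le> l'" "l \<le> l'" by (simp_all add: l'_def)
    have "AE \<omega> in P. \<forall>\<^sub>F n in sequentially. \<forall>j\<in>{1..l'}. \<bar>X n \<omega> j - m j\<bar> < e" if e: "0 < e" for e
    proof -
      obtain B \<theta> where B: "0 \<le> B" "0 \<le> \<theta>" "\<theta> < 1"
        "\<And>n. l' \<le> n \<Longrightarrow> emeasure (uniform_moments C n)
          {y \<in> space (\<Pi>\<^sub>M i\<in>{1..n}. borel). \<exists>j\<in>{1..l'}. e \<le> \<bar>y j - m j\<bar>} \<le> ennreal (B * \<theta> ^ (n - l'))"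
      proof (rule uniform_moments_deviation[OF C l'(1) e supp q_pos m_eq m_con])
        fix B \<theta>
        assume "0 \<le> B" "0 \<le> \<theta>" "\<theta> < 1" and "\<And>n. l' \<le> n \<Longrightarrow> emeasure (uniform_moments C n)
          {y \<in> space (\<Pi>\<^sub>M i\<in>{1..n}. borel). \<exists>j\<in>{1..l'}. e \<le> \<bar>y j - m j\<bar>} \<le> ennreal (B * \<theta> ^ (n - l'))"
        then show thesis by (rule that)
      qed
      let ?D = "\<lambda>n. {y \<in> space (\<Pi>\<^sub>M i\<in>{1..n}. borel :: real measure). \<exists>j\<in>{1..l'}. e \<le> \<bar>y j - m j\<bar>}"
      \<comment> \<open>Below \<open>N\<close> the law of \<open>X n\<close> is unspecified, and
        below \<open>l'\<close> there is no bound; the shift by \<open>K\<close> skips both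
        ranges.\<close>
      define K where "K = max N l'"
      define A where "A n = X (n + K) -` ?D (n + K) \<inter> space P" for n
      have D: "?D (n + K) \<in> sets (\<Pi>\<^sub>M i\<in>{1..n + K}. borel)" for n
        by (rule sets_deviation) (simp add: K_def)
      have meas: "A n \<in> sets P" for n
        unfolding A_def using assms(5)[of "n + K"] D[of n] by (intro measurable_sets) (auto simp: K_def)
      have le: "emeasure P (A n) \<le> ennreal (B * \<theta> ^ (n + K - l'))" for n
      proof -
        have "emeasure P (A n) = emeasure (distr P (\<Pi>\<^sub>M i\<in>{1..n + K}. borel) (X (n + K))) (?D (n + K))"
          unfolding A_def using assms(5)[of "n + K"] D[of n] by (subst emeasure_distr) (auto simp: K_def)
        also have "\<dots> = emeasure (uniform_moments C (n + K)) (?D (n + K))"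
          using assms(6)[of "n + K"] by (simp add: K_def)
        also have "\<dots> \<le> ennreal (B * \<theta> ^ (n + K - l'))" by (rule B(4)) (simp add: K_def)
        finally show ?thesis .
      qed
      \<comment> \<open>The first Borel--Cantelli lemma asks for summability only, so the marginal
        laws suffice.\<close>
      have "AE \<omega> in P. \<forall>\<^sub>F n in sequentially. \<omega> \<in> space P - A n"
      proof (rule borel_cantelli_AE1[OF meas])
        show "emeasure P (A n) < \<infinity>" for n
          using emeasure_finite[of "A n"] by (simp add: less_top[symmetric])
        show "summable (\<lambda>n. measure P (A n))"
        proof (rule summable_comparison_test'[where N = 0])
          show "summable (\<lambda>n. B * \<theta> ^ n)"
            using B(2,3) by (intro summable_mult summable_geometric) simp
          fix n :: nat
          have "measure P (A n) \<le> B * \<theta> ^ (n + K - l')"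
            using le[of n] B(1,2) by (simp add: emeasure_eq_measure)
          also have "\<dots> \<le> B * \<theta> ^ n"
            using B by (intro mult_left_mono power_decreasing) (auto simp: K_def)
          finally show "norm (measure P (A n)) \<le> B * \<theta> ^ n" by simp
        qed
      qed
      then show ?thesis
      proof eventually_elim
        case (elim \<omega>)
        then obtain n0 where n0: "\<And>n. n0 \<le> n \<Longrightarrow> \<omega> \<in> space P - A n"
          by (auto simp: eventually_sequentially)
        have "\<forall>j\<in>{1..l'}. \<bar>X n \<omega> j - m j\<bar> < e" if n: "n0 + K \<le> n" for n
        proof -
          have \<omega>: "\<omega> \<in> space P" "\<omega> \<notin> A (n - K)" using n0[of "n - K"] n by auto
          have nK: "n - K + K = n" using n by simp
          have "X n \<omega> \<in> space (\<Pi>\<^sub>M i\<in>{1..n}. borel)"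
            by (rule measurable_space[OF assms(5) \<omega>(1)]) (use n in \<open>simp add: K_def\<close>)
          moreover have "X n \<omega> \<notin> ?D n" using \<omega> unfolding A_def nK by blast
          ultimately show ?thesis by (metis (no_types, lifting) mem_Collect_eq not_le)
        qed
        then show ?case by (auto simp: eventually_sequentially)
      qed
    qed
    then have "AE \<omega> in P. \<forall>k. \<forall>\<^sub>F n in sequentially. \<forall>j\<in>{1..l'}. \<bar>X n \<omega> j - m j\<bar> < inverse (real (Suc k))"
      by (subst AE_all_countable) simp
    then show ?thesis
    proof eventually_elim
      case (elim \<omega>)
      have "(\<lambda>n. X n \<omega> j) \<longlonglongrightarrow> m j" if j: "j \<in> {1..l}" for j
      proof (rule tendstoI)
        fix e :: real assume "0 < e"
        then obtain k where k: "inverse (real (Suc k)) < e" using reals_Archimedean by blast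
        from elim have "\<forall>\<^sub>F n in sequentially. \<forall>j\<in>{1..l'}. \<bar>X n \<omega> j - m j\<bar> < inverse (real (Suc k))" by blast
        then show "\<forall>\<^sub>F n in sequentially. dist (X n \<omega> j) (m j) < e"
        proof eventually_elim
          case (elim n)
          then have "\<bar>X n \<omega> j - m j\<bar> < inverse (real (Suc k))" using j l'(2) by simp
          then show ?case using k by (simp add: dist_real_def)
        qed
      qed
      then show ?case
        unfolding limitin_componentwise
        by (auto simp: moment_vector_def m_def)
    qed
  qed
  have dens: "\<mu> = density lborel
      (\<lambda>x. ennreal (indicat_real {0..1} x / (poly (smult pi q) x * sqrt (x * (1 - x)))))"
    unfolding \<mu>_def by (rule tilted_arcsine_eq_density[OF q_pos])
  have \<mu>C: "\<mu> \<in> constrained_measures C {0..1}"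
  proof -
    have "moment i \<mu> = c" if "C i = Some c" for i c
      using m_con[of i] that by (auto simp: m_def constraint_value_def)
    then show ?thesis using \<mu> by (simp add: constrained_measures_def)
  qed
  have uniq: "\<nu> = \<mu>"
    if \<nu>: "\<nu> \<in> constrained_measures C {0..1}" and le: "kullback_leibler arcsine \<nu> \<le> kullback_leibler arcsine \<mu>" for \<nu>
  proof -
    have \<nu>m: "\<nu> \<in> moment_measures {0..1}" using \<nu> by (simp add: constrained_measures_def)
    \<comment> \<open>All measures that satisfy the constraint give \<open>q\<close> the same mean,
      because \<open>q\<close> involves only constrained powers and the constant.\<close>
    have "(\<integral>x. poly q x \<partial>\<nu>) = moment_functional (\<lambda>i. moment i \<nu>) q"
      by (rule moment_functional_moment[OF \<nu>m, symmetric]) auto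
    also have "\<dots> = moment_functional m q"
      by (rule moment_functional_cong_support)
        (use supp m_con constraint_value_moment[OF C \<nu>] in metis)
    also have "\<dots> = 1" by (rule moment_functional_self[OF q_pos m_eq order.refl])
    finally show ?thesis
      using \<nu>m le integrable_poly_moment_measure[OF \<nu>m] unfolding \<mu>_def
      by (intro eq_tilted_arcsine_if_kullback_leibler_le[OF q_pos mean]) (auto simp: moment_measures_def)
  qed
  show ?thesis
  proof (intro bexI[OF _ \<mu>] conjI allI)
    show "\<exists>S :: real poly. degree S \<le> last_index C \<and> (\<forall>x\<in>{0..1}. 0 < poly S x) \<and>
       \<mu> = density lborel (\<lambda>x. ennreal (indicat_real {0..1} x / (poly S x * sqrt (x * (1 - x)))))"
      \<comment> \<open>The factor \<open>pi\<close> of the arcsine density is absorbed into the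
        polynomial.\<close>
      using q_deg q_pos dens by (intro exI[of _ "smult pi q"]) (auto intro: order_trans[OF degree_smult_le])
    fix \<nu>
    show "is_arg_min (kullback_leibler arcsine) (\<lambda>\<nu>. \<nu> \<in> constrained_measures C {0..1}) \<nu> \<longleftrightarrow> \<nu> = \<mu>"
    proof
      assume "is_arg_min (kullback_leibler arcsine) (\<lambda>\<nu>. \<nu> \<in> constrained_measures C {0..1}) \<nu>"
      then show "\<nu> = \<mu>" using \<mu>C by (intro uniq) (auto simp: is_arg_min_def not_less)
    next
      assume "\<nu> = \<mu>"
      \<comment> \<open>A strictly better competitor would coincide with \<open>\<mu>\<close> by
        \<open>uniq\<close>, which contradicts strictness.\<close>
      moreover have "\<not> kullback_leibler arcsine y < kullback_leibler arcsine \<mu>"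
        if "y \<in> constrained_measures C {0..1}" for y
        using uniq[OF that] by fastforce
      ultimately show "is_arg_min (kullback_leibler arcsine) (\<lambda>\<nu>. \<nu> \<in> constrained_measures C {0..1}) \<nu>"
        using \<mu>C unfolding is_arg_min_def by blast
    qed
  qed (rule conv)
qed

end
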